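(* For all $m\ge1$ and $0\le k\le m$, every coefficient $x\in\mathrm U(\widehat{\mathfrak g}^{+})$ of the power series $\vartheta^{(k)}_m$ belongs to $\mathfrak z_{\mathrm{tr}}(\widehat{\mathfrak{gl}}_N)$; that is, the vector $x\,\mathbf 1\in V_{\mathrm{tr}}(\mathfrak{gl}_N)$ satisfies $E_{ij}[n]\,x\mathbf 1=0$ for all $i,j$ and $n\ge1$, and $E_{ij}[0]\,x\mathbf 1=0$ for all $i\ge j$.
   Context: Let $E_{ij}$ be the standard basis of $\mathfrak{gl}_N$, $e_{ij}$ the matrix units. The affine Lie algebra $\widehat{\mathfrak{gl}}_N=\mathfrak{gl}_N[t,t^{-1}]\oplus\mathbb CK$ has $K$ central and, with $E_{ij}[r]=E_{ij}t^r$, $[E_{ij}[r],E_{kl}[s]]=\delta_{kj}E_{il}[r+s]-\delta_{il}E_{kj}[r+s]+r\delta_{r,-s}K(\delta_{kj}\delta_{il}-\delta_{ij}\delta_{kl}/N)$. Let $\mathfrak b^+$ be the span of $E_{ij}[0]$, $i\le j$, and $\widehat{\mathfrak g}^{+}=\mathfrak b^+\oplus t^{-1}\mathfrak{gl}_N[t^{-1}]$, a Lie subalgebra. The (trigonometric) vacuum module at the critical level $V_{\mathrm{tr}}(\mathfrak{gl}_N)$ is the $\widehat{\mathfrak{gl}}_N$-module generated by a vector $\mathbf 1$ subject only to $K\mathbf 1=-N\mathbf 1$, $E_{ij}[n]\mathbf 1=0$ for all $i,j$ and $n\ge1$, and $E_{ij}[0]\mathbf 1=0$ for $i\ge j$.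 The map $x\mapsto x\mathbf 1$ identifies $\mathrm U(\widehat{\mathfrak g}^{+})$ with $V_{\mathrm{tr}}(\mathfrak{gl}_N)$ as vector spaces. Its subspace of invariants is $\mathfrak z_{\mathrm{tr}}(\widehat{\mathfrak{gl}}_N)=\{v: E_{ij}[n]v=0\ \forall i,j,\ n\ge1;\ E_{ij}[0]v=0\ \forall i\ge j\}$, regarded as a subspace of $\mathrm U(\widehat{\mathfrak g}^{+})$ via this identification. Use $\mathrm{sgn}(0)=0$. Let $\mathcal L^+(u)=\sum_{i,j}e_{ij}\otimes\mathcal L^+_{ij}(u)$ with $\mathcal L^+_{ij}(u)=\sum_{n\ge0}\mathcal L^+_{ij}[-n]u^n$, $\mathcal L^+_{ij}[-n]=-2E_{ij}[-n]$ ($n\ge1$), $\mathcal L^+_{ij}[0]=-(1+\mathrm{sgn}(j-i))E_{ij}[0]$. Differential operators in $\mathrm U(\widehat{\mathfrak g}^{+})[[u,\partial_u]]$: $\partial_u$ commutes with $\mathrm U(\widehat{\mathfrak g}^{+})$, $\partial_u g(u)=g(u)\partial_u+g'(u)$. Let $\rho=\mathrm{diag}[N-1,N-3,\dots,-N+1]$, $\overline{\mathcal L}=2u\partial_u\cdot I-\rho-\mathcal L^+(u)$; subscripts denote tensor copies of $\mathrm{End}\,\mathbb C^N$. Let $T(y)=\sum_{i}e_{ii}\otimes e_{ii}+\frac{1}{1-y}\sum_{i<j}e_{ij}\otimes e_{ji}+\frac{1}{1+y}\sum_{i>j}e_{ij}\otimes e_{ji}$ (power series in $y$), and define $\vartheta_m$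 by $\sum_{m\ge1}\vartheta_m y^m=\sum_{s\ge1}y^s\,\mathrm{tr}_{1,\dots,s}\,T_{s-1\,s}(y)\cdots T_{12}(y)\,\overline{\mathcal L}_1\cdots\overline{\mathcal L}_s$. Write $\vartheta_m=\sum_{k=0}^m\vartheta^{(k)}_m\partial_u^{m-k}$ with $\vartheta^{(k)}_m\in\mathrm U(\widehat{\mathfrak g}^{+})[[u]]$ to the left. *)

theory Defs
  imports Complex_Main "HOL-Library.Function_Algebras"
begin

text \<open>Generators: E i j r stands for E_ij[r] (indices 1..N), Kc for the central element K.\<close>
datatype gen = E nat nat int | Kc

type_synonym word = "gen list"

text \<open>Elements of the free associative algebra on the generators, given by their
coefficient functions on words (only finitely supported elements matter below).
Addition, zero and negation are pointwise (Function_Algebras); the algebra product is fmul.\<close>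
type_synonym falg = "word \<Rightarrow> complex"

definition fword :: "word \<Rightarrow> falg" where
  "fword v = (\<lambda>w. if w = v then 1 else 0)"

definition fone :: falg where "fone = fword []"

definition fgen :: "gen \<Rightarrow> falg" where "fgen g = fword [g]"

definition fscale :: "complex \<Rightarrow> falg \<Rightarrow> falg" where
  "fscale c p = (\<lambda>w. c * p w)"

definition fmul :: "falg \<Rightarrow> falg \<Rightarrow> falg" where
  "fmul p q = (\<lambda>w. \<Sum>i\<le>length w. p (take i w) * q (drop i w))"

definition kron :: "nat \<Rightarrow> nat \<Rightarrow> complex" where
  "kron i j = (if i = j then 1 else 0)"

fun lbr :: "nat \<Rightarrow> gen \<Rightarrow> gen \<Rightarrow> falg" where
  "lbr N (E i j r) (E k l s) =
     fscale (kron k j) (fgen (E i l (r + s)))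
   - fscale (kron i l) (fgen (E k j (r + s)))
   + fscale (of_int r * (if r = - s then 1 else 0) *
             (kron k j * kron i l - kron i j * kron k l / of_nat N)) (fgen Kc)"
| "lbr N _ _ = 0"

fun valid_gen :: "nat \<Rightarrow> gen \<Rightarrow> bool" where
  "valid_gen N (E i j r) = (1 \<le> i \<and> i \<le> N \<and> 1 \<le> j \<and> j \<le> N)"
| "valid_gen N Kc = True"

text \<open>V_tr = F / vac_ideal N, where F is the free algebra on the generators and
vac_ideal N is the left ideal spanned by the two-sided ideal of the Lie relations
(which gives U of the affine algebra) together with the left ideal generated by
K + N, E_ij[n] (n \<ge> 1) and E_ij[0] (i \<ge> j). The class of x is x acting on the vacuum 1.\<close>
inductive_set vac_ideal :: "nat \<Rightarrow> falg set" for N :: nat where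
  zero: "0 \<in> vac_ideal N"
| add: "p \<in> vac_ideal N \<Longrightarrow> q \<in> vac_ideal N \<Longrightarrow> p + q \<in> vac_ideal N"
| scale: "p \<in> vac_ideal N \<Longrightarrow> fscale c p \<in> vac_ideal N"
| lie: "valid_gen N g \<Longrightarrow> valid_gen N h \<Longrightarrow>
     fmul (fword a) (fmul (fmul (fgen g) (fgen h) - fmul (fgen h) (fgen g) - lbr N g h) (fword b))
       \<in> vac_ideal N"
| central: "fmul (fword a) (fgen Kc + fscale (of_nat N) fone) \<in> vac_ideal N"
| pos: "1 \<le> i \<Longrightarrow> i \<le> N \<Longrightarrow> 1 \<le> j \<Longrightarrow> j \<le> N \<Longrightarrow> n \<ge> 1 \<Longrightarrow>
     fmul (fword a) (fgen (E i j n)) \<in> vac_ideal N"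
| zero_low: "1 \<le> i \<Longrightarrow> i \<le> N \<Longrightarrow> 1 \<le> j \<Longrightarrow> j \<le> N \<Longrightarrow> j \<le> i \<Longrightarrow>
     fmul (fword a) (fgen (E i j 0)) \<in> vac_ideal N"

text \<open>x (an element of U(g^+), represented in F) lies in z_tr iff the vector x 1 is
annihilated by E_ij[n], n \<ge> 1, and E_ij[0], i \<ge> j.\<close>
definition in_ztr :: "nat \<Rightarrow> falg \<Rightarrow> bool" where
  "in_ztr N x \<longleftrightarrow>
     (\<forall>i j n. 1 \<le> i \<and> i \<le> N \<and> 1 \<le> j \<and> j \<le> N \<and> n \<ge> 1 \<longrightarrow>
        fmul (fgen (E i j n)) x \<in> vac_ideal N) \<and>
     (\<forall>i j. 1 \<le> i \<and> i \<le> N \<and> 1 \<le> j \<and> j \<le> N \<and> j \<le> i \<longrightarrow>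
        fmul (fgen (E i j 0)) x \<in> vac_ideal N)"

text \<open>A power series in u with coefficients in F: n-th coefficient.\<close>
type_synonym useries = "nat \<Rightarrow> falg"

definition smul :: "useries \<Rightarrow> useries \<Rightarrow> useries" where
  "smul f g = (\<lambda>n. \<Sum>p\<le>n. fmul (f p) (g (n - p)))"

definition sderiv :: "useries \<Rightarrow> useries" where
  "sderiv f = (\<lambda>n. fscale (of_nat (Suc n)) (f (Suc n)))"

text \<open>A differential operator sum_a g_a(u) d^a (coefficients to the left): a-th coefficient.\<close>
type_synonym dop = "nat \<Rightarrow> useries"

definition dscale :: "complex \<Rightarrow> dop \<Rightarrow> dop" where
  "dscale c P = (\<lambda>a n. fscale c (P a n))"

definition dunit :: dop where
  "dunit = (\<lambda>a n. if a = 0 \<and> n = 0 then fone else 0)"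

text \<open>Left multiplication by a first order operator c0(u) + c1(u) d, using
d g(u) = g(u) d + g'(u):  (c0 + c1 d)(q_b d^b) = c0 q_b d^b + c1 q_b' d^b + c1 q_b d^(b+1).\<close>
definition dmul1 :: "useries \<times> useries \<Rightarrow> dop \<Rightarrow> dop" where
  "dmul1 c Q = (\<lambda>b. smul (fst c) (Q b) + smul (snd c) (sderiv (Q b))
                   + (if b = 0 then 0 else smul (snd c) (Q (b - 1))))"

definition rho :: "nat \<Rightarrow> nat \<Rightarrow> complex" where
  "rho N i = of_int (int N + 1 - 2 * int i)"

definition Lplus :: "nat \<Rightarrow> nat \<Rightarrow> useries" where
  "Lplus i j n = (if n = 0 then fscale (- (1 + of_int (sgn (int j - int i)))) (fgen (E i j 0))
                  else fscale (-2) (fgen (E i j (- int n))))"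

text \<open>(i,j) entry of Lbar = 2 u d I - rho - L^+(u), as first order operator (c0, c1).\<close>
definition Lbar :: "nat \<Rightarrow> nat \<Rightarrow> nat \<Rightarrow> useries \<times> useries" where
  "Lbar N i j =
     ((\<lambda>n. (if n = 0 \<and> i = j then fscale (- rho N i) fone else 0) - Lplus i j n),
      (\<lambda>n. if n = 1 \<and> i = j then fscale 2 fone else 0))"

fun Lbar_prod :: "nat \<Rightarrow> (nat \<times> nat) list \<Rightarrow> dop" where
  "Lbar_prod N [] = dunit"
| "Lbar_prod N ((i, j) # ps) = dmul1 (Lbar N i j) (Lbar_prod N ps)"

text \<open>Basis multi-indices of (C^N)^{\<otimes> s}; slot a (1-based) is list position a - 1.\<close>
definition Idx :: "nat \<Rightarrow> nat \<Rightarrow> nat list set" where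
  "Idx N s = {K. length K = s \<and> set K \<subseteq> {1..N}}"

text \<open>Entries: K K' n gives the coefficient of y^n of the (K,K') matrix entry.\<close>
type_synonym ymat = "nat list \<Rightarrow> nat list \<Rightarrow> nat \<Rightarrow> complex"

definition ymul :: "nat \<Rightarrow> nat \<Rightarrow> ymat \<Rightarrow> ymat \<Rightarrow> ymat" where
  "ymul N s A B = (\<lambda>K K' n. \<Sum>M\<in>Idx N s. \<Sum>p\<le>n. A K M p * B M K' (n - p))"

definition yid :: ymat where
  "yid = (\<lambda>K K' n. if K = K' \<and> n = 0 then 1 else 0)"

definition tcoef :: "nat \<Rightarrow> nat \<Rightarrow> nat \<Rightarrow> complex" where
  "tcoef i j n = (if i = j then (if n = 0 then 1 else 0)
                  else if i < j then 1 else (-1) ^ n)"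

text \<open>T_{ab}(y) acting on slots a, b of (C^N)^{\<otimes> s}: sum of tcoef i j times
e_ij in slot a and e_ji in slot b (identity in the other slots).\<close>
definition Tslot :: "nat \<Rightarrow> nat \<Rightarrow> nat \<Rightarrow> nat \<Rightarrow> ymat" where
  "Tslot N s a b = (\<lambda>K K' n. \<Sum>i\<in>{1..N}. \<Sum>j\<in>{1..N}.
      tcoef i j n *
      (if K ! (a - 1) = i \<and> K' ! (a - 1) = j \<and> K ! (b - 1) = j \<and> K' ! (b - 1) = i
          \<and> (\<forall>c<s. c \<noteq> a - 1 \<and> c \<noteq> b - 1 \<longrightarrow> K ! c = K' ! c) then 1 else 0))"

fun Tchain :: "nat \<Rightarrow> nat \<Rightarrow> nat \<Rightarrow> ymat" where
  "Tchain N s 0 = yid"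
| "Tchain N s (Suc r) = ymul N s (Tslot N s (Suc r) (Suc (Suc r))) (Tchain N s r)"

text \<open>Coefficient of y^n in tr_{1..s} T_{s-1 s}(y)...T_{12}(y) Lbar_1 ... Lbar_s.
The (J,I) entry of Lbar_1...Lbar_s is Lbar_{j1 i1} ... Lbar_{js is}.\<close>
definition trace_coef :: "nat \<Rightarrow> nat \<Rightarrow> nat \<Rightarrow> dop" where
  "trace_coef N s n =
     (\<Sum>I\<in>Idx N s. \<Sum>J\<in>Idx N s. dscale (Tchain N s (s - 1) I J n) (Lbar_prod N (zip J I)))"

text \<open>theta_m = coefficient of y^m in sum_{s \<ge> 1} y^s tr(...).\<close>
definition theta :: "nat \<Rightarrow> nat \<Rightarrow> dop" where
  "theta N m = (\<Sum>s\<in>{1..m}. trace_coef N s (m - s))"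

definition theta_k :: "nat \<Rightarrow> nat \<Rightarrow> nat \<Rightarrow> useries" where
  "theta_k N m k = theta N m (m - k)"

end

(*
  Write L for the matrix 2u d - rho - L^+(u) and S_c = diag_a(sgn(c - a)). The product of the
  T-matrices in the trace collapses to a cyclic permutation with scalar weights, the geometric
  series in y resum, and theta_m = sum_c ((L + S_c)^m)_cc.

  The entries of L satisfy a linear deformation of the Manin relations
  [L_ab, L_cd] = [L_cb, L_ad]. The annihilating subalgebra is generated by the simple root vectors
  E_{j+1,j}[0] and E_{1N}[1], the Cartan elements E_ii[0] and the central elements sum_i E_ii[n].
  The last two kinds commute with theta_m. Moving a simple root vector F through the powers of
  L + S_c gives a linear recurrence; at the critical level its solution reduces F theta_m, modulo the
  left ideal generated by F and a Cartan element, to an identity between entries of one column of the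
  resolvents of shifts of L. That identity follows from the Manin relations: the sums
  w_m(p,q) = sum_{a+b=m} ((L - S_q)^a)_pc ((L - S_c)^b)_qc are symmetric in p and q.
*)
theory Submission
  imports Defs "HOL-Computational_Algebra.Formal_Power_Series"
begin

section \<open>Matrices over a noncommutative ring\<close>

text \<open>\<open>vac_ideal\<close> is only a left ideal, so its quotient is a module and not a
  ring. The relations are therefore stated for additive endomorphisms: entries of L become left
  multiplications on differential operators whose coefficients are vectors of the vacuum module, and
  all identities between them are instances of identities for matrices over an arbitrary
  noncommutative ring. Applied to the vacuum, such an operator returns all its coefficient vectors
  at once.

  The matrices S_c have two roles. They record the factors 1/(1 - y) and 1/(1 + y) of T, and for the
  index pair (c, q) of a simple root S_c - S_q equals -E_cc - E_qq up to a scalar 2 eps. This low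
  rank is why only the summands of the indices c and q matter when F is moved through theta_m, and
  why these two cancel.

  The shift rho and the level meet in the number rho_c - rho_q - 2. It is 0 for a finite simple root
  and -2N for the affine one, where it compensates the central term produced by K = -N. Both kinds
  of root then obey the same abstract relations.\<close>

definition mmul :: "nat \<Rightarrow> (nat \<Rightarrow> nat \<Rightarrow> 'a::ring_1) \<Rightarrow> (nat \<Rightarrow> nat \<Rightarrow> 'a) \<Rightarrow> nat \<Rightarrow> nat \<Rightarrow> 'a" where
  "mmul N A B = (\<lambda>i j. \<Sum>k=1..N. A i k * B k j)"

primrec mpow :: "nat \<Rightarrow> (nat \<Rightarrow> nat \<Rightarrow> 'a::ring_1) \<Rightarrow> nat \<Rightarrow> nat \<Rightarrow> nat \<Rightarrow> 'a" where
  "mpow N A 0 = (\<lambda>i j. if i = j then 1 else 0)"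
| "mpow N A (Suc n) = mmul N A (mpow N A n)"

text \<open>Integers are central in every ring, so a diagonal shift of this kind changes no
  commutator of matrix entries.\<close>

definition diag_of_int :: "(nat \<Rightarrow> int) \<Rightarrow> nat \<Rightarrow> nat \<Rightarrow> 'a::ring_1" where
  "diag_of_int f = (\<lambda>i j. if i = j then of_int (f i) else 0)"

definition sgd :: "nat \<Rightarrow> nat \<Rightarrow> int" where
  "sgd a b = sgn (int a - int b)"

lemma sgd_same [simp]: "sgd a a = 0"
  by (simp add: sgd_def)

lemma sgd_swap: "sgd a b = - sgd b a"
  by (simp add: sgd_def sgn_if)

lemma sum_delta_mult_left:
  fixes f :: "nat \<Rightarrow> 'a::ring_1"
  assumes "i \<in> {1..N}"
  shows "(\<Sum>k=1..N. (if i = k then g k else 0) * f k) = g i * f i"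
proof -
  have "(\<Sum>k=1..N. (if i = k then g k else 0) * f k) = (\<Sum>k\<in>{1..N}. if i = k then g k * f k else 0)"
    by (intro sum.cong) auto
  then show ?thesis
    using assms by (simp add: sum.delta)
qed

lemma sum_delta_mult_right:
  fixes f :: "nat \<Rightarrow> 'a::ring_1"
  assumes "i \<in> {1..N}"
  shows "(\<Sum>k=1..N. f k * (if k = i then g k else 0)) = f i * g i"
proof -
  have "(\<Sum>k=1..N. f k * (if k = i then g k else 0)) = (\<Sum>k\<in>{1..N}. if k = i then f k * g k else 0)"
    by (intro sum.cong) auto
  then show ?thesis
    using assms by (simp add: sum.delta')
qed

lemma mpow_Suc_diag_of_int:
  assumes "i \<in> {1..N}"
  shows "mpow N (A + diag_of_int f) (Suc n) i j
    = (\<Sum>k=1..N. A i k * mpow N (A + diag_of_int f) n k j) + of_int (f i) * mpow N (A + diag_of_int f) n i j"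
proof -
  have "mpow N (A + diag_of_int f) (Suc n) i j = (\<Sum>k=1..N. A i k * mpow N (A + diag_of_int f) n k j)
     + (\<Sum>k=1..N. (if i = k then of_int (f k) else 0) * mpow N (A + diag_of_int f) n k j)"
    by (simp add: mmul_def diag_of_int_def distrib_right sum.distrib cong: if_cong)
  then show ?thesis
    using sum_delta_mult_left[OF assms] by simp
qed

text \<open>Discrete variation of constants. The source \<open>s\<close> may itself involve
  \<open>Z\<close>; in \<open>mpow_perturb\<close> it is the perturbation applied to the perturbed
  power.\<close>

lemma linear_recurrence:
  fixes B :: "nat \<Rightarrow> nat \<Rightarrow> 'a::ring_1"
  assumes rec: "\<And>m i. i \<in> {1..N} \<Longrightarrow> Z (Suc m) i = (\<Sum>k=1..N. B i k * Z m k) + s m i"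
    and "i \<in> {1..N}"
  shows "Z m i = (\<Sum>k=1..N. mpow N B m i k * Z 0 k)
    + (\<Sum>a<m. \<Sum>k=1..N. mpow N B a i k * s (m - Suc a) k)"
  using assms(2)
proof (induction m arbitrary: i)
  case 0
  then show ?case
    using sum_delta_mult_left[of i N "\<lambda>_. 1" "Z 0"] by simp
next
  case (Suc m)
  have push: "(\<Sum>k=1..N. B i k * (\<Sum>l=1..N. mpow N B n k l * f l)) = (\<Sum>l=1..N. mpow N B (Suc n) i l * f l)"
    for n and f :: "nat \<Rightarrow> 'a"
    by (simp add: mmul_def sum_distrib_left sum_distrib_right mult.assoc) (rule sum.swap)
  have "Z (Suc m) i = (\<Sum>k=1..N. B i k * Z m k) + s m i"
    using rec Suc.prems by simp
  also have "(\<Sum>k=1..N. B i k * Z m k) =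
     (\<Sum>k=1..N. B i k * ((\<Sum>l=1..N. mpow N B m k l * Z 0 l)
    + (\<Sum>a<m. \<Sum>l=1..N. mpow N B a k l * s (m - Suc a) l)))"
    by (intro sum.cong refl) (subst Suc.IH, auto)
  also have "\<dots> = (\<Sum>l=1..N. mpow N B (Suc m) i l * Z 0 l)
      + (\<Sum>k=1..N. \<Sum>a<m. B i k * (\<Sum>l=1..N. mpow N B a k l * s (m - Suc a) l))"
    by (simp only: distrib_left sum.distrib push sum_distrib_left[of _ _ "{..<m}"])
  also have "(\<Sum>k=1..N. \<Sum>a<m. B i k * (\<Sum>l=1..N. mpow N B a k l * s (m - Suc a) l))
     = (\<Sum>a<m. \<Sum>l=1..N. mpow N B (Suc a) i l * s (m - Suc a) l)"
    by (subst sum.swap) (simp only: push)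
  also have "s m i = (\<Sum>k=1..N. mpow N B 0 i k * s m k)"
    using sum_delta_mult_left[OF Suc.prems, of "\<lambda>_. 1" "s m"] by simp
  finally show ?case
    by (simp only: sum.lessThan_Suc_shift diff_Suc_Suc diff_zero minus_nat.diff_0 add_ac)
qed

text \<open>The relations satisfied by the entries of \<open>2u\<partial> - \<rho> - L\<^sup>+(u)\<close>. All terms with a diagonal
  entry on the right-hand side have coefficient 0, so the relations survive adding a scalar
  diagonal matrix to \<open>X\<close>.\<close>
locale trig_manin =
  fixes N :: nat and X :: "nat \<Rightarrow> nat \<Rightarrow> 'a::ring_1"
  assumes two_cancel: "\<And>x::'a. x + x = 0 \<Longrightarrow> x = 0"
    and rel: "\<And>a b c d. a \<in> {1..N} \<Longrightarrow> b \<in> {1..N} \<Longrightarrow> c \<in> {1..N} \<Longrightarrow> d \<in> {1..N} \<Longrightarrow>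
      X a b * X c d - X c d * X a b - (X c b * X a d - X a d * X c b)
      = (if b = c then of_int (sgd b a + sgd d b) * X a d else 0)
      - (if a = d then of_int (sgd b a + sgd a c) * X c b else 0)
      - (if a = b then of_int (sgd b c + sgd d b) * X c d else 0)
      + (if c = d then of_int (sgd b c + sgd c a) * X a b else 0)"
begin

lemma shift: "trig_manin N (X + diag_of_int f)"
proof
  fix x :: 'a
  show "x + x = 0 \<Longrightarrow> x = 0" by (rule two_cancel)
next
  fix a b c d assume I: "a \<in> {1..N}" "b \<in> {1..N}" "c \<in> {1..N}" "d \<in> {1..N}"
  have comm: "(x + diag_of_int f i j) * (y + diag_of_int f k l) - (y + diag_of_int f k l) * (x + diag_of_int f i j) = x * y - y * x"
    for x y :: 'a and i j k l
    by (simp add: diag_of_int_def algebra_simps mult_of_int_commute)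
  have "of_int (sgd b a + sgd d b) * diag_of_int f a d = (0::'a)"
    by (cases "a = d") (auto simp: diag_of_int_def sgd_swap[of b])
  moreover have "of_int (sgd b a + sgd a c) * diag_of_int f c b = (0::'a)"
    by (cases "c = b") (auto simp: diag_of_int_def sgd_swap[of a])
  moreover have "of_int (sgd b c + sgd d b) * diag_of_int f c d = (0::'a)"
    by (cases "c = d") (auto simp: diag_of_int_def sgd_swap[of b])
  moreover have "of_int (sgd b c + sgd c a) * diag_of_int f a b = (0::'a)"
    by (cases "a = b") (auto simp: diag_of_int_def sgd_swap[of c])
  ultimately show "(X + diag_of_int f) a b * (X + diag_of_int f) c d - (X + diag_of_int f) c d * (X + diag_of_int f) a b
        - ((X + diag_of_int f) c b * (X + diag_of_int f) a d - (X + diag_of_int f) a d * (X + diag_of_int f) c b)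
      = (if b = c then of_int (sgd b a + sgd d b) * (X + diag_of_int f) a d else 0)
      - (if a = d then of_int (sgd b a + sgd a c) * (X + diag_of_int f) c b else 0)
      - (if a = b then of_int (sgd b c + sgd d b) * (X + diag_of_int f) c d else 0)
      + (if c = d then of_int (sgd b c + sgd c a) * (X + diag_of_int f) a b else 0)"
    unfolding plus_fun_apply comm using rel[OF I] by (simp only: distrib_left add_0_right)
qed

text \<open>For fixed q this is X + diag(sgd i q) applied to the first index of \<open>w\<close>;
  \<open>slot2\<close> is X + diag(sgd i p) applied to the second index. The signs are opposite, so
  they cancel in the sum of the two operators.\<close>

definition slot1 :: "(nat \<Rightarrow> nat \<Rightarrow> 'a) \<Rightarrow> nat \<Rightarrow> nat \<Rightarrow> 'a" where
  "slot1 w p q = (\<Sum>k=1..N. X p k * w k q) + of_int (sgd p q) * w p q"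

definition slot2 :: "(nat \<Rightarrow> nat \<Rightarrow> 'a) \<Rightarrow> nat \<Rightarrow> nat \<Rightarrow> 'a" where
  "slot2 w p q = (\<Sum>k=1..N. X q k * w p k) + of_int (sgd q p) * w p q"

text \<open>Symmetry of \<open>w\<close> allows the summation indices of the quadratic part to be
  exchanged. Twice its antisymmetric part in p and q is then a sum of the combinations [X_pk, X_ql]
  - [X_qk, X_pl], which \<open>rel\<close> makes linear in X. These linear terms cancel those that
  the signs in the two slots produce, and \<open>two_cancel\<close> removes the doubling.\<close>

lemma slot2_slot1_symmetric:
  assumes sym: "\<And>p q. p \<in> {1..N} \<Longrightarrow> q \<in> {1..N} \<Longrightarrow> w p q = w q p"
    and pq: "p \<in> {1..N}" "q \<in> {1..N}"
  shows "slot2 (slot1 w) p q = slot2 (slot1 w) q p"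
proof -
  define T where "T p q = (\<Sum>l=1..N. \<Sum>k=1..N. X q l * X p k * w k l)" for p q
  define U where "U p q = (\<Sum>l=1..N. of_int (sgd p l) * (X q l * w p l))" for p q
  define W where "W p q = (\<Sum>l=1..N. X q l * w p l)" for p q
  have CCBB: "slot2 (slot1 w) p q = T p q + U p q + of_int (sgd q p) * W q p - of_int (sgd q p * sgd q p) * w p q"
    if "p \<in> {1..N}" "q \<in> {1..N}" for p q
  proof -
    have "(\<Sum>k=1..N. X p k * w k q) = W q p"
      unfolding W_def using that by (intro sum.cong refl) (simp add: sym)
    moreover have "(\<Sum>l=1..N. X q l * ((\<Sum>k=1..N. X p k * w k l) + of_int (sgd p l) * w p l)) = T p q + U p q"
      unfolding T_def U_def
      by (simp add: distrib_left sum.distrib sum_distrib_left mult.assoc mult_of_int_commute)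
    ultimately show ?thesis
      unfolding slot2_def slot1_def by (simp add: distrib_left right_diff_distrib sgd_swap[of p q] mult.assoc)
  qed
  have swapT: "T p q = (\<Sum>l=1..N. \<Sum>k=1..N. X q k * X p l * w k l)"
    if "p \<in> {1..N}" "q \<in> {1..N}" for p q
    unfolding T_def
    by (subst sum.swap, intro sum.cong refl) (simp add: sym)
  have "(T p q - T q p) + (T p q - T q p)
     = (\<Sum>l=1..N. \<Sum>k=1..N. X q l * X p k * w k l) - (\<Sum>l=1..N. \<Sum>k=1..N. X p l * X q k * w k l)
     + ((\<Sum>l=1..N. \<Sum>k=1..N. X q k * X p l * w k l) - (\<Sum>l=1..N. \<Sum>k=1..N. X p k * X q l * w k l))"
    by (simp only: T_def[of p q, symmetric] T_def[of q p, symmetric]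
        swapT[OF pq, symmetric] swapT[OF pq(2,1), symmetric])
  also have "\<dots> = (\<Sum>l=1..N. \<Sum>k=1..N.
      - (X p k * X q l - X q l * X p k - (X q k * X p l - X p l * X q k)) * w k l)"
    unfolding sum_subtractf[symmetric] sum.distrib[symmetric]
    by (intro sum.cong refl) (simp add: algebra_simps)
  also have "\<dots> = (\<Sum>l=1..N. \<Sum>k=1..N.
      - ((if k = q then of_int (sgd k p + sgd l k) * X p l else 0)
      - (if p = l then of_int (sgd k p + sgd p q) * X q k else 0)
      - (if p = k then of_int (sgd k q + sgd l k) * X q l else 0)
      + (if q = l then of_int (sgd k q + sgd q p) * X p k else 0)) * w k l)"
    by (intro sum.cong refl, subst rel, use pq in auto)
  also have "\<dots> =
      - (\<Sum>l=1..N. \<Sum>k=1..N. if k = q then of_int (sgd k p + sgd l k) * X p l * w k l else 0)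
      + (\<Sum>l=1..N. \<Sum>k=1..N. if l = p then of_int (sgd k p + sgd p q) * X q k * w k l else 0)
      + (\<Sum>l=1..N. \<Sum>k=1..N. if k = p then of_int (sgd k q + sgd l k) * X q l * w k l else 0)
      - (\<Sum>l=1..N. \<Sum>k=1..N. if l = q then of_int (sgd k q + sgd q p) * X p k * w k l else 0)"
    unfolding sum_subtractf[symmetric] sum.distrib[symmetric] sum_negf[symmetric]
    by (intro sum.cong refl) (simp add: algebra_simps)
  also have "\<dots> =
      - (\<Sum>l=1..N. of_int (sgd q p + sgd l q) * X p l * w q l)
      + (\<Sum>l=1..N. of_int (sgd l p + sgd p q) * X q l * w p l)
      + (\<Sum>l=1..N. of_int (sgd p q + sgd l p) * X q l * w p l)
      - (\<Sum>l=1..N. of_int (sgd l q + sgd q p) * X p l * w q l)"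
  proof -
    have 1: "(\<Sum>l=1..N. \<Sum>k=1..N. if k = r then f l k else 0) = (\<Sum>l=1..N. f l r)"
      if "r \<in> {1..N}" for f :: "nat \<Rightarrow> nat \<Rightarrow> 'a" and r
      using that by simp
    have 2: "(\<Sum>l=1..N. \<Sum>k=1..N. if l = r then f l k else 0) = (\<Sum>k=1..N. f r k)"
      if "r \<in> {1..N}" for f :: "nat \<Rightarrow> nat \<Rightarrow> 'a" and r
      by (subst sum.swap) (rule 1[OF that])
    have "(\<Sum>k=1..N. of_int (sgd k p + sgd p q) * X q k * w k p) = (\<Sum>k=1..N. of_int (sgd k p + sgd p q) * X q k * w p k)"
      "(\<Sum>k=1..N. of_int (sgd k q + sgd q p) * X p k * w k q) = (\<Sum>k=1..N. of_int (sgd k q + sgd q p) * X p k * w q k)"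
      using pq sym by (auto intro!: sum.cong)
    then show ?thesis
      unfolding 1[OF pq(1)] 1[OF pq(2)] 2[OF pq(1)] 2[OF pq(2)] by (simp only:)
  qed
  also have "\<dots> = - (of_int (sgd q p) * W q p - U q p) + (of_int (sgd p q) * W p q - U p q)
         + (of_int (sgd p q) * W p q - U p q) - (of_int (sgd q p) * W q p - U q p)"
  proof -
    have "of_int (sgd l x + sgd x y) = (of_int (sgd x y) - of_int (sgd x l) :: 'a)"
      "of_int (sgd x y + sgd l x) = (of_int (sgd x y) - of_int (sgd x l) :: 'a)" for l x y
      by (simp_all add: sgd_swap[of l x])
    then show ?thesis
      unfolding U_def W_def
      by (simp only: left_diff_distrib sum_subtractf sum_distrib_left mult.assoc)
  qed
  finally have T: "(T p q - T q p) + (T p q - T q p) = \<dots>" .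
  have "(slot2 (slot1 w) p q - slot2 (slot1 w) q p) + (slot2 (slot1 w) p q - slot2 (slot1 w) q p) = 0"
    using T unfolding CCBB[OF pq] CCBB[OF pq(2,1)] sym[OF pq(2,1)]
    by (simp add: sgd_swap[of p q] algebra_simps)
  then have "slot2 (slot1 w) p q - slot2 (slot1 w) q p = 0"
    by (rule two_cancel)
  then show ?thesis by simp
qed

text \<open>If \<open>w\<^sub>m p q\<close> denotes the left-hand side, \<open>B = slot1\<close> and \<open>C = slot2\<close>, then
  \<open>w\<^sub>m\<^sub>+\<^sub>2 = (B + C) w\<^sub>m\<^sub>+\<^sub>1 - C B w\<^sub>m\<close>, and both \<open>B + C\<close> and \<open>C B\<close> preserve symmetry.\<close>
lemma mpow_column_symmetric:
  assumes c: "c \<in> {1..N}" and pq: "p \<in> {1..N}" "q \<in> {1..N}"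
  shows "(\<Sum>a\<le>m. mpow N (X + diag_of_int (\<lambda>i. sgd i q)) a p c * mpow N (X + diag_of_int (\<lambda>i. sgd i c)) (m - a) q c)
    = (\<Sum>a\<le>m. mpow N (X + diag_of_int (\<lambda>i. sgd i p)) a q c * mpow N (X + diag_of_int (\<lambda>i. sgd i c)) (m - a) p c)"
proof -
  define v where "v m q = mpow N (X + diag_of_int (\<lambda>i. sgd i c)) m q c" for m q
  define w where "w m p q = (\<Sum>a\<le>m. mpow N (X + diag_of_int (\<lambda>i. sgd i q)) a p c * v (m - a) q)" for m p q
  \<comment> \<open>\<open>d m\<close> is the summand a = 0 of \<open>w m\<close>, nonzero only for
    p = c. There the sign in \<open>slot2\<close> is sgd q c, the one in the recursion of
    \<open>v\<close>, so \<open>d\<close> evolves by \<open>slot2\<close> alone. Since d (m + 1) is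
    w (m + 1) minus \<open>slot1\<close> of w m, it can be eliminated, which gives a second-order
    recursion for \<open>w\<close>.\<close>
  define d where "d m p q = (if p = c then v m q else 0)" for m p q
  have w0: "w 0 p q = (if p = c \<and> q = c then 1 else 0)" for p q
    by (auto simp: w_def v_def)
  have wSuc: "w (Suc m) p q = slot1 (w m) p q + d (Suc m) p q" if "p \<in> {1..N}" for m p q
  proof -
    have "w (Suc m) p q = d (Suc m) p q
      + (\<Sum>a\<le>m. mpow N (X + diag_of_int (\<lambda>i. sgd i q)) (Suc a) p c * v (m - a) q)"
      unfolding w_def sum.atMost_Suc_shift by (simp add: d_def)
    also have "(\<Sum>a\<le>m. mpow N (X + diag_of_int (\<lambda>i. sgd i q)) (Suc a) p c * v (m - a) q) = slot1 (w m) p q"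
      unfolding slot1_def w_def mpow_Suc_diag_of_int[OF that]
      by (simp add: distrib_right sum.distrib sum_distrib_left sum_distrib_right mult.assoc)
        (rule sum.swap)
    finally show ?thesis by simp
  qed
  have dSuc: "d (Suc m) p q = slot2 (d m) p q" if "q \<in> {1..N}" for m p q
    unfolding d_def slot2_def v_def mpow_Suc_diag_of_int[OF that] by simp
  have BBCC: "slot1 f p q + slot2 f p q = (\<Sum>k=1..N. X p k * f k q) + (\<Sum>k=1..N. X q k * f p k)" for f p q
    unfolding slot1_def slot2_def by (simp add: sgd_swap[of q p])
  have slot2_add: "slot2 (\<lambda>p q. f p q - g p q) p q = slot2 f p q - slot2 g p q" for f g p q
    by (simp add: slot2_def algebra_simps sum_subtractf)
  have slot2_cong: "slot2 f p q = slot2 g p q" if "\<And>k. k \<in> {1..N} \<Longrightarrow> f p k = g p k" "q \<in> {1..N}" for f g p q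
    using that by (simp add: slot2_def)
  have wSS: "w (Suc (Suc m)) p q = slot1 (w (Suc m)) p q + slot2 (w (Suc m)) p q - slot2 (slot1 (w m)) p q"
    if pq: "p \<in> {1..N}" "q \<in> {1..N}" for m p q
  proof -
    have "d (Suc (Suc m)) p q = slot2 (\<lambda>p q. w (Suc m) p q - slot1 (w m) p q) p q"
      unfolding dSuc[OF pq(2), of "Suc m"] using wSuc[OF pq(1)] by (intro slot2_cong pq) simp
    then show ?thesis
      using wSuc[OF pq(1), of "Suc m" q] by (simp add: slot2_add)
  qed
  have sumsym: "slot1 f p q + slot2 f p q = slot1 f q p + slot2 f q p"
    if "\<And>p q. p \<in> {1..N} \<Longrightarrow> q \<in> {1..N} \<Longrightarrow> f p q = f q p" "p \<in> {1..N}" "q \<in> {1..N}" for f p q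
  proof -
    have "(\<Sum>k=1..N. X p k * f k q) = (\<Sum>k=1..N. X p k * f q k)"
      "(\<Sum>k=1..N. X q k * f p k) = (\<Sum>k=1..N. X q k * f k p)"
      using that by (auto intro!: sum.cong)
    then show ?thesis
      unfolding BBCC by (simp only: add.commute)
  qed
  have "w m p q = w m q p" if "p \<in> {1..N}" "q \<in> {1..N}" for p q
    using that
  proof (induction m arbitrary: p q rule: induct_nat_012)
    case 0
    then show ?case by (simp add: w0)
  next
    case 1
    have "d 0 = w 0"
      by (intro ext) (simp add: w0 d_def v_def)
    then have "w (Suc 0) p q = slot1 (w 0) p q + slot2 (w 0) p q" if "p \<in> {1..N}" "q \<in> {1..N}" for p q
      using wSuc[OF that(1), of 0 q] dSuc[OF that(2), of 0 p] by simp
    then show ?case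
      using sumsym[of "w 0" p q] w0 1 by auto
  next
    case (ge2 m)
    then show ?case
      using wSS slot2_slot1_symmetric[of "w m" p q] sumsym[of "w (Suc m)" p q] by simp
  qed
  from this[OF pq] show ?thesis
    by (simp only: w_def v_def)
qed

end

text \<open>Second resolvent identity, read off coefficientwise: if R_A is the sum of t^n A^n, then
  R_(B+f) = R_B + t R_B f R_(B+f).\<close>

lemma mpow_perturb:
  assumes "i \<in> {1..N}" "j \<in> {1..N}"
  shows "mpow N (B + diag_of_int f) m i j = mpow N B m i j
    + (\<Sum>a<m. \<Sum>k=1..N. mpow N B a i k * (of_int (f k) * mpow N (B + diag_of_int f) (m - Suc a) k j))"
proof -
  have "mpow N (B + diag_of_int f) m i j = (\<Sum>k=1..N. mpow N B m i k * mpow N (B + diag_of_int f) 0 k j)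
    + (\<Sum>a<m. \<Sum>k=1..N. mpow N B a i k * (of_int (f k) * mpow N (B + diag_of_int f) (m - Suc a) k j))"
    by (rule linear_recurrence[where Z = "\<lambda>m i. mpow N (B + diag_of_int f) m i j"
          and s = "\<lambda>m i. of_int (f i) * mpow N (B + diag_of_int f) m i j", OF _ assms(1)])
      (rule mpow_Suc_diag_of_int)
  also have "(\<Sum>k=1..N. mpow N B m i k * mpow N (B + diag_of_int f) 0 k j) = mpow N B m i j"
    using sum_delta_mult_right[OF assms(2), of "\<lambda>k. mpow N B m i k" "\<lambda>_. 1"] by simp
  finally show ?thesis .
qed

lemma diag_of_int_cancel: "B + diag_of_int f + diag_of_int (\<lambda>i. - f i) = B"
  by (intro ext) (simp add: diag_of_int_def)

lemma diag_of_int_add: "diag_of_int f + diag_of_int g = diag_of_int (\<lambda>i. f i + g i)"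
  by (intro ext) (simp add: diag_of_int_def)

lemma two_fps_X_mult: "2 * fps_X * h = fps_X * (h + h :: 'a::ring_1 fps)"
  by (simp add: mult_2 distrib_left distrib_right)

lemma two_fps_X_commute: "2 * fps_X * h = h * (2 * fps_X :: 'a::ring_1 fps)"
  unfolding two_fps_X_mult fps_mult_fps_X_commute
  by (simp add: mult_2 distrib_left distrib_right)

lemma fps_nth_two_X_mult:
  "fps_nth (2 * fps_X * (Abs_fps P * Abs_fps Q)) m = (\<Sum>a<m. P a * (2 * Q (m - Suc a) :: 'a::ring_1))"
proof -
  have "fps_nth (2 * fps_X * h) m = (if m = 0 then 0 else fps_nth (h + h) (m - 1))" for h :: "'a fps"
    unfolding two_fps_X_mult by simp
  note X = this
  show ?thesis
    unfolding X by (cases m) (simp_all add: fps_mult_nth mult_2 distrib_left sum.distrib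
        atLeast0AtMost lessThan_Suc_atMost)
qed

lemma fps_two_X_mult_eqI:
  fixes P Q F G :: "nat \<Rightarrow> 'a::ring_1"
  assumes "\<And>m. F m = G m + (\<Sum>a<m. P a * (2 * Q (m - Suc a)))"
  shows "Abs_fps F = Abs_fps G + 2 * fps_X * (Abs_fps P * Abs_fps Q)"
  by (rule fps_ext) (simp only: fps_add_nth fps_nth_two_X_mult fps_nth_Abs_fps assms)

text \<open>The perturbation is 2 E_cc, so the sum over inner indices in the resolvent identity
  shrinks to one product of entries. The second form comes from exchanging the roles of
  \<open>A\<close> and \<open>A'\<close>, with perturbation -2 E_cc. The variable
  \<open>fps_X\<close> here counts matrix powers; it is not the loop variable u.\<close>

lemma mpow_rank_one:
  fixes A :: "nat \<Rightarrow> nat \<Rightarrow> 'a::ring_1"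
  assumes i: "i \<in> {1..N}" "j \<in> {1..N}" "c \<in> {1..N}"
  defines "A' \<equiv> A + diag_of_int (\<lambda>i. if i = c then 2 else 0)"
  shows "Abs_fps (\<lambda>n. mpow N A' n i j) = Abs_fps (\<lambda>n. mpow N A n i j)
      + 2 * fps_X * (Abs_fps (\<lambda>n. mpow N A n i c) * Abs_fps (\<lambda>n. mpow N A' n c j))" (is ?left)
    and "Abs_fps (\<lambda>n. mpow N A' n i j) = Abs_fps (\<lambda>n. mpow N A n i j)
      + 2 * fps_X * (Abs_fps (\<lambda>n. mpow N A' n i c) * Abs_fps (\<lambda>n. mpow N A n c j))" (is ?right)
proof -
  have pick: "(\<Sum>k=1..N. f k * (of_int (if k = c then t else 0) * g k)) = f c * (of_int t * g c)"
    for f g :: "nat \<Rightarrow> 'a" and t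
  proof -
    have "(\<Sum>k=1..N. f k * (of_int (if k = c then t else 0) * g k))
       = (\<Sum>k=1..N. f k * (if k = c then of_int t * g k else 0))"
      by (intro sum.cong) auto
    then show ?thesis
      using sum_delta_mult_right[OF i(3)] by simp
  qed
  show ?left
    by (rule fps_two_X_mult_eqI) (subst A'_def, subst mpow_perturb[OF i(1,2)],
      simp only: pick A'_def of_int_numeral)
  have A: "A = A' + diag_of_int (\<lambda>k. if k = c then - 2 else 0)"
    unfolding A'_def by (intro ext) (auto simp: diag_of_int_def)
  have "mpow N A m i j = mpow N A' m i j + (\<Sum>a<m. mpow N A' a i c * (- 2 * mpow N A (m - Suc a) c j))" for m
    using mpow_perturb[OF i(1,2), of A' "\<lambda>k. if k = c then - 2 else 0" m]
    unfolding A[symmetric] pick by simp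
  moreover have "(\<Sum>a<m. mpow N A' a i c * (- 2 * mpow N A (m - Suc a) c j))
      = - (\<Sum>a<m. mpow N A' a i c * (2 * mpow N A (m - Suc a) c j))" for m
    by (simp add: sum_negf)
  ultimately have "mpow N A m i j = mpow N A' m i j
      - (\<Sum>a<m. mpow N A' a i c * (2 * mpow N A (m - Suc a) c j))" for m
    by simp
  then show ?right
    by (intro fps_two_X_mult_eqI) (metis diff_add_cancel)
qed

lemma intertwine_resolvents:
  fixes t :: "'a::ring_1"
  assumes t: "\<And>x. t * x = x * t"
    and D: "D' = D + t * (D' * D)" and k: "k' = k + t * (k * k')" and g: "D * g = g * k"
  shows "D' * g = g * k'"
proof -
  define K K' where "K = t * k" and "K' = t * k'"
  have "t * (D' * D) * g = D' * g * K"
    unfolding K_def by (metis g mult.assoc t)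
  then have "D' * g = g * k + D' * g * K"
    using arg_cong[OF D, of "\<lambda>x. x * g"] by (simp add: distrib_right g)
  then have 1: "D' * g * (1 - K) = g * k"
    unfolding right_diff_distrib mult_1_right by (metis add_diff_cancel_right')
  have "t * (t * (k * k')) = K * K'"
    unfolding K_def K'_def by (metis mult.assoc t)
  then have KK: "K' = K + K * K'"
    using arg_cong[OF k, of "\<lambda>x. t * x"] by (simp add: distrib_left K_def K'_def)
  have "(1 - K) * (1 + K') = 1 + (K' - (K + K * K'))"
    by (simp add: algebra_simps)
  then have 2: "(1 - K) * (1 + K') = 1"
    unfolding KK[symmetric] by simp
  have 3: "k * (1 + K') = k'"
    using k unfolding K'_def by (metis distrib_left mult.assoc mult_1_right t)
  have "D' * g = D' * g * (1 - K) * (1 + K')"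
    by (simp only: mult.assoc 2 mult_1_right)
  then show ?thesis
    unfolding 1 by (simp only: mult.assoc 3)
qed

context trig_manin
begin

text \<open>The symmetry of columns for \<open>X + 2 S\<^sub>c\<close> intertwines two resolvent entries; the rank one
  perturbation \<open>2 E\<^sub>c\<^sub>c\<close> of both sides preserves the intertwining.\<close>
lemma perturbed_column_identity:
  assumes c: "c \<in> {1..N}" and q: "q \<in> {1..N}" and "c \<noteq> q"
    and eps: "\<And>a. a \<in> {1..N} \<Longrightarrow> sgd c a - sgd q a = 2 * eps - (if a = c then 1 else 0) - (if a = q then 1 else 0)"
  defines "A \<equiv> X + diag_of_int (sgd c)"
  defines "h \<equiv> \<lambda>i. if i = c then 1 else if i = q then - 1 else (0::int)"
  shows "(\<Sum>a<m. mpow N (A + diag_of_int h + diag_of_int (\<lambda>_. 2 * eps)) a c c * (2 * mpow N A (m - Suc a) q c))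
    = mpow N (A + diag_of_int (\<lambda>i. if i = c then 2 else 0)) m q c - mpow N A m q c"
proof -
  define D where "D = A + diag_of_int (\<lambda>i. sgd c i - sgd q i)"
  define A' where "A' = A + diag_of_int (\<lambda>i. if i = c then 2 else 0)"
  define D' where "D' = D + diag_of_int (\<lambda>i. if i = c then 2 else 0)"
  \<comment> \<open>The symmetric sums involve X - S_q and X - S_c. Replacing X by X + 2 S_c turns
    these matrices into \<open>D\<close> and \<open>A\<close>.\<close>
  interpret Y: trig_manin N "X + diag_of_int (\<lambda>i. sgd c i + sgd c i)" by (rule shift)
  have "X + diag_of_int (\<lambda>i. sgd c i + sgd c i) + diag_of_int (\<lambda>i. sgd i q) = D"
    unfolding D_def A_def add.assoc diag_of_int_add by (simp add: sgd_swap[of _ q])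
  moreover have "X + diag_of_int (\<lambda>i. sgd c i + sgd c i) + diag_of_int (\<lambda>i. sgd i c) = A"
    unfolding A_def add.assoc diag_of_int_add by (simp add: sgd_swap[of _ c])
  ultimately have "(\<Sum>a\<le>n. mpow N D a c c * mpow N A (n - a) q c)
      = (\<Sum>a\<le>n. mpow N A a q c * mpow N A (n - a) c c)" for n
    using Y.mpow_column_symmetric[OF c c q, of n] by simp
  then have "Abs_fps (\<lambda>n. mpow N D n c c) * Abs_fps (\<lambda>n. mpow N A n q c)
      = Abs_fps (\<lambda>n. mpow N A n q c) * Abs_fps (\<lambda>n. mpow N A n c c)"
    by (intro fps_ext) (simp add: fps_mult_nth atLeast0AtMost)
  then have "Abs_fps (\<lambda>n. mpow N D' n c c) * Abs_fps (\<lambda>n. mpow N A n q c)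
      = Abs_fps (\<lambda>n. mpow N A n q c) * Abs_fps (\<lambda>n. mpow N A' n c c)"
    unfolding D'_def A'_def
    by (rule intertwine_resolvents[OF two_fps_X_commute mpow_rank_one(2)[OF c c c]
          mpow_rank_one(1)[OF c c c]])
  then have "Abs_fps (\<lambda>n. mpow N A' n q c) = Abs_fps (\<lambda>n. mpow N A n q c)
      + 2 * fps_X * (Abs_fps (\<lambda>n. mpow N D' n c c) * Abs_fps (\<lambda>n. mpow N A n q c))" (is "?l = ?r")
    using mpow_rank_one(1)[OF q c c, of A] by (simp add: A'_def)
  then have "fps_nth ?l m = fps_nth ?r m" by simp
  then have "mpow N A' m q c = mpow N A m q c + (\<Sum>a<m. mpow N D' a c c * (2 * mpow N A (m - Suc a) q c))"
    by (simp only: fps_add_nth fps_nth_two_X_mult fps_nth_Abs_fps)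
  \<comment> \<open>By \<open>eps\<close>, S_c - S_q is 2 eps - E_cc - E_qq; adding 2 E_cc gives 2
    eps + E_cc - E_qq, that is 2 eps + h. The two matrices agree in rows 1..N, which is all that a
    power sees.\<close>
  moreover have "mpow N (A + diag_of_int h + diag_of_int (\<lambda>_. 2 * eps)) a i j = mpow N D' a i j" if "i \<in> {1..N}" for a i j
    using that
  proof (induction a arbitrary: i)
    case (Suc a)
    have "h i + 2 * eps = sgd c i - sgd q i + (if i = c then 2 else 0)"
      using eps[OF Suc.prems] \<open>c \<noteq> q\<close> unfolding h_def by auto
    then have "(A + diag_of_int h + diag_of_int (\<lambda>_. 2 * eps)) i k = D' i k" for k
      unfolding D'_def D_def add.assoc diag_of_int_add by (simp only: diag_of_int_def plus_fun_apply)
    then show ?case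
      using Suc.IH by (simp add: mmul_def)
  qed simp
  ultimately show ?thesis
    using c by (simp add: A'_def)
qed

end

section \<open>Moving a simple root vector through matrix powers\<close>

lemma of_int_left_commute: "x * (of_int z * y) = of_int z * (x * y :: 'a::ring_1)"
  using mult_of_int_commute[of z x] by (metis mult.assoc)

text \<open>The entry X_kl has weight h k - h l under H, and weights telescope along a path from k
  to l. The diagonal shift has weight 0.\<close>

lemma mpow_weight:
  fixes H :: "'a::ring_1" and h :: "nat \<Rightarrow> int"
  assumes H_X: "\<And>k l. k \<in> {1..N} \<Longrightarrow> l \<in> {1..N} \<Longrightarrow>
      H * X k l = X k l * H + of_int (h k - h l) * X k l"
    and "k \<in> {1..N}" "l \<in> {1..N}"
  shows "H * mpow N (X + diag_of_int f) m k l = mpow N (X + diag_of_int f) m k l * H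
    + of_int (h k - h l) * mpow N (X + diag_of_int f) m k l"
  using assms(2)
proof (induction m arbitrary: k)
  case (Suc m)
  define A where "A = X + diag_of_int f"
  define P where "P = mpow N A m"
  have HA: "H * A k i = A k i * H + of_int (h k - h i) * A k i" if "i \<in> {1..N}" for i
    using H_X[OF Suc.prems that] by (simp add: A_def diag_of_int_def distrib_left distrib_right mult_of_int_commute)
  have "H * (A k i * P i l) = A k i * P i l * H + of_int (h k - h l) * (A k i * P i l)"
    if "i \<in> {1..N}" for i
  proof -
    have "H * (A k i * P i l) = A k i * (H * P i l) + of_int (h k - h i) * (A k i * P i l)"
      by (simp only: mult.assoc[symmetric] HA[OF that] distrib_right)
    also have "A k i * (H * P i l) = A k i * P i l * H + of_int (h i - h l) * (A k i * P i l)"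
      by (simp only: Suc.IH[OF that, folded A_def, folded P_def] distrib_left of_int_left_commute mult.assoc)
    also have "of_int (h i - h l) * (A k i * P i l) = of_int (h k - h l) * (A k i * P i l)
        - of_int (h k - h i) * (A k i * P i l)"
      unfolding left_diff_distrib[symmetric] of_int_diff[symmetric] by simp
    finally show ?thesis by simp
  qed
  then show ?case
    unfolding A_def[symmetric]
    by (simp add: P_def mmul_def sum_distrib_left sum_distrib_right sum.distrib)
qed simp

text \<open>The data of a simple root vector \<open>F\<close> of the annihilating subalgebra, acting through the matrix
  \<open>e = u E\<^sub>c\<^sub>q\<close>: \<open>(c, q) = (j, j + 1)\<close>, \<open>eps = 0\<close>, \<open>u = 1\<close> for a finite root, and
  \<open>(c, q) = (N, 1)\<close>, \<open>eps = 1\<close>, \<open>u\<close> the loop variable for the affine one.\<close>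
locale simple_root = trig_manin N X for N and X :: "nat \<Rightarrow> nat \<Rightarrow> 'a::ring_1" +
  fixes c q :: nat and eps :: int and u F H :: 'a and h :: "nat \<Rightarrow> int"
  assumes c: "c \<in> {1..N}" and q: "q \<in> {1..N}" and cq: "c \<noteq> q"
    and h: "\<And>i. h i = (if i = c then 1 else if i = q then - 1 else 0)"
    and eps: "\<And>a. a \<in> {1..N} \<Longrightarrow>
      sgd c a - sgd q a = 2 * eps - (if a = c then 1 else 0) - (if a = q then 1 else 0)"
    and X_u: "\<And>k l. k \<in> {1..N} \<Longrightarrow> l \<in> {1..N} \<Longrightarrow>
      X k l * u = u * (X k l + (if k = l then of_int (2 * eps) else 0))"
    and H_X: "\<And>k l. k \<in> {1..N} \<Longrightarrow> l \<in> {1..N} \<Longrightarrow>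
      H * X k l = X k l * H + of_int (h k - h l) * X k l"
    and F_X: "\<And>k l. k \<in> {1..N} \<Longrightarrow> l \<in> {1..N} \<Longrightarrow>
      F * X k l = X k l * F
        + (if k = c then u * X q l else 0) - (if l = q then X k c * u else 0)
        - (if k = c \<and> l = q then of_int (2 - 2 * eps) * u else 0)
        + (if k = l then of_int (h k) * F else 0) - (if k = c \<and> l = q then u * H else 0)"
begin

text \<open>F and H will both kill the vacuum, so every element of this left ideal does.\<close>

definition left_ideal :: "'a set" where
  "left_ideal = {x. \<exists>P Q. x = P * F + Q * H}"

lemma left_ideal_left_F: "P * F \<in> left_ideal" and left_ideal_left_H: "P * H \<in> left_ideal"
  by (force simp: left_ideal_def intro: exI[of _ 0])+

lemma left_ideal_add:
  assumes "x \<in> left_ideal" "y \<in> left_ideal"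
  shows "x + y \<in> left_ideal"
proof -
  obtain P Q P' Q' where "x = P * F + Q * H" "y = P' * F + Q' * H"
    using assms unfolding left_ideal_def by blast
  then have "x + y = (P + P') * F + (Q + Q') * H"
    by (simp add: algebra_simps)
  then show ?thesis unfolding left_ideal_def by blast
qed

lemma left_ideal_minus:
  assumes "x \<in> left_ideal"
  shows "- x \<in> left_ideal"
proof -
  obtain P Q where "x = P * F + Q * H"
    using assms unfolding left_ideal_def by blast
  then have "- x = (- P) * F + (- Q) * H"
    by simp
  then show ?thesis unfolding left_ideal_def by blast
qed

lemma left_ideal_sum: "(\<And>i. i \<in> I \<Longrightarrow> f i \<in> left_ideal) \<Longrightarrow> sum f I \<in> left_ideal"
  by (induction I rule: infinite_finite_induct) (auto intro: left_ideal_add simp: left_ideal_left_F[of 0, simplified])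

lemma H_mpow:
  "k \<in> {1..N} \<Longrightarrow> l \<in> {1..N} \<Longrightarrow> H * mpow N (X + diag_of_int f) m k l = mpow N (X + diag_of_int f) m k l * H
    + of_int (h k - h l) * mpow N (X + diag_of_int f) m k l"
  by (rule mpow_weight[OF H_X])

text \<open>At the entry (c, q) the shift by S_b contributes sgd b q - sgd b c. By
  \<open>eps\<close> this absorbs the 2 eps of the scalar term, which then depends on b only through
  whether b is c or q.\<close>

lemma F_shifted:
  assumes b: "b \<in> {1..N}" and kl: "k \<in> {1..N}" "l \<in> {1..N}"
  defines "A \<equiv> X + diag_of_int (sgd b)"
  shows "F * A k l = A k l * F
        + (if k = c then u * A q l else 0) - (if l = q then A k c * u else 0)
        + (if k = c \<and> l = q then of_int ((if b = c then 1 else 0) + (if b = q then 1 else 0) - 2) * u else 0)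
        + (if k = l then of_int (h k) * F else 0) - (if k = c \<and> l = q then u * H else 0)"
proof -
  have s: "sgd b c = sgd b q - 2 * eps + (if b = c then 1 else 0) + (if b = q then 1 else 0)"
    using eps[OF b] by (simp add: sgd_swap[of c b] sgd_swap[of q b])
  have "(if k = c then u * A q l else 0) - (if l = q then A k c * u else 0)
    = (if k = c then u * X q l else 0) - (if l = q then X k c * u else 0)
     + (if k = c \<and> l = q then of_int (sgd b q - sgd b c) * u else 0)"
    by (auto simp: A_def diag_of_int_def distrib_left distrib_right left_diff_distrib mult_of_int_commute)
  moreover have "of_int (sgd b q - sgd b c) * u = - (of_int (2 - 2 * eps) * u)
     - of_int ((if b = c then 1 else 0) + (if b = q then 1 else 0) - 2) * u"
    unfolding s by (simp only: left_diff_distrib[symmetric] mult_minus_left[symmetric] of_int_diff[symmetric]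
          of_int_minus[symmetric]) (simp add: algebra_simps)
  moreover have "F * A k l = F * X k l + (if k = l then of_int (sgd b k) * F else 0)"
    "A k l * F = X k l * F + (if k = l then of_int (sgd b k) * F else 0)"
    by (auto simp: A_def diag_of_int_def distrib_left distrib_right mult_of_int_commute)
  ultimately show ?thesis
    using F_X[OF kl] by (simp split: if_splits)
qed

text \<open>Since (2u d) u = u (2u d + 2), moving the loop variable to the left across L adds the
  scalar 2 to L. For u = 1 nothing changes, in accordance with eps = 0.\<close>

lemma mpow_u:
  assumes "k \<in> {1..N}" "l \<in> {1..N}"
  shows "mpow N (X + diag_of_int f) m k l * u = u * mpow N (X + diag_of_int f + diag_of_int (\<lambda>_. 2 * eps)) m k l"
  using assms(1)
proof (induction m arbitrary: k)
  case (Suc m)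
  let ?A = "X + diag_of_int f" and ?A' = "X + diag_of_int f + diag_of_int (\<lambda>_. 2 * eps)"
  have A: "?A k i * u = u * ?A' k i" if "i \<in> {1..N}" for i
    using X_u[OF Suc.prems that] by (auto simp: diag_of_int_def distrib_left distrib_right mult_of_int_commute)
  have "(\<Sum>i=1..N. ?A k i * mpow N ?A m i l * u) = (\<Sum>i=1..N. u * ?A' k i * mpow N ?A' m i l)"
    by (intro sum.cong refl) (simp only: mult.assoc Suc.IH A[symmetric])
  then show ?case
    by (simp only: mpow.simps mmul_def sum_distrib_left sum_distrib_right mult.assoc)
qed simp

text \<open>The matrix \<open>F A\<^sup>m - e A\<^sup>m + A\<^sup>m e\<close> satisfies a linear recurrence with matrix \<open>A + h\<close>.\<close>
lemma F_mpow_diagonal: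
  assumes b: "b \<in> {1..N}"
  defines "A \<equiv> X + diag_of_int (sgd b)"
  defines "s \<equiv> \<lambda>m k. (if b = c \<and> k = c then 2 * (u * mpow N A m q c) else 0)
      - (if b = q then of_int (h k) * (mpow N A m k c * u) else 0)"
  shows "F * mpow N A m b b - (if b = c then u * mpow N A m q c else 0)
      + (if b = q then mpow N A m q c * u else 0)
      - (\<Sum>a<m. \<Sum>k=1..N. mpow N (A + diag_of_int h) a b k * s (m - Suc a) k) \<in> left_ideal"
proof -
  \<comment> \<open>Column b of F A^m - e A^m + A^m e with e = u E_cq. The leading part of [F, A] is
    [e, A], so these two corrections remove from the recurrence everything except diagonal terms and
    multiples of u.\<close>
  define Z where "Z m k = F * mpow N A m k b - (if k = c then u * mpow N A m q b else 0)
      + (if b = q then mpow N A m k c * u else 0)" for m k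
  \<comment> \<open>The additional source ends in H and so contributes only to
    \<open>left_ideal\<close>. Moving H to the right past the entry (q, b) of A^m costs the scalar h
    q - h b.\<close>
  define s' where "s' m k = s m k - (if k = c then u * mpow N A m q b * H else 0)" for m k
  define \<delta> where "\<delta> = (if b = c then 1 else 0) + (if b = q then 1 else 0 :: int)"
  have rec: "Z (Suc m) k = (\<Sum>i=1..N. (A + diag_of_int h) k i * Z m i) + s' m k" if k: "k \<in> {1..N}" for m k
  proof -
    let ?P = "mpow N A m"
    have "F * mpow N A (Suc m) k b = (\<Sum>i=1..N. F * A k i * ?P i b)"
      by (simp add: mmul_def sum_distrib_left mult.assoc)
    also have "\<dots> = (\<Sum>i=1..N. A k i * (F * ?P i b)
        + (if k = c then u * (A q i * ?P i b) else 0) - (if i = q then A k c * (u * ?P i b) else 0)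
        + (if i = q then (if k = c then of_int (\<delta> - 2) * (u * ?P i b) else 0) else 0)
        + (if k = i then of_int (h i) * (F * ?P i b) else 0)
        - (if i = q then (if k = c then u * (H * ?P i b) else 0) else 0))"
      by (intro sum.cong refl, unfold A_def, subst F_shifted[OF b k], unfold \<delta>_def)
        (auto simp: distrib_right left_diff_distrib mult.assoc)
    also have "\<dots> = (\<Sum>i=1..N. A k i * (F * ?P i b))
        + (\<Sum>i=1..N. if k = c then u * (A q i * ?P i b) else 0)
        - (\<Sum>i=1..N. if i = q then A k c * (u * ?P i b) else 0)
        + (\<Sum>i=1..N. if i = q then (if k = c then of_int (\<delta> - 2) * (u * ?P i b) else 0) else 0)
        + (\<Sum>i=1..N. if k = i then of_int (h i) * (F * ?P i b) else 0)
        - (\<Sum>i=1..N. if i = q then (if k = c then u * (H * ?P i b) else 0) else 0)"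
      by (simp only: sum.distrib sum_subtractf)
    also have "\<dots> = (\<Sum>i=1..N. A k i * (F * ?P i b))
        + (if k = c then u * mpow N A (Suc m) q b else 0)
        - A k c * (u * ?P q b)
        + (if k = c then of_int (\<delta> - 2) * (u * ?P q b) else 0)
        + of_int (h k) * (F * ?P k b)
        - (if k = c then u * (H * ?P q b) else 0)"
      using k q by (simp add: mmul_def sum_distrib_left)
    finally have F: "F * mpow N A (Suc m) k b = \<dots>" .
    have "(\<Sum>i=1..N. (A + diag_of_int h) k i * Z m i) = (\<Sum>i=1..N. A k i * Z m i) + of_int (h k) * Z m k"
    proof -
      have "(\<Sum>i=1..N. (A + diag_of_int h) k i * Z m i)
          = (\<Sum>i=1..N. A k i * Z m i) + (\<Sum>i=1..N. (if k = i then of_int (h k) else 0) * Z m i)"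
        unfolding sum.distrib[symmetric] by (intro sum.cong refl) (simp add: diag_of_int_def distrib_right)
      then show ?thesis
        using sum_delta_mult_left[OF k, of "\<lambda>_. of_int (h k)" "Z m"] by simp
    qed
    also have "(\<Sum>i=1..N. A k i * Z m i) = (\<Sum>i=1..N. A k i * (F * ?P i b))
        - (\<Sum>i=1..N. A k i * (if i = c then u * ?P q b else 0))
        + (\<Sum>i=1..N. A k i * (if b = q then ?P i c * u else 0))"
      unfolding Z_def by (simp only: distrib_left right_diff_distrib sum.distrib sum_subtractf)
    also have "(\<Sum>i=1..N. A k i * (if i = c then u * ?P q b else 0)) = A k c * (u * ?P q b)"
      by (rule sum_delta_mult_right[OF c])
    also have "(\<Sum>i=1..N. A k i * (if b = q then ?P i c * u else 0))
        = (if b = q then mpow N A (Suc m) k c * u else 0)"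
      by (simp add: mmul_def sum_distrib_right mult.assoc)
    finally have R: "(\<Sum>i=1..N. (A + diag_of_int h) k i * Z m i) =
      (\<Sum>i=1..N. A k i * (F * ?P i b)) - A k c * (u * ?P q b)
      + (if b = q then mpow N A (Suc m) k c * u else 0) + of_int (h k) * Z m k" .
    have H: "H * ?P q b = ?P q b * H + of_int (h q - h b) * ?P q b"
      unfolding A_def by (rule H_mpow[OF q b])
    have "Z (Suc m) k - (\<Sum>i=1..N. (A + diag_of_int h) k i * Z m i) =
        (if k = c then of_int (\<delta> - 2) * (u * ?P q b) else 0)
        + of_int (h k) * (if k = c then u * ?P q b else 0)
        - of_int (h k) * (if b = q then ?P k c * u else 0)
        - (if k = c then u * (H * ?P q b) else 0)"
      unfolding R Z_def[of "Suc m"] F unfolding Z_def by (simp add: algebra_simps)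
    also have "\<dots> = s' m k"
    proof (cases "k = c")
      case False
      then show ?thesis by (simp add: s'_def s_def)
    next
      case True
      have "u * (H * ?P q b) = u * ?P q b * H + of_int (h q - h b) * (u * ?P q b)"
        by (simp only: H distrib_left of_int_left_commute mult.assoc)
      then have "(if k = c then of_int (\<delta> - 2) * (u * ?P q b) else 0)
          + of_int (h k) * (if k = c then u * ?P q b else 0)
          - of_int (h k) * (if b = q then ?P k c * u else 0)
          - (if k = c then u * (H * ?P q b) else 0)
        = of_int (\<delta> - 2 + h c - (h q - h b)) * (u * ?P q b)
          - of_int (h k) * (if b = q then ?P k c * u else 0) - u * ?P q b * H"
        using True by (simp only: of_int_add of_int_diff distrib_right left_diff_distrib if_True)
          (simp add: algebra_simps)
      \<comment> \<open>The scalar at the entry (c, q), the diagonal term h c and the weight picked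
        up by H add up to zero unless b = c. This is why the source is so small.\<close>
      also have "\<delta> - 2 + h c - (h q - h b) = (if b = c then 2 else 0)"
        using cq by (simp add: h \<delta>_def)
      finally show ?thesis
        using True by (auto simp: s'_def s_def)
    qed
    finally show ?thesis by (simp add: algebra_simps)
  qed
  have Z0: "Z 0 k = (if k = b then F else 0)" for k
    by (auto simp: Z_def)
  have "Z m b = (\<Sum>k=1..N. mpow N (A + diag_of_int h) m b k * Z 0 k)
    + (\<Sum>a<m. \<Sum>k=1..N. mpow N (A + diag_of_int h) a b k * s' (m - Suc a) k)"
    using rec b by (rule linear_recurrence[where Z = Z and B = "A + diag_of_int h" and s = s'])
  also have "(\<Sum>k=1..N. mpow N (A + diag_of_int h) m b k * Z 0 k) = mpow N (A + diag_of_int h) m b b * F"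
    unfolding Z0 using sum_delta_mult_right[OF b] by simp
  also have "(\<Sum>a<m. \<Sum>k=1..N. mpow N (A + diag_of_int h) a b k * s' (m - Suc a) k)
    = (\<Sum>a<m. \<Sum>k=1..N. mpow N (A + diag_of_int h) a b k * s (m - Suc a) k)
     - (\<Sum>a<m. mpow N (A + diag_of_int h) a b c * (u * mpow N A (m - Suc a) q b * H))"
    by (simp only: s'_def right_diff_distrib sum_subtractf sum_delta_mult_right[OF c])
  finally have "Z m b - (\<Sum>a<m. \<Sum>k=1..N. mpow N (A + diag_of_int h) a b k * s (m - Suc a) k)
    = mpow N (A + diag_of_int h) m b b * F
      + - (\<Sum>a<m. (mpow N (A + diag_of_int h) a b c * (u * mpow N A (m - Suc a) q b)) * H)"
    by (simp add: mult.assoc plus_fun_def)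
  also have "\<dots> \<in> left_ideal"
    by (intro left_ideal_add left_ideal_minus left_ideal_sum left_ideal_left_F left_ideal_left_H)
  finally show ?thesis
    unfolding Z_def using cq by (simp split: if_splits)
qed

text \<open>Modulo the left ideal, b = c contributes u ((A_c + 2 E_cc)^m)_qc, where A_b = X + S_b,
  by \<open>perturbed_column_identity\<close>. The index b = q contributes -((A_q + h)^m)_qc u by
  the resolvent identity, and other b contribute nothing. Moving u to the left turns A_q + h into
  A_q + h + 2 eps, which is A_c + 2 E_cc by \<open>eps\<close>, so the two cancel.\<close>

lemma F_trace_in_left_ideal: "F * (\<Sum>b=1..N. mpow N (X + diag_of_int (sgd b)) m b b) \<in> left_ideal"
proof -
  define A where "A b = X + diag_of_int (sgd b)" for b
  define s where "s b m k = (if b = c \<and> k = c then 2 * (u * mpow N (A b) m q c) else 0)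
      - (if b = q then of_int (h k) * (mpow N (A b) m k c * u) else 0)" for b m k
  define S where "S b = (\<Sum>a<m. \<Sum>k=1..N. mpow N (A b + diag_of_int h) a b k * s b (m - Suc a) k)" for b
  define e where "e b = (if b = c then u * mpow N (A c) m q c else 0)
      - (if b = q then mpow N (A q) m q c * u else 0)" for b
  have 1: "F * mpow N (A b) m b b - (e b + S b) \<in> left_ideal" if "b \<in> {1..N}" for b
    using F_mpow_diagonal[OF that, of m] unfolding A_def[symmetric] S_def s_def e_def
    by (auto simp: algebra_simps)
  have S_other: "S b = 0" if "b \<noteq> c" "b \<noteq> q" for b
    using that by (simp add: S_def s_def)
  have Sc: "S c = u * (mpow N (A c + diag_of_int (\<lambda>i. if i = c then 2 else 0)) m q c - mpow N (A c) m q c)"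
  proof -
    have "S c = (\<Sum>a<m. mpow N (A c + diag_of_int h) a c c * (2 * (u * mpow N (A c) (m - Suc a) q c)))"
    proof -
      have "s c j k = (if k = c then 2 * (u * mpow N (A c) j q c) else 0)" for j k
        using cq by (simp add: s_def)
      then show ?thesis
        by (simp only: S_def sum_delta_mult_right[OF c])
    qed
    also have "\<dots> = (\<Sum>a<m. u * (mpow N (A c + diag_of_int h + diag_of_int (\<lambda>_. 2 * eps)) a c c * (2 * mpow N (A c) (m - Suc a) q c)))"
    proof (intro sum.cong refl)
      fix a
      have "mpow N (A c + diag_of_int h) a c c * u = u * mpow N (A c + diag_of_int h + diag_of_int (\<lambda>_. 2 * eps)) a c c"
        using mpow_u[OF c c, of "\<lambda>i. sgd c i + h i" a] by (simp add: A_def diag_of_int_add[symmetric] add.assoc)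
      then show "mpow N (A c + diag_of_int h) a c c * (2 * (u * mpow N (A c) (m - Suc a) q c)) =
        u * (mpow N (A c + diag_of_int h + diag_of_int (\<lambda>_. 2 * eps)) a c c * (2 * mpow N (A c) (m - Suc a) q c))"
        by (simp only: mult_2 distrib_left distrib_right mult.assoc[symmetric])
    qed
    also have "\<dots> = u * (mpow N (A c + diag_of_int (\<lambda>i. if i = c then 2 else 0)) m q c - mpow N (A c) m q c)"
      unfolding sum_distrib_left[symmetric]
      using perturbed_column_identity[OF c q cq eps, of m] unfolding A_def h by simp
    finally show ?thesis .
  qed
  \<comment> \<open>The sources for b = q carry the factor -h k, so their sum is exactly the
    resolvent expansion of A_q around A_q + h.\<close>
  have Sq: "S q = (mpow N (A q) m q c - mpow N (A q + diag_of_int h) m q c) * u"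
  proof -
    have A: "A q = (A q + diag_of_int h) + diag_of_int (\<lambda>k. - h k)"
      by (rule diag_of_int_cancel[symmetric])
    have "mpow N (A q) m q c = mpow N (A q + diag_of_int h) m q c
       + (\<Sum>a<m. \<Sum>k=1..N. mpow N (A q + diag_of_int h) a q k * (of_int (- h k) * mpow N (A q) (m - Suc a) k c))"
      using mpow_perturb[OF q c, of "A q + diag_of_int h" "\<lambda>k. - h k" m] unfolding A[symmetric] .
    then have "(mpow N (A q) m q c - mpow N (A q + diag_of_int h) m q c) * u =
      (\<Sum>a<m. \<Sum>k=1..N. mpow N (A q + diag_of_int h) a q k * (of_int (- h k) * mpow N (A q) (m - Suc a) k c)) * u"
      by simp
    also have "\<dots> = S q"
      unfolding S_def s_def using cq by (simp add: sum_distrib_right mult.assoc)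
    finally show ?thesis by simp
  qed
  have shift: "mpow N (A q + diag_of_int h) m q c * u = u * mpow N (A c + diag_of_int (\<lambda>i. if i = c then 2 else 0)) m q c"
  proof -
    have "mpow N (A q + diag_of_int h) m q c * u = u * mpow N (A q + diag_of_int h + diag_of_int (\<lambda>_. 2 * eps)) m q c"
      using mpow_u[OF q c, of "\<lambda>i. sgd q i + h i" m] by (simp add: A_def diag_of_int_add[symmetric] add.assoc)
    also have "mpow N (A q + diag_of_int h + diag_of_int (\<lambda>_. 2 * eps)) m i c
        = mpow N (A c + diag_of_int (\<lambda>i. if i = c then 2 else 0)) m i c" if "i \<in> {1..N}" for i
      using that
    proof (induction m arbitrary: i)
      case (Suc m)
      have "sgd q i + (h i + 2 * eps) = sgd c i + (if i = c then 2 else 0)"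
        using eps[OF Suc.prems] cq by (auto simp: h)
      then have "(A q + diag_of_int h + diag_of_int (\<lambda>_. 2 * eps)) i k = (A c + diag_of_int (\<lambda>i. if i = c then 2 else 0)) i k" for k
        unfolding A_def add.assoc diag_of_int_add by (simp only: diag_of_int_def plus_fun_apply)
      then show ?case
        using Suc.IH by (simp add: mmul_def)
    qed simp
    then have "mpow N (A q + diag_of_int h + diag_of_int (\<lambda>_. 2 * eps)) m q c
        = mpow N (A c + diag_of_int (\<lambda>i. if i = c then 2 else 0)) m q c"
      using q by blast
    finally show ?thesis .
  qed
  have "(\<Sum>b=1..N. e b + S b) = (\<Sum>b=1..N. (if b = c then e c + S c else 0) + (if b = q then e q + S q else 0))"
    using cq S_other by (intro sum.cong refl) (auto simp: e_def)
  also have "\<dots> = (e c + S c) + (e q + S q)"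
    using c q by (simp add: sum.distrib)
  also have "\<dots> = 0"
    using cq unfolding Sc Sq e_def left_diff_distrib shift by (simp add: algebra_simps)
  finally have 0: "(\<Sum>b=1..N. e b + S b) = 0" .
  have "(\<Sum>b=1..N. F * mpow N (A b) m b b - (e b + S b)) \<in> left_ideal"
    by (intro left_ideal_sum 1)
  then show ?thesis
    unfolding sum_subtractf 0 A_def by (simp add: sum_distrib_left)
qed

end

section \<open>The free algebra and the vacuum ideal\<close>

lemma fmul_Nil: "fmul p q [] = p [] * q []"
  by (simp add: fmul_def)

text \<open>Splitting off the first letter turns the sum over all cuts of a word into a recursion.
  Inductions on words must then generalise over the left factor, which is replaced by its left
  quotient by that letter.\<close>

lemma fmul_Cons: "fmul p q (x # w) = p [] * q (x # w) + fmul (\<lambda>w. p (x # w)) q w"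
  unfolding fmul_def by (simp add: sum.atMost_Suc_shift del: sum.atMost_Suc)

lemma fmul_add_left: "fmul (p + q) r = fmul p r + fmul q r"
  and fmul_add_right: "fmul r (p + q) = fmul r p + fmul r q"
  and fmul_diff_left: "fmul (p - q) r = fmul p r - fmul q r"
  and fmul_diff_right: "fmul r (p - q) = fmul r p - fmul r q"
  and fmul_scale_left: "fmul (fscale c p) r = fscale c (fmul p r)"
  and fmul_scale_right: "fmul r (fscale c p) = fscale c (fmul r p)"
  by (auto simp: fmul_def fun_eq_iff algebra_simps sum.distrib sum_subtractf fscale_def sum_distrib_left)

lemma fmul_zero_left [simp]: "fmul 0 q = 0" and fmul_zero_right [simp]: "fmul q 0 = 0"
  by (auto simp: fmul_def fun_eq_iff)

lemma fmul_assoc: "fmul (fmul p q) r = fmul p (fmul q r)"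
proof
  fix w
  show "fmul (fmul p q) r w = fmul p (fmul q r) w"
  proof (induction w arbitrary: p)
    case Nil
    then show ?case by (simp add: fmul_Nil)
  next
    case (Cons x w)
    have "(\<lambda>w. fmul p q (x # w)) = fscale (p []) (\<lambda>w. q (x # w)) + fmul (\<lambda>w. p (x # w)) q"
      by (auto simp: fmul_Cons fscale_def)
    then have "fmul (\<lambda>w. fmul p q (x # w)) r w
        = p [] * fmul (\<lambda>w. q (x # w)) r w + fmul (\<lambda>w. p (x # w)) (fmul q r) w"
      by (simp only: fmul_add_left fmul_scale_left plus_fun_apply Cons.IH) (simp add: fscale_def)
    then show ?case
      by (simp add: fmul_Cons[of _ r] fmul_Cons[of p "fmul q r"] fmul_Nil algebra_simps)
  qed
qed

lemma fmul_fone_left [simp]: "fmul (fword []) q = q"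
proof
  fix w
  show "fmul (fword []) q w = q w"
  proof (cases w)
    case (Cons x w')
    have "(\<lambda>w. fword [] (x # w)) = 0"
      by (auto simp: fword_def)
    then show ?thesis
      by (simp add: Cons fmul_Cons) (simp add: fword_def)
  qed (simp add: fmul_Nil fword_def)
qed

lemma fmul_fword_Cons: "fmul (fword (x # a)) q = fmul (fgen x) (fmul (fword a) q)"
proof -
  have "fmul (fword (x # a)) q w = (case w of [] \<Rightarrow> 0 | y # w' \<Rightarrow> if y = x then fmul (fword a) q w' else 0)" for a q w
  proof (cases w)
    case (Cons y w')
    have "(\<lambda>w. fword (x # a) (y # w)) = (if y = x then fword a else 0)"
      by (auto simp: fword_def)
    then show ?thesis
      by (simp add: Cons fmul_Cons) (simp add: fword_def)
  qed (simp add: fmul_Nil fword_def)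
  note 1 = this
  show ?thesis
    unfolding fgen_def by (intro ext) (simp add: 1 split: list.splits)
qed

lemma fmul_fone_right [simp]: "fmul q (fword []) = q"
proof
  fix w
  show "fmul q (fword []) w = q w"
  proof (induction w arbitrary: q)
    case (Cons x w)
    show ?case
      by (simp add: fmul_Cons Cons) (simp add: fword_def)
  qed (simp add: fmul_Nil fword_def)
qed

lemma fmul_fgen_fword: "fmul (fgen x) (fword a) = fword (x # a)"
  using fmul_fword_Cons[of x a "fword []"] by simp

lemma vac_ideal_fgen:
  assumes "p \<in> vac_ideal N"
  shows "fmul (fgen g) p \<in> vac_ideal N"
  using assms
proof induction
  case zero
  then show ?case by (simp add: vac_ideal.zero flip: zero_fun_def)
next
  case (add p q)
  then show ?case by (simp only: fmul_add_right vac_ideal.add)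
next
  case (scale p c)
  then show ?case by (simp add: fmul_scale_right vac_ideal.scale)
next
  case (lie x y a b)
  then show ?case
    using vac_ideal.lie[of N x y "g # a" b] by (simp add: fmul_fword_Cons)
next
  case (central a)
  then show ?case
    using vac_ideal.central[of "g # a" N] by (simp add: fmul_fword_Cons)
next
  case (pos i j n a)
  then show ?case
    using vac_ideal.pos[of i N j n "g # a"] by (simp add: fmul_fword_Cons)
next
  case (zero_low i j a)
  then show ?case
    using vac_ideal.zero_low[of i N j "g # a"] by (simp add: fmul_fword_Cons)
qed

lemma vac_ideal_uminus: "p \<in> vac_ideal N \<Longrightarrow> - p \<in> vac_ideal N"
  using vac_ideal.scale[of p N "-1"] by (simp add: fscale_def fun_Compl_def)

text \<open>The type \<open>falg\<close> also holds functions of infinite support and words with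
  indices outside 1..N, to which the Lie relations cannot be applied letter by letter. The vacuum
  module is formed as a quotient of this subspace.\<close>

inductive_set valid_alg :: "nat \<Rightarrow> falg set" for N :: nat where
  zero: "0 \<in> valid_alg N"
| add: "p \<in> valid_alg N \<Longrightarrow> q \<in> valid_alg N \<Longrightarrow> p + q \<in> valid_alg N"
| scale: "p \<in> valid_alg N \<Longrightarrow> fscale c p \<in> valid_alg N"
| word: "(\<And>g. g \<in> set w \<Longrightarrow> valid_gen N g) \<Longrightarrow> fword w \<in> valid_alg N"

lemma valid_alg_uminus: "p \<in> valid_alg N \<Longrightarrow> - p \<in> valid_alg N"
  using valid_alg.scale[of p N "-1"] by (simp add: fscale_def fun_Compl_def)

lemma valid_alg_diff: "p \<in> valid_alg N \<Longrightarrow> q \<in> valid_alg N \<Longrightarrow> p - q \<in> valid_alg N"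
  using valid_alg.add[of p N "- q"] valid_alg_uminus[of q N] by simp

lemma valid_alg_sum: "(\<And>i. i \<in> I \<Longrightarrow> f i \<in> valid_alg N) \<Longrightarrow> sum f I \<in> valid_alg N"
  by (induction I rule: infinite_finite_induct) (auto intro: valid_alg.zero valid_alg.add)

lemma valid_alg_fone: "fone \<in> valid_alg N"
  unfolding fone_def by (rule valid_alg.word) simp

lemma valid_alg_fgen: "valid_gen N g \<Longrightarrow> fgen g \<in> valid_alg N"
  unfolding fgen_def by (rule valid_alg.word) simp

lemma valid_alg_fmul_fgen:
  assumes "p \<in> valid_alg N" "valid_gen N g"
  shows "fmul (fgen g) p \<in> valid_alg N"
  using assms
proof induction
  case (word w)
  then have "fword (g # w) \<in> valid_alg N"
    by (intro valid_alg.word) auto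
  then show ?case by (simp add: fmul_fgen_fword)
qed (auto simp: fmul_add_right fmul_scale_right intro: valid_alg.intros)

lemma valid_alg_fmul:
  assumes "p \<in> valid_alg N" "q \<in> valid_alg N"
  shows "fmul p q \<in> valid_alg N"
  using assms
proof induction
  case (word w)
  then show ?case
  proof (induction w)
    case (Cons g w)
    then show ?case
      by (simp add: fmul_fword_Cons valid_alg_fmul_fgen)
  qed simp
qed (auto simp: fmul_add_left fmul_scale_left intro: valid_alg.intros)

lemma vac_ideal_fmul:
  assumes "p \<in> valid_alg N" "q \<in> vac_ideal N"
  shows "fmul p q \<in> vac_ideal N"
  using assms
proof induction
  case (word w)
  then show ?case
  proof (induction w)
    case (Cons g w)
    then show ?case
      by (simp add: fmul_fword_Cons vac_ideal_fgen)
  qed simp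
qed (auto simp: fmul_add_left fmul_scale_left intro: vac_ideal.intros)

lemma valid_alg_linear_vac_ideal:
  assumes "p \<in> valid_alg N"
    and "\<And>p q. T (p + q) = T p + T q" "\<And>c p. T (fscale c p) = fscale c (T p)"
    and "\<And>w. (\<And>g. g \<in> set w \<Longrightarrow> valid_gen N g) \<Longrightarrow> T (fword w) \<in> vac_ideal N"
  shows "T p \<in> vac_ideal N"
  using assms(1)
proof induction
  case zero
  have "T 0 = 0"
    using assms(2)[of 0 0] by simp
  then show ?case by (simp add: vac_ideal.zero flip: zero_fun_def)
next
  case (add p q)
  then show ?case by (simp only: assms(2) vac_ideal.add)
qed (auto simp: assms(3) intro: assms(4) vac_ideal.intros)

lemma vac_ideal_lie_valid_alg:
  assumes "p \<in> valid_alg N" "valid_gen N g" "valid_gen N h"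
  shows "fmul (fmul (fgen g) (fgen h) - fmul (fgen h) (fgen g) - lbr N g h) p \<in> vac_ideal N"
  using assms(1)
proof (rule valid_alg_linear_vac_ideal)
  fix w :: word
  show "fmul (fmul (fgen g) (fgen h) - fmul (fgen h) (fgen g) - lbr N g h) (fword w) \<in> vac_ideal N"
    using vac_ideal.lie[of N g h "[]" w] assms by (simp only: fmul_fone_left)
qed (simp_all only: fmul_add_right fmul_scale_right)

text \<open>The generators of the ideal contain K + N only at the right end of a word, where it
  meets the vacuum. The Lie relations make K central, so it can be moved there from the left
  end.\<close>

lemma vac_ideal_Kc_valid_alg:
  assumes "p \<in> valid_alg N"
  shows "fmul (fgen Kc) p + fscale (of_nat N) p \<in> vac_ideal N"
  using assms
proof (rule valid_alg_linear_vac_ideal)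
  fix p q
  show "fmul (fgen Kc) (p + q) + fscale (of_nat N) (p + q)
    = (fmul (fgen Kc) p + fscale (of_nat N) p) + (fmul (fgen Kc) q + fscale (of_nat N) q)"
    unfolding fmul_add_right by (simp add: fscale_def fun_eq_iff algebra_simps)
next
  fix c p
  show "fmul (fgen Kc) (fscale c p) + fscale (of_nat N) (fscale c p)
    = fscale c (fmul (fgen Kc) p + fscale (of_nat N) p)"
    unfolding fmul_scale_right by (simp add: fscale_def fun_eq_iff algebra_simps)
next
  fix w :: word
  assume "\<And>g. g \<in> set w \<Longrightarrow> valid_gen N g"
  then show "fmul (fgen Kc) (fword w) + fscale (of_nat N) (fword w) \<in> vac_ideal N"
  proof (induction w)
    case Nil
    then show ?case
      using vac_ideal.central[of "[]" N] by (simp only: fone_def fmul_fone_left fmul_fone_right)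
  next
    case (Cons g w)
    have w: "fword w \<in> valid_alg N"
      using Cons.prems by (intro valid_alg.word) auto
    have "lbr N Kc g = 0"
      by (cases g) auto
    then have "fmul (fmul (fgen Kc) (fgen g) - fmul (fgen g) (fgen Kc)) (fword w) \<in> vac_ideal N"
      using vac_ideal_lie_valid_alg[OF w, of Kc g] Cons.prems by simp
    moreover have "fmul (fgen g) (fmul (fgen Kc) (fword w) + fscale (of_nat N) (fword w)) \<in> vac_ideal N"
      by (intro vac_ideal_fgen Cons.IH Cons.prems) simp
    ultimately have "fmul (fmul (fgen Kc) (fgen g) - fmul (fgen g) (fgen Kc)) (fword w)
      + fmul (fgen g) (fmul (fgen Kc) (fword w) + fscale (of_nat N) (fword w)) \<in> vac_ideal N"
      by (rule vac_ideal.add)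
    then show ?case
      by (simp only: fmul_diff_left fmul_add_right fmul_scale_right fmul_assoc fmul_fgen_fword
          diff_add_cancel add.assoc[symmetric])
  qed
qed

lemma valid_alg_subset_vac_ideal:
  assumes "fone \<in> vac_ideal N"
  shows "valid_alg N \<subseteq> vac_ideal N"
  using vac_ideal_fmul[OF _ assms] by (auto simp: fone_def)

text \<open>For N = 0 the relation K + N is K itself, and so every spanning element of the ideal has
  constant term zero.\<close>

lemma fone_notin_vac_ideal_0: "fone \<notin> vac_ideal 0"
proof -
  have "p [] = 0" if "p \<in> vac_ideal 0" for p
    using that
  proof induction
    case (lie g h a b)
    have "lbr 0 g h [] = 0"
      by (cases g; cases h) (auto simp: fscale_def fgen_def fword_def)
    then show ?case
      by (simp add: fmul_Nil fgen_def fword_def)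
  qed (auto simp: fscale_def fmul_Nil fgen_def fword_def)
  then show ?thesis
    by (force simp: fone_def fword_def)
qed

lemma valid_alg_dmul1:
  assumes "\<And>n. fst c n \<in> valid_alg N" "\<And>n. snd c n \<in> valid_alg N" "\<And>b n. Q b n \<in> valid_alg N"
  shows "dmul1 c Q b n \<in> valid_alg N"
  unfolding dmul1_def smul_def sderiv_def
  using assms by (auto intro!: valid_alg.add valid_alg_sum valid_alg_fmul valid_alg.scale valid_alg.zero)

lemma valid_alg_Lbar:
  assumes "i \<in> {1..N}" "j \<in> {1..N}"
  shows "fst (Lbar N i j) n \<in> valid_alg N" "snd (Lbar N i j) n \<in> valid_alg N"
  using assms unfolding Lbar_def Lplus_def
  by (auto intro!: valid_alg_uminus valid_alg_diff valid_alg.scale valid_alg_fone valid_alg.zero valid_alg_fgen)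

lemma valid_alg_Lbar_prod:
  assumes "\<And>i j. (i, j) \<in> set ps \<Longrightarrow> i \<in> {1..N} \<and> j \<in> {1..N}"
  shows "Lbar_prod N ps b n \<in> valid_alg N"
  using assms
proof (induction N ps arbitrary: b n rule: Lbar_prod.induct)
  case (1 N)
  then show ?case by (auto simp: dunit_def valid_alg_fone valid_alg.zero)
next
  case (2 N i j ps)
  show ?case
    unfolding Lbar_prod.simps by (intro valid_alg_dmul1 valid_alg_Lbar 2) (use "2.prems" in auto)
qed

lemma sum_fun_apply: "(\<Sum>i\<in>I. f i) x y = (\<Sum>i\<in>I. f i x y)"
  by (induction I rule: infinite_finite_induct) auto

lemma valid_alg_theta: "theta_k N m k r \<in> valid_alg N"
proof -
  have "Lbar_prod N (zip J I) b n \<in> valid_alg N" if "I \<in> Idx N s" "J \<in> Idx N s" for I J s b n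
    using that by (intro valid_alg_Lbar_prod) (auto simp: Idx_def dest: set_zip_leftD set_zip_rightD)
  then show ?thesis
    unfolding theta_k_def theta_def trace_coef_def sum_fun_apply dscale_def
    by (intro valid_alg_sum valid_alg.scale)
qed

section \<open>The vacuum module\<close>

text \<open>The class \<open>ring_1\<close> demands that 0 and 1 differ, hence an endomorphism ring
  belongs to it only if the group is nonzero.\<close>

class nonzero_group = ab_group_add +
  assumes ex_nonzero: "\<exists>x. x \<noteq> 0"

instance "fun" :: (type, nonzero_group) nonzero_group
proof
  obtain y :: 'b where "y \<noteq> 0" using ex_nonzero by blast
  then have "(\<lambda>_::'a. y) \<noteq> 0" by (simp add: fun_eq_iff)
  then show "\<exists>x::'a \<Rightarrow> 'b. x \<noteq> 0" by blast
qed

text \<open>Additivity is enough to obtain a ring. Integers act as \<open>of_int\<close>; complex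
  scalars enter separately as \<open>scalar_endo\<close>.\<close>

typedef (overloaded) 'v endo = "{f :: 'v::ab_group_add \<Rightarrow> 'v. \<forall>x y. f (x + y) = f x + f y}"
  morphisms app Endo
  by (rule exI[of _ id]) simp

setup_lifting type_definition_endo

lemma app_add [simp]: "app f (x + y) = app f x + app f y"
  using app[of f] by blast

lemma app_zero [simp]: "app f 0 = 0"
  using app_add[of f 0 0] by simp

lemma app_minus [simp]: "app f (- x) = - app f x"
  using app_add[of f x "- x"] by (simp add: eq_neg_iff_add_eq_0 add.commute)

lemma app_diff [simp]: "app f (x - y) = app f x - app f y"
  using app_add[of f x "- y"] by simp

lemma app_sum: "app f (sum g I) = (\<Sum>i\<in>I. app f (g i))"
  by (induction I rule: infinite_finite_induct) auto

lemma endo_eqI: "(\<And>x. app f x = app g x) \<Longrightarrow> f = g"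
  using app_inject by blast

lemma app_Endo: "(\<And>x y. f (x + y) = f x + f y) \<Longrightarrow> app (Endo f) = f"
  by (rule Endo_inverse) simp

instantiation endo :: (ab_group_add) "{ring, one}"
begin

lift_definition zero_endo :: "'a endo" is "\<lambda>_. 0" by simp
lift_definition one_endo :: "'a endo" is "\<lambda>x. x" by simp
lift_definition plus_endo :: "'a endo \<Rightarrow> 'a endo \<Rightarrow> 'a endo" is "\<lambda>f g x. f x + g x"
  by (simp add: algebra_simps)
lift_definition minus_endo :: "'a endo \<Rightarrow> 'a endo \<Rightarrow> 'a endo" is "\<lambda>f g x. f x - g x"
  by (simp add: algebra_simps)
lift_definition uminus_endo :: "'a endo \<Rightarrow> 'a endo" is "\<lambda>f x. - f x"
  by simp
lift_definition times_endo :: "'a endo \<Rightarrow> 'a endo \<Rightarrow> 'a endo" is "\<lambda>f g x. f (g x)"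
  by simp

instance
  by standard (transfer; force simp: algebra_simps)+

end

instance endo :: (nonzero_group) ring_1
proof
  show "(0 :: 'a endo) \<noteq> 1"
    using ex_nonzero[where 'a = 'a] by transfer metis
qed (transfer; simp)+

lemma app_zero_endo [simp]: "app 0 x = 0" by transfer simp
lemma app_one [simp]: "app 1 x = x" by transfer simp
lemma app_plus [simp]: "app (f + g) x = app f x + app g x" by transfer simp
lemma app_minus_endo [simp]: "app (f - g) x = app f x - app g x" by transfer simp
lemma app_uminus [simp]: "app (- f) x = - app f x" by transfer simp
lemma app_times [simp]: "app (f * g) x = app f (app g x)" by transfer simp
lemma app_sum_endo: "app (sum f I) x = (\<Sum>i\<in>I. app (f i) x)"
  by (induction I rule: infinite_finite_induct) auto

text \<open>HOL has no types depending on \<open>N\<close>, so the module is only formed for one fixed \<open>N\<close>: a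
  counterexample to the theorem if there is one. The value \<open>0\<close> otherwise is irrelevant; it makes
  the module nonzero in either case.\<close>
definition counterexample :: "nat \<Rightarrow> bool" where
  "counterexample N \<longleftrightarrow> (\<exists>m k r. 1 \<le> m \<and> \<not> in_ztr N (theta_k N m k r))"

definition cex :: nat where
  "cex = (if \<exists>N. counterexample N then SOME N. counterexample N else 0)"

lemma counterexampleI: "counterexample N \<Longrightarrow> counterexample cex"
  unfolding cex_def by (metis someI)

text \<open>If 1 lay in the ideal, so would all of \<open>valid_alg\<close>, and every coefficient
  of every theta would be invariant, against the choice of \<open>cex\<close>. The module is thus
  nonzero without an appeal to a basis theorem.\<close>

lemma fone_notin_vac_ideal_cex: "fone \<notin> vac_ideal cex"
proof (cases "\<exists>N. counterexample N")
  case True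
  then obtain m k r where "\<not> in_ztr cex (theta_k cex m k r)"
    using counterexampleI unfolding counterexample_def by blast
  moreover have "in_ztr cex (theta_k cex m k r)" if "valid_alg cex \<subseteq> vac_ideal cex"
    unfolding in_ztr_def using that valid_alg_fmul_fgen[OF valid_alg_theta] by auto
  ultimately show ?thesis
    using valid_alg_subset_vac_ideal by blast
qed (simp add: cex_def fone_notin_vac_ideal_0)

definition vac_rel :: "falg \<Rightarrow> falg \<Rightarrow> bool" where
  "vac_rel p q \<longleftrightarrow> p \<in> valid_alg cex \<and> q \<in> valid_alg cex \<and> p - q \<in> vac_ideal cex"

lemma vac_rel_refl: "p \<in> valid_alg cex \<Longrightarrow> vac_rel p p"
  by (simp only: vac_rel_def diff_self vac_ideal.zero simp_thms)

lemma vac_rel_add: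
  assumes "vac_rel p p'" "vac_rel q q'"
  shows "vac_rel (p + q) (p' + q')"
proof -
  have "(p + q) - (p' + q') = (p - p') + (q - q')"
    by (rule add_diff_add)
  then show ?thesis
    using assms unfolding vac_rel_def by (simp only: valid_alg.add vac_ideal.add simp_thms)
qed

lemma vac_rel_uminus:
  assumes "vac_rel p p'"
  shows "vac_rel (- p) (- p')"
proof -
  have "(- p) - (- p') = - (p - p')"
    by (simp only: minus_diff_minus)
  then show ?thesis
    using assms unfolding vac_rel_def by (simp only: valid_alg_uminus vac_ideal_uminus simp_thms)
qed

lemma vac_rel_scale:
  assumes "vac_rel p p'"
  shows "vac_rel (fscale c p) (fscale c p')"
proof -
  have "fscale c p - fscale c p' = fscale c (p - p')"
    by (simp add: fscale_def fun_eq_iff algebra_simps)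
  then show ?thesis
    using assms unfolding vac_rel_def by (simp only: valid_alg.scale vac_ideal.scale simp_thms)
qed

lemma vac_rel_fgen:
  assumes "vac_rel p p'" "valid_gen cex g"
  shows "vac_rel (fmul (fgen g) p) (fmul (fgen g) p')"
proof -
  have "fmul (fgen g) p - fmul (fgen g) p' = fmul (fgen g) (p - p')"
    by (rule fmul_diff_right[symmetric])
  then show ?thesis
    using assms unfolding vac_rel_def by (simp only: valid_alg_fmul_fgen vac_ideal_fgen simp_thms)
qed

quotient_type vac = "word \<Rightarrow> complex" / partial: vac_rel
proof (rule part_equivpI)
  show "\<exists>x. vac_rel x x"
    using vac_rel_refl[OF valid_alg.zero] by blast
  show "symp vac_rel"
  proof (rule sympI)
    fix p q assume "vac_rel p q"
    then show "vac_rel q p"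
      unfolding vac_rel_def using vac_ideal_uminus[of "p - q"] by (simp only: minus_diff_eq simp_thms)
  qed
  show "transp vac_rel"
  proof (rule transpI)
    fix p q r assume "vac_rel p q" "vac_rel q r"
    moreover have "p - r = (p - q) + (q - r)"
      by (simp only: diff_add_cancel add_diff_eq)
    ultimately show "vac_rel p r"
      unfolding vac_rel_def by (simp only: vac_ideal.add simp_thms)
  qed
qed

lemma abs_vac_eq_iff: "p \<in> valid_alg cex \<Longrightarrow> q \<in> valid_alg cex \<Longrightarrow> abs_vac p = abs_vac q \<longleftrightarrow> p - q \<in> vac_ideal cex"
  using Quotient_rel[OF Quotient_vac, of p q] vac_rel_refl unfolding vac_rel_def by blast

lemma vac_cases [cases type: vac]: obtains p where "p \<in> valid_alg cex" "v = abs_vac p"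
  using Quotient_abs_rep[OF Quotient_vac, of v] Quotient_rep_reflp[OF Quotient_vac, of v]
  unfolding vac_rel_def by metis

instantiation vac :: "{zero, plus, minus, uminus}"
begin

lift_definition zero_vac :: vac is "0 :: word \<Rightarrow> complex"
  by (rule vac_rel_refl[OF valid_alg.zero])

lift_definition plus_vac :: "vac \<Rightarrow> vac \<Rightarrow> vac" is "(+)"
  by (rule vac_rel_add)

lift_definition uminus_vac :: "vac \<Rightarrow> vac" is "uminus"
  by (rule vac_rel_uminus)

definition minus_vac :: "vac \<Rightarrow> vac \<Rightarrow> vac" where
  "minus_vac v w = v + (- w)"

instance ..

end

lift_definition vscale :: "complex \<Rightarrow> vac \<Rightarrow> vac" is fscale
  by (rule vac_rel_scale)

text \<open>A generator with an index out of range would lead out of \<open>valid_alg\<close>;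
  letting it act by zero makes the action total.\<close>

lift_definition vact :: "gen \<Rightarrow> vac \<Rightarrow> vac" is "\<lambda>g p. if valid_gen cex g then fmul (fgen g) p else 0"
  by (auto intro: vac_rel_fgen vac_rel_refl[OF valid_alg.zero])

lemma abs_vac_zero: "abs_vac 0 = 0"
  by (rule zero_vac.abs_eq[symmetric])

lemma abs_vac_add: "p \<in> valid_alg cex \<Longrightarrow> q \<in> valid_alg cex \<Longrightarrow> abs_vac (p + q) = abs_vac p + abs_vac q"
  by (rule plus_vac.abs_eq[symmetric]) (auto intro: vac_rel_refl simp: eq_onp_def)

lemma abs_vac_uminus: "p \<in> valid_alg cex \<Longrightarrow> abs_vac (- p) = - abs_vac p"
  by (rule uminus_vac.abs_eq[symmetric]) (auto intro: vac_rel_refl simp: eq_onp_def)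

lemma abs_vac_diff: "p \<in> valid_alg cex \<Longrightarrow> q \<in> valid_alg cex \<Longrightarrow> abs_vac (p - q) = abs_vac p - abs_vac q"
  using abs_vac_add[of p "- q"] by (simp only: valid_alg_uminus abs_vac_uminus minus_vac_def diff_conv_add_uminus)

lemma abs_vac_scale: "p \<in> valid_alg cex \<Longrightarrow> abs_vac (fscale c p) = vscale c (abs_vac p)"
  by (rule vscale.abs_eq[symmetric]) (auto intro: vac_rel_refl simp: eq_onp_def)

lemma abs_vac_fgen: "p \<in> valid_alg cex \<Longrightarrow> valid_gen cex g \<Longrightarrow> abs_vac (fmul (fgen g) p) = vact g (abs_vac p)"
  using vact.abs_eq[of p g] by (simp add: vac_rel_refl eq_onp_def)

instance vac :: ab_group_add
proof
  fix a b c :: vac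
  show "a + b + c = a + (b + c)"
    by (cases a; cases b; cases c) (simp only: abs_vac_add[symmetric] valid_alg.add add.assoc)
  show "a + b = b + a"
    by (cases a; cases b) (simp only: abs_vac_add[symmetric] add.commute)
  show "0 + a = a"
    by (cases a) (simp only: abs_vac_zero[symmetric] abs_vac_add[symmetric] valid_alg.zero add_0_left)
  show "- a + a = 0"
    by (cases a) (simp only: abs_vac_zero[symmetric] abs_vac_add[symmetric] abs_vac_uminus[symmetric]
        valid_alg_uminus left_minus)
  show "a - b = a + - b"
    by (rule minus_vac_def)
qed

lemma abs_vac_eq_0_iff: "p \<in> valid_alg cex \<Longrightarrow> abs_vac p = 0 \<longleftrightarrow> p \<in> vac_ideal cex"
  using abs_vac_eq_iff[of p 0] by (simp only: valid_alg.zero abs_vac_zero diff_0_right)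

instance vac :: nonzero_group
proof
  show "\<exists>v::vac. v \<noteq> 0"
    using abs_vac_eq_0_iff[OF valid_alg_fone] fone_notin_vac_ideal_cex by blast
qed

lemma abs_vac_sum: "(\<And>i. i \<in> I \<Longrightarrow> f i \<in> valid_alg cex) \<Longrightarrow> abs_vac (sum f I) = (\<Sum>i\<in>I. abs_vac (f i))"
  by (induction I rule: infinite_finite_induct) (simp_all add: abs_vac_zero abs_vac_add valid_alg_sum)

lemma fscale_add_right: "fscale c (p + q) = fscale c p + fscale c q"
  and fscale_add_left: "fscale (c + d) p = fscale c p + fscale d p"
  and fscale_fscale: "fscale c (fscale d p) = fscale (c * d) p"
  and fscale_one: "fscale 1 p = p"
  by (simp_all add: fscale_def fun_eq_iff algebra_simps)

lemma vscale_add_right: "vscale c (v + w) = vscale c v + vscale c w"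
  by (cases v; cases w)
    (simp only: abs_vac_add[symmetric] abs_vac_scale[symmetric] valid_alg.add valid_alg.scale fscale_add_right)

lemma vscale_add_left: "vscale (c + d) v = vscale c v + vscale d v"
  by (cases v) (simp only: abs_vac_add[symmetric] abs_vac_scale[symmetric] valid_alg.scale fscale_add_left)

lemma vscale_vscale: "vscale c (vscale d v) = vscale (c * d) v"
  by (cases v) (simp only: abs_vac_scale[symmetric] valid_alg.scale fscale_fscale)

lemma vscale_one: "vscale 1 v = v"
  by (cases v) (simp only: abs_vac_scale[symmetric] fscale_one)

lemma vact_add: "vact g (v + w) = vact g v + vact g w"
proof (cases "valid_gen cex g")
  case True
  then show ?thesis
    by (cases v; cases w)
      (simp only: abs_vac_add[symmetric] abs_vac_fgen[symmetric] valid_alg.add valid_alg_fmul_fgen fmul_add_right)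
next
  case False
  have "vact g v = 0" for v
    using False vact.abs_eq[of _ g] by (cases v) (simp add: vac_rel_refl eq_onp_def abs_vac_zero)
  then show ?thesis by simp
qed

definition scalar_endo :: "complex \<Rightarrow> vac endo" where
  "scalar_endo c = Endo (vscale c)"

definition act_E :: "nat \<Rightarrow> nat \<Rightarrow> int \<Rightarrow> vac endo" where
  "act_E i j r = Endo (vact (E i j r))"

definition act_K :: "vac endo" where
  "act_K = Endo (vact Kc)"

lemma app_scalar_endo: "app (scalar_endo c) = vscale c"
  unfolding scalar_endo_def by (rule app_Endo) (rule vscale_add_right)

lemma app_act_E: "app (act_E i j r) = vact (E i j r)"
  unfolding act_E_def by (rule app_Endo) (rule vact_add)

lemma app_act_K: "app act_K = vact Kc"
  unfolding act_K_def by (rule app_Endo) (rule vact_add)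

lemma scalar_endo_add: "scalar_endo (c + d) = scalar_endo c + scalar_endo d"
  by (rule endo_eqI) (simp add: app_scalar_endo vscale_add_left)

lemma scalar_endo_mult: "scalar_endo (c * d) = scalar_endo c * scalar_endo d"
  by (rule endo_eqI) (simp add: app_scalar_endo vscale_vscale)

lemma scalar_endo_1 [simp]: "scalar_endo 1 = 1"
  by (rule endo_eqI) (simp add: app_scalar_endo vscale_one)

lemma scalar_endo_0 [simp]: "scalar_endo 0 = 0"
  using scalar_endo_add[of 0 0] by simp

lemma scalar_endo_minus: "scalar_endo (- c) = - scalar_endo c"
  using scalar_endo_add[of c "- c"] by (simp add: eq_neg_iff_add_eq_0 add.commute)

lemma scalar_endo_of_nat: "scalar_endo (of_nat n) = of_nat n"
  by (induction n) (simp_all add: scalar_endo_add)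

lemma scalar_endo_of_int: "scalar_endo (of_int z) = of_int z"
  by (cases z rule: int_cases2) (simp_all add: scalar_endo_of_nat scalar_endo_minus)

lemma act_K_eq: "act_K = - of_nat cex"
proof (rule endo_eqI)
  fix v
  obtain p where p: "p \<in> valid_alg cex" "v = abs_vac p" by (cases v)
  have "abs_vac (fmul (fgen Kc) p + fscale (of_nat cex) p) = 0"
    using vac_ideal_Kc_valid_alg[OF p(1)] p(1)
    by (subst abs_vac_eq_0_iff) (auto intro!: valid_alg.add valid_alg.scale valid_alg_fmul_fgen simp del: plus_fun_apply)
  then have "vact Kc v + vscale (of_nat cex) v = 0"
    using p by (simp only: abs_vac_add abs_vac_fgen abs_vac_scale valid_alg.scale valid_alg_fmul_fgen valid_gen.simps)
  then have "vact Kc v + app (of_nat cex) v = 0"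
    by (simp only: app_scalar_endo[symmetric] scalar_endo_of_nat)
  then show "app act_K v = app (- of_nat cex) v"
    by (simp add: app_act_K eq_neg_iff_add_eq_0)
qed

text \<open>Substituting K = -N clears the denominator N of the central term. All coefficients
  become integers, so the relation makes sense in the endomorphism ring without complex
  scalars.\<close>

lemma act_E_commutator:
  assumes "i \<in> {1..cex}" "j \<in> {1..cex}" "k \<in> {1..cex}" "l \<in> {1..cex}"
  shows "act_E i j r * act_E k l s - act_E k l s * act_E i j r
    = (if k = j then act_E i l (r + s) else 0) - (if i = l then act_E k j (r + s) else 0)
    - (if r + s = 0 then of_int r * ((if k = j \<and> i = l then of_nat cex else 0) - (if i = j \<and> k = l then 1 else 0)) else 0)"
proof (rule endo_eqI)
  fix v
  have rs: "r = - s \<longleftrightarrow> r + s = 0" by arith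
  have kr: "scalar_endo (kron a b) * x = (if a = b then x else 0)" for a b x
    by (simp add: kron_def)
  obtain p where p: "p \<in> valid_alg cex" "v = abs_vac p" by (cases v)
  define C where "C = of_int r * (if r + s = 0 then 1 else 0) * (kron k j * kron i l - kron i j * kron k l / of_nat cex)"
  let ?g = "E i j r" and ?h = "E k l s"
  have val: "valid_gen cex ?g" "valid_gen cex ?h" "valid_gen cex (E i l t)" "valid_gen cex (E k j t)" "valid_gen cex Kc" for t
    using assms by auto
  have "fmul (fmul (fgen ?g) (fgen ?h) - fmul (fgen ?h) (fgen ?g) - lbr cex ?g ?h) p \<in> vac_ideal cex" (is "?x \<in> _")
    by (rule vac_ideal_lie_valid_alg[OF p(1) val(1,2)])
  moreover have x: "?x = fmul (fgen ?g) (fmul (fgen ?h) p) - fmul (fgen ?h) (fmul (fgen ?g) p)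
     - (fscale (kron k j) (fmul (fgen (E i l (r + s))) p) - fscale (kron i l) (fmul (fgen (E k j (r + s))) p)
        + fscale C (fmul (fgen Kc) p))" (is "_ = ?y")
    by (simp only: lbr.simps C_def rs fmul_diff_left fmul_add_left fmul_scale_left fmul_assoc)
  moreover have "?y \<in> valid_alg cex"
    by (intro valid_alg.add valid_alg_diff valid_alg.scale valid_alg_fmul_fgen p val)
  ultimately have "abs_vac ?y = 0"
    using abs_vac_eq_0_iff[of ?y] by (simp only:)
  then have "vact ?g (vact ?h v) - vact ?h (vact ?g v)
     - (vscale (kron k j) (vact (E i l (r + s)) v) - vscale (kron i l) (vact (E k j (r + s)) v) + vscale C (vact Kc v)) = 0"
    unfolding p(2)
    by (simp only: abs_vac_diff abs_vac_add abs_vac_scale abs_vac_fgen valid_alg.add valid_alg_diff valid_alg.scale valid_alg_fmul_fgen p(1) val)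
  then have "app (act_E i j r * act_E k l s - act_E k l s * act_E i j r) v
    = app (scalar_endo (kron k j) * act_E i l (r + s) - scalar_endo (kron i l) * act_E k j (r + s) + scalar_endo C * act_K) v"
    by (simp add: app_act_E app_act_K app_scalar_endo)
  also have "scalar_endo C * act_K = scalar_endo (C * (- of_nat cex))"
    by (simp add: act_K_eq scalar_endo_mult scalar_endo_minus scalar_endo_of_nat)
  also have "C * (- of_nat cex) = - (if r + s = 0 then of_int r * ((if k = j \<and> i = l then of_nat cex else 0) - (if i = j \<and> k = l then 1 else 0)) else 0)"
  proof -
    have "(of_nat cex :: complex) \<noteq> 0"
      using assms by simp
    then have *: "(a - b / of_nat cex) * of_nat cex = a * of_nat cex - b" for a b :: complex
      by (simp add: left_diff_distrib)
    have "C * (- of_nat cex) = - (of_int r * ((if r + s = 0 then 1 else 0) * (kron k j * kron i l * of_nat cex - kron i j * kron k l)))"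
      unfolding C_def mult_minus_right mult.assoc[of _ _ "of_nat cex"] * by (simp only: mult.assoc)
    then show ?thesis
      unfolding kron_def
      by (cases "r + s = 0"; cases "k = j"; cases "i = l"; cases "i = j"; cases "k = l";
          simp only: if_True if_False simp_thms mult_1_left mult_1_right mult_zero_left mult_zero_right)
  qed
  also have "\<dots> = of_int (- (if r + s = 0 then r * ((if k = j \<and> i = l then int cex else 0) - (if i = j \<and> k = l then 1 else 0)) else 0))"
    by (simp only: of_int_minus of_int_mult of_int_diff if_distrib[where f = of_int] of_int_0 of_int_1
        of_int_of_nat_eq)
  finally show "app (act_E i j r * act_E k l s - act_E k l s * act_E i j r) v =
    app ((if k = j then act_E i l (r + s) else 0) - (if i = l then act_E k j (r + s) else 0)
    - (if r + s = 0 then of_int r * ((if k = j \<and> i = l then of_nat cex else 0) - (if i = j \<and> k = l then 1 else 0)) else 0)) v"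
    unfolding scalar_endo_of_int
    by (simp only: kr of_int_minus of_int_mult of_int_diff if_distrib[where f = of_int] of_int_0 of_int_1
        of_int_of_nat_eq add_uminus_conv_diff)
qed

lemma act_E_vacuum:
  assumes "i \<in> {1..cex}" "j \<in> {1..cex}" "r \<ge> 1 \<or> r = 0 \<and> j \<le> i"
  shows "app (act_E i j r) (abs_vac fone) = 0"
proof -
  have v: "valid_gen cex (E i j r)"
    using assms by simp
  have "fmul (fgen (E i j r)) fone \<in> vac_ideal cex"
    using vac_ideal.pos[of i cex j r "[]"] vac_ideal.zero_low[of i cex j "[]"] assms
    by (auto simp: fone_def)
  then show ?thesis
    using abs_vac_eq_0_iff[OF valid_alg_fmul_fgen[OF valid_alg_fone v]] abs_vac_fgen[OF valid_alg_fone v]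
    by (simp only: app_act_E)
qed

section \<open>Differential operators acting on the vacuum module\<close>

text \<open>An operator with coefficients to the left is stored as \<open>Q b n\<close>, the coefficient of
  \<open>u\<^sup>n \<partial>\<^sup>b\<close>. Here \<open>series_op f\<close> and \<open>euler\<close> are the left multiplications by \<open>f(u)\<close> and \<open>u\<partial>\<close>.\<close>
definition series_op :: "'v::nonzero_group endo fps \<Rightarrow> (nat \<Rightarrow> nat \<Rightarrow> 'v) endo" where
  "series_op f = Endo (\<lambda>Q b n. \<Sum>p\<le>n. app (fps_nth f p) (Q b (n - p)))"

lemma app_series_op: "app (series_op f) Q b n = (\<Sum>p\<le>n. app (fps_nth f p) (Q b (n - p)))"
  unfolding series_op_def by (subst app_Endo) (auto simp: sum.distrib fun_eq_iff)

definition euler :: "(nat \<Rightarrow> nat \<Rightarrow> 'v::nonzero_group) endo" where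
  "euler = Endo (\<lambda>Q b n. app (of_nat n) (Q b n) + (if b = 0 \<or> n = 0 then 0 else Q (b - 1) (n - 1)))"

lemma app_euler: "app euler Q b n = app (of_nat n) (Q b n) + (if b = 0 \<or> n = 0 then 0 else Q (b - 1) (n - 1))"
  unfolding euler_def by (subst app_Endo) (auto simp: fun_eq_iff algebra_simps)

definition fps_euler :: "'a::ring_1 fps \<Rightarrow> 'a fps" where
  "fps_euler f = Abs_fps (\<lambda>n. of_nat n * fps_nth f n)"

lemma endo_fun_eqI: "(\<And>Q b n. app f Q b n = app g Q b n) \<Longrightarrow> f = (g :: (nat \<Rightarrow> nat \<Rightarrow> 'v::ab_group_add) endo)"
  by (rule endo_eqI) (auto simp: fun_eq_iff)

lemma series_op_add: "series_op (f + g) = series_op f + series_op g"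
  by (rule endo_fun_eqI) (simp add: app_series_op sum.distrib)

lemma series_op_diff: "series_op (f - g) = series_op f - series_op g"
  by (rule endo_fun_eqI) (simp add: app_series_op sum_subtractf)

lemma series_op_0 [simp]: "series_op 0 = 0"
  by (rule endo_fun_eqI) (simp add: app_series_op)

lemma series_op_minus: "series_op (- f) = - series_op f"
  using series_op_diff[of 0 f] by simp

lemma series_op_mult: "series_op (f * g) = series_op f * series_op g"
proof (rule endo_fun_eqI)
  fix Q :: "nat \<Rightarrow> nat \<Rightarrow> 'a" and b n
  have "app (series_op f * series_op g) Q b n
      = (\<Sum>p\<le>n. \<Sum>q\<le>n - p. app (fps_nth f p) (app (fps_nth g q) (Q b (n - p - q))))"
    by (simp add: app_series_op app_sum)
  also have "\<dots> = (\<Sum>(p, q)\<in>{(p, q). p + q \<le> n}. app (fps_nth f p) (app (fps_nth g q) (Q b (n - (p + q)))))"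
    by (subst sum.Sigma) (auto intro!: sum.cong)
  also have "\<dots> = (\<Sum>k\<le>n. \<Sum>p\<le>k. app (fps_nth f p) (app (fps_nth g (k - p)) (Q b (n - k))))"
    by (subst sum.triangle_reindex_eq) (auto intro!: sum.cong)
  also have "\<dots> = app (series_op (f * g)) Q b n"
    by (simp add: app_series_op fps_mult_nth app_sum_endo atLeast0AtMost)
  finally show "app (series_op (f * g)) Q b n = app (series_op f * series_op g) Q b n" by simp
qed

lemma app_series_op_const: "app (series_op (fps_const c)) Q b n = app c (Q b n)"
proof -
  have "(\<Sum>p\<le>n. app (fps_nth (fps_const c) p) (Q b (n - p))) = (\<Sum>p\<le>n. if p = 0 then app c (Q b n) else 0)"
    by (intro sum.cong) auto
  then show ?thesis by (simp add: app_series_op)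
qed

lemma series_op_1 [simp]: "series_op 1 = 1"
  by (rule endo_fun_eqI) (simp add: app_series_op_const flip: fps_const_1_eq_1)

lemma series_op_of_nat: "series_op (of_nat n) = of_nat n"
  by (induction n) (simp_all add: series_op_add)

lemma series_op_of_int: "series_op (of_int z) = of_int z"
  by (cases z rule: int_cases2) (simp_all add: series_op_of_nat series_op_minus)

lemma series_op_of_int_mult: "series_op (of_int z * f) = of_int z * series_op f"
  by (simp add: series_op_mult series_op_of_int)

lemma of_nat_app_commute: "app (of_nat n) (app f x) = app f (app (of_nat n) x)"
  by (metis app_times mult_of_nat_commute)

lemma euler_series_op: "euler * series_op f = series_op f * euler + series_op (fps_euler f)"
proof (rule endo_fun_eqI)
  fix Q :: "nat \<Rightarrow> nat \<Rightarrow> 'a" and b n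
  have "(\<Sum>p\<le>n. app (of_nat n) (app (fps_nth f p) (Q b (n - p))))
    = (\<Sum>p\<le>n. app (fps_nth f p) (app (of_nat (n - p)) (Q b (n - p)))
        + app (of_nat p) (app (fps_nth f p) (Q b (n - p))))"
  proof (intro sum.cong refl)
    fix p assume "p \<in> {..n}"
    then have "(of_nat n :: 'a endo) = of_nat (n - p) + of_nat p"
      by (simp flip: of_nat_add)
    then show "app (of_nat n) (app (fps_nth f p) (Q b (n - p)))
       = app (fps_nth f p) (app (of_nat (n - p)) (Q b (n - p))) + app (of_nat p) (app (fps_nth f p) (Q b (n - p)))"
      by (simp only: app_plus of_nat_app_commute)
  qed
  moreover have "(if b = 0 \<or> n = 0 then 0 else \<Sum>p\<le>n - 1. app (fps_nth f p) (Q (b - 1) (n - 1 - p)))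
     = (\<Sum>p\<le>n. app (fps_nth f p) (if b = 0 \<or> n - p = 0 then 0 else Q (b - 1) (n - p - 1)))"
  proof (cases "b = 0 \<or> n = 0")
    case False
    then obtain m where n: "n = Suc m" by (cases n) auto
    show ?thesis
      using False unfolding n sum.atMost_Suc by (auto intro!: sum.cong)
  qed auto
  ultimately show "app (euler * series_op f) Q b n = app (series_op f * euler + series_op (fps_euler f)) Q b n"
    by (simp only: app_times app_plus plus_fun_apply app_euler app_series_op app_sum app_add sum.distrib
        fps_euler_def fps_nth_Abs_fps) (simp add: ac_simps)
qed

section \<open>Commutation relations of the operator matrix\<close>

definition Lplus_coeff :: "nat \<Rightarrow> nat \<Rightarrow> nat \<Rightarrow> int" where
  "Lplus_coeff a b p = (if p = 0 then 1 + sgd b a else 2)"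

text \<open>The minus sign in front of L^+ is absorbed: this series represents -L^+_ab(u), with
  coefficients 0, 1 or 2.\<close>

definition Lplus_op :: "nat \<Rightarrow> nat \<Rightarrow> vac endo fps" where
  "Lplus_op a b = Abs_fps (\<lambda>p. of_int (Lplus_coeff a b p) * act_E a b (- int p))"

lemma Lplus_op_nth: "fps_nth (Lplus_op a b) p = of_int (Lplus_coeff a b p) * act_E a b (- int p)"
  by (simp add: Lplus_op_def)

definition rho_int :: "nat \<Rightarrow> int" where
  "rho_int i = int cex + 1 - 2 * int i"

definition Lbar_op :: "nat \<Rightarrow> nat \<Rightarrow> (nat \<Rightarrow> nat \<Rightarrow> vac) endo" where
  "Lbar_op a b = (if a = b then euler + euler - of_int (rho_int a) else 0) + series_op (Lplus_op a b)"

lemma fps_of_int_mult_nth: "fps_nth (of_int z * f) n = of_int z * fps_nth f n"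
  for f :: "'a::ring_1 fps"
proof -
  have "(of_int z :: 'a fps) = fps_const (of_int z)"
    by (simp add: fps_of_int)
  then show ?thesis by simp
qed

text \<open>The bracket of E_ab[-p] and E_cd[p - n] depends on n alone; its central part vanishes
  because both modes are nonpositive. Each coefficient is therefore one bracket times the
  convolution \<open>\<sigma>\<close> of the numerical coefficients. For n > 0,
  \<open>\<sigma>\<close> is affine in n, its slope producing the Euler derivation u d/du and its
  constant term the signs.\<close>

lemma Lplus_op_commutator:
  assumes I: "a \<in> {1..cex}" "b \<in> {1..cex}" "c \<in> {1..cex}" "d \<in> {1..cex}"
  shows "Lplus_op a b * Lplus_op c d - Lplus_op c d * Lplus_op a b
    = (if b = c then 2 * fps_euler (Lplus_op a d) + of_int (sgd b a + sgd d b) * Lplus_op a d else 0)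
    - (if a = d then 2 * fps_euler (Lplus_op c b) + of_int (sgd b a + sgd a c) * Lplus_op c b else 0)"
proof (rule fps_ext)
  fix n
  define G1 where "G1 = (if b = c then act_E a d (- int n) else 0)"
  define G2 where "G2 = (if a = d then act_E c b (- int n) else 0)"
  define \<sigma> where "\<sigma> = (\<Sum>p\<le>n. Lplus_coeff a b p * Lplus_coeff c d (n - p))"
  have comm: "act_E a b (- int p) * act_E c d (- int (n - p)) - act_E c d (- int (n - p)) * act_E a b (- int p) = G1 - G2"
    if "p \<le> n" for p
  proof -
    have "- int p + - int (n - p) = - int n" using that by simp
    moreover have "(if - int p + - int (n - p) = 0 then of_int (- int p) * x else 0) = 0" for x :: "vac endo"
      using that by auto
    ultimately show ?thesis
      using act_E_commutator[OF I, of "- int p" "- int (n - p)"]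
      by (simp only: G1_def G2_def diff_0_right eq_commute[of b c])
  qed
  have "fps_nth (Lplus_op c d * Lplus_op a b) n = (\<Sum>p\<le>n. fps_nth (Lplus_op c d) (n - p) * fps_nth (Lplus_op a b) p)"
    unfolding fps_mult_nth atLeast0AtMost
    by (rule sum.reindex_bij_witness[of _ "\<lambda>p. n - p" "\<lambda>p. n - p"]) auto
  then have "fps_nth (Lplus_op a b * Lplus_op c d - Lplus_op c d * Lplus_op a b) n
     = (\<Sum>p\<le>n. fps_nth (Lplus_op a b) p * fps_nth (Lplus_op c d) (n - p) - fps_nth (Lplus_op c d) (n - p) * fps_nth (Lplus_op a b) p)"
    by (simp add: fps_mult_nth atLeast0AtMost sum_subtractf)
  also have "\<dots> = (\<Sum>p\<le>n. of_int (Lplus_coeff a b p * Lplus_coeff c d (n - p)) * (G1 - G2))"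
  proof (intro sum.cong refl)
    fix p assume p: "p \<in> {..n}"
    have "of_int y * g * (of_int z * g') - of_int z * g' * (of_int y * g) = of_int (y * z) * (g * g' - g' * g)"
      for y z and g g' :: "vac endo"
    proof -
      have "of_int y * g * (of_int z * g') = of_int (y * z) * (g * g')"
        for y z and g g' :: "vac endo"
        by (simp only: mult.assoc of_int_left_commute[of g z g'] of_int_mult)
      note * = this
      show ?thesis
        unfolding * mult.commute[of z y] by (simp only: right_diff_distrib)
    qed
    then show "fps_nth (Lplus_op a b) p * fps_nth (Lplus_op c d) (n - p) - fps_nth (Lplus_op c d) (n - p) * fps_nth (Lplus_op a b) p
       = of_int (Lplus_coeff a b p * Lplus_coeff c d (n - p)) * (G1 - G2)"
      unfolding Lplus_op_nth using comm p by simp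
  qed
  also have "\<dots> = of_int \<sigma> * (G1 - G2)"
    by (simp add: \<sigma>_def sum_distrib_right)
  finally have L: "fps_nth (Lplus_op a b * Lplus_op c d - Lplus_op c d * Lplus_op a b) n = of_int \<sigma> * G1 - of_int \<sigma> * G2"
    by (simp add: right_diff_distrib)
  have \<sigma>: "\<sigma> = (if n = 0 then (1 + sgd b a) * (1 + sgd d c) else 2 * (1 + sgd b a) + 2 * (1 + sgd d c) + 4 * (int n - 1))"
  proof (cases n)
    case (Suc m)
    have "\<sigma> = Lplus_coeff a b 0 * Lplus_coeff c d n + (\<Sum>p\<le>m. Lplus_coeff a b (Suc p) * Lplus_coeff c d (m - p))"
      unfolding \<sigma>_def Suc by (simp add: sum.atMost_Suc_shift del: sum.atMost_Suc)
    also have "(\<Sum>p\<le>m. Lplus_coeff a b (Suc p) * Lplus_coeff c d (m - p)) = (\<Sum>p<m. Lplus_coeff a b (Suc p) * Lplus_coeff c d (m - p)) + Lplus_coeff a b (Suc m) * Lplus_coeff c d 0"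
      by (simp add: lessThan_Suc_atMost[symmetric])
    also have "(\<Sum>p<m. Lplus_coeff a b (Suc p) * Lplus_coeff c d (m - p)) = (\<Sum>p<m. 4)"
      by (intro sum.cong) (auto simp: Lplus_coeff_def)
    finally show ?thesis
      by (simp add: Suc Lplus_coeff_def)
  qed (simp add: \<sigma>_def Lplus_coeff_def)
  \<comment> \<open>For n = 0 the product of signs reduces to their sum, with a defect of 1 when the
    three indices coincide. This defect occurs in both brackets exactly when a, b, c, d are all
    equal, and there it cancels.\<close>
  have sg3: "(1 + sgd y x) * (1 + sgd z y) = (sgd y x + sgd z y) * (1 + sgd z x) + (if x = y \<and> y = z then 1 else 0)"
    for x y z
    by (auto simp: sgd_def sgn_if)
  have E: "fps_nth (2 * fps_euler f + of_int z * f) n = of_int (2 * int n + z) * fps_nth f n" for f :: "vac endo fps" and z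
    using fps_of_int_mult_nth[of 2 "fps_euler f" n]
    by (simp add: fps_of_int_mult_nth fps_euler_def distrib_right mult.assoc)
  have add_if_mult: "(z + (if P then 1 else 0)) * g = z * g + (if P then g else 0)" for P and z g :: "vac endo"
    by (simp add: distrib_right)
  have R1: "of_int \<sigma> * G1 = fps_nth (if b = c then 2 * fps_euler (Lplus_op a d) + of_int (sgd b a + sgd d b) * Lplus_op a d else 0) n
      + (if (a = b \<and> b = d) \<and> n = 0 then G1 else 0)"
  proof (cases "b = c")
    case True
    have "\<sigma> = (2 * int n + (sgd b a + sgd d b)) * Lplus_coeff a d n + (if (a = b \<and> b = d) \<and> n = 0 then 1 else 0)"
      unfolding \<sigma> Lplus_coeff_def True[symmetric] sg3[of b a d] by simp
    then have "of_int \<sigma> = of_int (2 * int n + (sgd b a + sgd d b)) * of_int (Lplus_coeff a d n)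
        + (if (a = b \<and> b = d) \<and> n = 0 then 1 else 0 :: vac endo)"
      by (simp only: of_int_add of_int_mult if_distrib[where f = of_int] of_int_1 of_int_0)
    then show ?thesis
      unfolding if_P[OF True] E Lplus_op_nth by (simp only: add_if_mult mult.assoc) (simp add: G1_def True)
  qed (simp add: G1_def)
  have R2: "of_int \<sigma> * G2 = fps_nth (if a = d then 2 * fps_euler (Lplus_op c b) + of_int (sgd b a + sgd a c) * Lplus_op c b else 0) n
      + (if (c = a \<and> a = b) \<and> n = 0 then G2 else 0)"
  proof (cases "a = d")
    case True
    have "\<sigma> = (2 * int n + (sgd b a + sgd a c)) * Lplus_coeff c b n + (if (c = a \<and> a = b) \<and> n = 0 then 1 else 0)"
      unfolding \<sigma> Lplus_coeff_def True[symmetric] mult.commute[of "1 + sgd b a"] sg3[of a c b] by simp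
    then have "of_int \<sigma> = of_int (2 * int n + (sgd b a + sgd a c)) * of_int (Lplus_coeff c b n)
        + (if (c = a \<and> a = b) \<and> n = 0 then 1 else 0 :: vac endo)"
      by (simp only: of_int_add of_int_mult if_distrib[where f = of_int] of_int_1 of_int_0)
    then show ?thesis
      unfolding if_P[OF True] E Lplus_op_nth by (simp only: add_if_mult mult.assoc) (simp add: G2_def True)
  qed (simp add: G2_def)
  have "(if (a = b \<and> b = d) \<and> n = 0 then G1 else 0) = (if (c = a \<and> a = b) \<and> n = 0 then G2 else 0)"
    unfolding G1_def G2_def by (cases "a = b"; cases "b = c"; cases "c = d") auto
  then show "fps_nth (Lplus_op a b * Lplus_op c d - Lplus_op c d * Lplus_op a b) n = fps_nth
    ((if b = c then 2 * fps_euler (Lplus_op a d) + of_int (sgd b a + sgd d b) * Lplus_op a d else 0)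
    - (if a = d then 2 * fps_euler (Lplus_op c b) + of_int (sgd b a + sgd a c) * Lplus_op c b else 0)) n"
    unfolding L R1 R2 by (simp only: fps_sub_nth add_diff_add diff_self add_0_right)
qed

lemma vac_two_cancel: "v + v = 0 \<Longrightarrow> v = 0" for v :: vac
proof -
  assume "v + v = 0"
  then have "vscale (1 / 2) (v + v) = vscale (1 / 2) 0" by simp
  moreover have "vscale (1 / 2) (v + v) = v"
    by (simp add: vscale_add_right flip: vscale_add_left) (simp add: vscale_one)
  moreover have "vscale (1 / 2) 0 = 0"
    using vscale_add_right[of "1 / 2" 0 0] by simp
  ultimately show "v = 0" by simp
qed

definition Lbar_diff :: "nat \<Rightarrow> nat \<Rightarrow> (nat \<Rightarrow> nat \<Rightarrow> vac) endo" where
  "Lbar_diff a b = (if a = b then euler + euler - of_int (rho_int a) else 0)"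

lemma Lbar_op_Lbar_diff: "Lbar_op a b = Lbar_diff a b + series_op (Lplus_op a b)"
  by (simp add: Lbar_op_def Lbar_diff_def)

lemma Lbar_diff_series_op: "Lbar_diff a b * series_op f - series_op f * Lbar_diff a b = series_op (if a = b then 2 * fps_euler f else 0)"
proof (cases "a = b")
  case True
  have "Lbar_diff a b * series_op f = euler * series_op f + euler * series_op f - of_int (rho_int a) * series_op f"
    "series_op f * Lbar_diff a b = series_op f * euler + series_op f * euler - of_int (rho_int a) * series_op f"
    using True by (simp_all add: Lbar_diff_def algebra_simps mult_of_int_commute)
  then show ?thesis
    using True by (simp add: euler_series_op mult_2 series_op_add)
qed (simp add: Lbar_diff_def)

lemma Lbar_diff_commute: "Lbar_diff a b * Lbar_diff c d = Lbar_diff c d * Lbar_diff a b"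
proof -
  have "(x - of_int z) * (x - of_int z') = (x - of_int z') * (x - of_int z)"
    for x :: "(nat \<Rightarrow> nat \<Rightarrow> vac) endo" and z z'
    using mult_of_int_commute[of z x] mult_of_int_commute[of z' x]
      mult_of_int_commute[of z "of_int z' :: (nat \<Rightarrow> nat \<Rightarrow> vac) endo"]
    by (simp add: left_diff_distrib right_diff_distrib)
  then show ?thesis
    unfolding Lbar_diff_def by (cases "a = b"; cases "c = d") auto
qed

lemma Lbar_op_commutator:
  "Lbar_op a b * Lbar_op c d - Lbar_op c d * Lbar_op a b = series_op (Lplus_op a b * Lplus_op c d - Lplus_op c d * Lplus_op a b
    + (if a = b then 2 * fps_euler (Lplus_op c d) else 0) - (if c = d then 2 * fps_euler (Lplus_op a b) else 0))"
proof -
  have "Lbar_op a b * Lbar_op c d - Lbar_op c d * Lbar_op a b = (Lbar_diff a b * Lbar_diff c d - Lbar_diff c d * Lbar_diff a b)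
     + (series_op (Lplus_op a b) * series_op (Lplus_op c d) - series_op (Lplus_op c d) * series_op (Lplus_op a b))
     + (Lbar_diff a b * series_op (Lplus_op c d) - series_op (Lplus_op c d) * Lbar_diff a b) - (Lbar_diff c d * series_op (Lplus_op a b) - series_op (Lplus_op a b) * Lbar_diff c d)"
    unfolding Lbar_op_Lbar_diff by (simp add: algebra_simps)
  also have "\<dots> = series_op (Lplus_op a b) * series_op (Lplus_op c d) - series_op (Lplus_op c d) * series_op (Lplus_op a b)
     + series_op (if a = b then 2 * fps_euler (Lplus_op c d) else 0) - series_op (if c = d then 2 * fps_euler (Lplus_op a b) else 0)"
    by (simp only: Lbar_diff_series_op Lbar_diff_commute diff_self add_0_left)
  finally show ?thesis
    by (simp only: series_op_add series_op_diff series_op_mult)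
qed

text \<open>\<open>Lbar_op\<close> and \<open>Lplus_op\<close> differ only on the diagonal, where
  the sign coefficients of the deformed Manin relations vanish.\<close>

lemma of_int_mult_Lbar_op:
  assumes "a = b \<Longrightarrow> z = 0"
  shows "of_int z * Lbar_op a b = series_op (of_int z * Lplus_op a b)"
  using assms by (cases "a = b") (simp_all add: Lbar_op_def series_op_of_int_mult)

lemma four_term:
  fixes e1 :: "'a::ab_group_add"
  shows "((if P then e1 + z1 else 0) - (if Q then e2 + z2 else 0) + (if R then e3 else 0) - (if S then e4 else 0))
    - ((if R then e3 + z3 else 0) - (if S then e4 + z4 else 0) + (if P then e1 else 0) - (if Q then e2 else 0))
    = (if P then z1 else 0) - (if Q then z2 else 0) - (if R then z3 else 0) + (if S then z4 else 0)"
  by (simp add: algebra_simps)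

text \<open>In [L_ab, L_cd] Euler derivatives arise from the bracket of currents when b = c or a =
  d, and from the summand 2u d of a diagonal entry when a = b or c = d. Exchanging a and c swaps
  these two sources, so the derivatives cancel in the difference of the commutators and only sign
  terms survive.\<close>

lemma Lbar_op_manin: "trig_manin cex Lbar_op"
proof
  fix x :: "(nat \<Rightarrow> nat \<Rightarrow> vac) endo"
  assume x: "x + x = 0"
  show "x = 0"
  proof (rule endo_fun_eqI)
    fix Q b n
    have "app (x + x) Q b n = 0" using x by simp
    then show "app x Q b n = app 0 Q b n"
      using vac_two_cancel[of "app x Q b n"] by simp
  qed
next
  fix a b c d
  assume I: "a \<in> {1..cex}" "b \<in> {1..cex}" "c \<in> {1..cex}" "d \<in> {1..cex}"
  have z: "(if b = c then of_int (sgd b a + sgd d b) * Lbar_op a d else 0) = series_op (if b = c then of_int (sgd b a + sgd d b) * Lplus_op a d else 0)"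
    "(if a = d then of_int (sgd b a + sgd a c) * Lbar_op c b else 0) = series_op (if a = d then of_int (sgd b a + sgd a c) * Lplus_op c b else 0)"
    "(if a = b then of_int (sgd b c + sgd d b) * Lbar_op c d else 0) = series_op (if a = b then of_int (sgd b c + sgd d b) * Lplus_op c d else 0)"
    "(if c = d then of_int (sgd b c + sgd c a) * Lbar_op a b else 0) = series_op (if c = d then of_int (sgd b c + sgd c a) * Lplus_op a b else 0)"
    using sgd_swap[of b a] sgd_swap[of b c] sgd_swap[of c a]
    by (simp_all only: of_int_mult_Lbar_op series_op_0 add.left_inverse add.right_inverse split: if_split) simp_all
  have "Lbar_op a b * Lbar_op c d - Lbar_op c d * Lbar_op a b - (Lbar_op c b * Lbar_op a d - Lbar_op a d * Lbar_op c b)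
     = series_op ((Lplus_op a b * Lplus_op c d - Lplus_op c d * Lplus_op a b
    + (if a = b then 2 * fps_euler (Lplus_op c d) else 0) - (if c = d then 2 * fps_euler (Lplus_op a b) else 0))
    - (Lplus_op c b * Lplus_op a d - Lplus_op a d * Lplus_op c b
    + (if b = c then 2 * fps_euler (Lplus_op a d) else 0) - (if a = d then 2 * fps_euler (Lplus_op c b) else 0)))"
    by (simp only: Lbar_op_commutator series_op_diff eq_commute[of c b])
  also have "\<dots> = series_op ((if b = c then of_int (sgd b a + sgd d b) * Lplus_op a d else 0)
      - (if a = d then of_int (sgd b a + sgd a c) * Lplus_op c b else 0)
      - (if a = b then of_int (sgd b c + sgd d b) * Lplus_op c d else 0)
      + (if c = d then of_int (sgd b c + sgd c a) * Lplus_op a b else 0))"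
    unfolding Lplus_op_commutator[OF I] Lplus_op_commutator[OF I(3,2,1,4)] eq_commute[of b a] four_term ..
  finally show "Lbar_op a b * Lbar_op c d - Lbar_op c d * Lbar_op a b - (Lbar_op c b * Lbar_op a d - Lbar_op a d * Lbar_op c b)
      = (if b = c then of_int (sgd b a + sgd d b) * Lbar_op a d else 0)
      - (if a = d then of_int (sgd b a + sgd a c) * Lbar_op c b else 0)
      - (if a = b then of_int (sgd b c + sgd d b) * Lbar_op c d else 0)
      + (if c = d then of_int (sgd b c + sgd c a) * Lbar_op a b else 0)"
    unfolding z by (simp only: series_op_add series_op_diff)
qed

section \<open>Commutators with generators of the annihilating subalgebra\<close>

lemma fps_euler_const [simp]: "fps_euler (fps_const c) = 0"
  by (rule fps_ext) (simp add: fps_euler_def)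

lemma series_op_const_Lbar_op:
  "series_op (fps_const g) * Lbar_op k l - Lbar_op k l * series_op (fps_const g) = series_op (fps_const g * Lplus_op k l - Lplus_op k l * fps_const g)"
proof -
  have "Lbar_diff k l * series_op (fps_const g) = series_op (fps_const g) * Lbar_diff k l"
    using Lbar_diff_series_op[of k l "fps_const g"] by (simp split: if_splits)
  then show ?thesis
    by (simp add: Lbar_op_Lbar_diff series_op_diff series_op_mult algebra_simps)
qed

lemma fps_const_Lplus_op_commutator_nth:
  "fps_nth (fps_const g * Lplus_op k l - Lplus_op k l * fps_const g) n
    = of_int (Lplus_coeff k l n) * (g * act_E k l (- int n) - act_E k l (- int n) * g)"
proof -
  have "g * (of_int z * x) = of_int z * (g * x)" for z and x :: "vac endo"
    by (rule of_int_left_commute)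
  then show ?thesis
    by (simp add: Lplus_op_nth right_diff_distrib mult.assoc)
qed

lemma cartan_Lbar_op:
  assumes "i \<in> {1..cex}" "k \<in> {1..cex}" "l \<in> {1..cex}"
  shows "series_op (fps_const (act_E i i 0)) * Lbar_op k l = Lbar_op k l * series_op (fps_const (act_E i i 0))
    + of_int ((if k = i then 1 else 0) - (if l = i then 1 else 0)) * Lbar_op k l"
proof -
  let ?z = "(if k = i then 1 else 0) - (if l = i then 1 else 0 :: int)"
  have "act_E i i 0 * act_E k l r - act_E k l r * act_E i i 0 = of_int ?z * act_E k l r" for r
    unfolding act_E_commutator[OF assms(1,1,2,3)] by auto
  then have "fps_const (act_E i i 0) * Lplus_op k l - Lplus_op k l * fps_const (act_E i i 0) = of_int ?z * Lplus_op k l"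
    by (intro fps_ext, simp only: fps_const_Lplus_op_commutator_nth fps_of_int_mult_nth Lplus_op_nth)
      (rule of_int_left_commute)
  moreover have "of_int ?z * Lbar_op k l = series_op (of_int ?z * Lplus_op k l)"
    by (rule of_int_mult_Lbar_op) simp
  ultimately have "series_op (fps_const (act_E i i 0)) * Lbar_op k l - Lbar_op k l * series_op (fps_const (act_E i i 0)) = of_int ?z * Lbar_op k l"
    using series_op_const_Lbar_op[of "act_E i i 0" k l] by (simp only:)
  then show ?thesis
    by (simp only: diff_eq_eq add.commute)
qed

text \<open>The bilinear form of the central term vanishes on the identity matrix: the sum over i of
  N [i = k] - 1 is zero. The summand \<open>of_int (0 - 0)\<close> gives the statement the shape of
  a weight relation, as \<open>weight_zero_kills\<close> expects.\<close>

lemma center_Lbar_op: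
  assumes "k \<in> {1..cex}" "l \<in> {1..cex}"
  shows "series_op (fps_const (\<Sum>i=1..cex. act_E i i r)) * Lbar_op k l = Lbar_op k l * series_op (fps_const (\<Sum>i=1..cex. act_E i i r))
     + of_int (0 - 0) * Lbar_op k l"
proof -
  have "(\<Sum>i=1..cex. act_E i i r) * act_E k l s - act_E k l s * (\<Sum>i=1..cex. act_E i i r) = 0" for s
  proof -
    have S: "(\<Sum>i=1..cex. if P then z * f i else 0) = (if P then z * (\<Sum>i=1..cex. f i) else 0)"
      for P z and f :: "nat \<Rightarrow> vac endo"
      by (cases P) (simp_all add: sum_distrib_left)
    have "(\<Sum>i=1..cex. act_E i i r) * act_E k l s - act_E k l s * (\<Sum>i=1..cex. act_E i i r)
      = (\<Sum>i=1..cex. act_E i i r * act_E k l s - act_E k l s * act_E i i r)"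
      by (simp only: sum_distrib_left sum_distrib_right sum_subtractf)
    also have "\<dots> = (\<Sum>i=1..cex. (if i = k then act_E k l (r + s) else 0) - (if i = l then act_E k l (r + s) else 0)
        - (if r + s = 0 \<and> k = l then of_int r * ((if i = k then of_nat cex else 0) - 1) else 0))"
      using assms by (intro sum.cong refl) (subst act_E_commutator, auto)
    also have "\<dots> = (\<Sum>i=1..cex. if i = k then act_E k l (r + s) else 0)
        - (\<Sum>i=1..cex. if i = l then act_E k l (r + s) else 0)
        - (if r + s = 0 \<and> k = l then of_int r * (\<Sum>i=1..cex. (if i = k then of_nat cex else 0) - 1) else 0)"
      by (simp only: sum_subtractf S)
    also have "\<dots> = 0"
      using assms by (simp add: sum_subtractf)
    finally show ?thesis .
  qed
  then have "fps_const (\<Sum>i=1..cex. act_E i i r) * Lplus_op k l - Lplus_op k l * fps_const (\<Sum>i=1..cex. act_E i i r) = 0"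
    by (intro fps_ext) (simp only: fps_const_Lplus_op_commutator_nth mult_zero_right fps_zero_nth)
  then show ?thesis
    using series_op_const_Lbar_op[of "\<Sum>i=1..cex. act_E i i r" k l] by (simp only: series_op_0) simp
qed


definition root_weight :: "nat \<Rightarrow> nat \<Rightarrow> nat \<Rightarrow> int" where
  "root_weight c q i = (if i = c then 1 else if i = q then - 1 else 0)"

text \<open>The signs relative to the neighbours c and q agree at every other index, so there the
  zero mode behaves like the other modes. Corrections arise only at the entries (c, c), (q, q) and
  (c, q); the first two produce the weight term, the last the Cartan term.\<close>

lemma simple_root_Lplus_op:
  assumes I: "c \<in> {1..cex}" "q \<in> {1..cex}" "k \<in> {1..cex}" "l \<in> {1..cex}" and q: "q = Suc c"
  shows "fps_const (act_E q c 0) * Lplus_op k l - Lplus_op k l * fps_const (act_E q c 0)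
    = (if k = c then Lplus_op q l else 0) - (if l = q then Lplus_op k c else 0)
    + (if k = l then of_int (root_weight c q k) * fps_const (act_E q c 0) else 0)
    - (if k = c \<and> l = q then fps_const (act_E c c 0 - act_E q q 0) else 0)" (is "_ = ?R")
proof (rule fps_ext)
  fix n
  have L: "fps_nth (fps_const (act_E q c 0) * Lplus_op k l - Lplus_op k l * fps_const (act_E q c 0)) n
    = of_int (Lplus_coeff k l n) * ((if k = c then act_E q l (- int n) else 0) - (if q = l then act_E k c (- int n) else 0))"
    unfolding fps_const_Lplus_op_commutator_nth act_E_commutator[OF I(2,1,3,4)] by simp
  have cq: "c \<noteq> q" "sgd q c = 1" "sgd c q = - 1"
    using q by (auto simp: sgd_def)
  have sgd: "sgd x q = sgd x c" "sgd q x = sgd c x" if "x \<noteq> c" "x \<noteq> q" for x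
    using that q by (auto simp: sgd_def sgn_if)
  have K: "fps_nth (of_int z * fps_const g) n = (if n = 0 then of_int z * g else 0)" for z and g :: "vac endo"
    by (simp add: fps_of_int_mult_nth)
  consider "k = c" "l = q" | "k = c" "l = c" | "k = c" "l \<noteq> q" "l \<noteq> c" | "k = q" "l = q"
    | "k \<noteq> c" "k \<noteq> q" "l = q" | "k \<noteq> c" "l \<noteq> q" by blast
  then show "fps_nth (fps_const (act_E q c 0) * Lplus_op k l - Lplus_op k l * fps_const (act_E q c 0)) n = fps_nth ?R n"
  proof cases
    case 1
    then show ?thesis
      unfolding L using cq by (cases "n = 0") (simp_all add: Lplus_op_nth Lplus_coeff_def algebra_simps mult_2)
  next
    case 2
    then show ?thesis
      unfolding L using cq by (cases "n = 0") (simp_all add: Lplus_op_nth Lplus_coeff_def K root_weight_def)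
  next
    case 3
    then show ?thesis
      unfolding L using cq sgd by (cases "n = 0") (simp_all add: Lplus_op_nth Lplus_coeff_def)
  next
    case 4
    then show ?thesis
      unfolding L using cq by (cases "n = 0") (simp_all add: Lplus_op_nth Lplus_coeff_def K root_weight_def)
  next
    case 5
    then show ?thesis
      unfolding L using cq sgd by (cases "n = 0") (simp_all add: Lplus_op_nth Lplus_coeff_def)
  next
    case 6
    then show ?thesis
      unfolding L using cq by (simp add: root_weight_def)
  qed
qed

text \<open>The mode of E_1N[1] raises degrees by one, hence the factors \<open>fps_X\<close>. The
  number 2 * cex is the coefficient 2 of E_N1[-1] times the N from the central term at K =
  -N.\<close>

lemma affine_root_Lplus_op:
  assumes N: "cex \<ge> 2" and I: "k \<in> {1..cex}" "l \<in> {1..cex}"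
  defines "c \<equiv> cex" and "q \<equiv> 1::nat"
  shows "fps_const (act_E q c 1) * Lplus_op k l - Lplus_op k l * fps_const (act_E q c 1)
    = (if k = c then fps_X * Lplus_op q l else 0) - (if l = q then Lplus_op k c * fps_X else 0)
    + (if k = l then of_int (root_weight c q k) * fps_const (act_E q c 1) else 0)
    - (if k = c \<and> l = q then fps_X * fps_const (act_E c c 0 - act_E q q 0) else 0)
    - (if k = c \<and> l = q then of_int (2 * int cex) * fps_X else 0)" (is "_ = ?R")
proof (rule fps_ext)
  fix n
  have cq: "c \<noteq> q" "c \<in> {1..cex}" "q \<in> {1..cex}" "sgd c q = 1" "sgd q c = - 1"
    using N by (auto simp: c_def q_def sgd_def)
  have sgd: "sgd x q = 1" "sgd c x = 1" "sgd x c = - 1" "sgd q x = - 1"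
    if "x \<noteq> c" "x \<noteq> q" "x \<in> {1..cex}" for x
    using that by (auto simp: c_def q_def sgd_def)
  have L: "fps_nth (fps_const (act_E q c 1) * Lplus_op k l - Lplus_op k l * fps_const (act_E q c 1)) n
    = of_int (Lplus_coeff k l n) * ((if k = c then act_E q l (1 - int n) else 0) - (if q = l then act_E k c (1 - int n) else 0)
       - (if n = 1 then (if k = c \<and> q = l then of_nat cex else 0) else 0))"
    unfolding fps_const_Lplus_op_commutator_nth act_E_commutator[OF cq(3,2) I] using cq(1) by simp
  have K: "fps_nth (of_int z * fps_const g) n = (if n = 0 then of_int z * g else 0)" for z and g :: "vac endo"
    by (simp add: fps_of_int_mult_nth)
  have X1: "fps_nth (fps_X * f) n = (if n = 0 then 0 else fps_nth f (n - 1))"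
    "fps_nth (f * fps_X) n = (if n = 0 then 0 else fps_nth f (n - 1))" for f :: "vac endo fps"
    by (simp_all flip: fps_mult_fps_X_commute)
  have n: "n = 0 \<or> n = 1 \<or> (\<exists>m. n = Suc (Suc m))"
    by (cases n; cases "n - 1") auto
  consider "k = c" "l = q" | "k = c" "l = c" | "k = c" "l \<noteq> q" "l \<noteq> c" | "k = q" "l = q"
    | "k \<noteq> c" "k \<noteq> q" "l = q" | "k \<noteq> c" "l \<noteq> q" by blast
  then show "fps_nth (fps_const (act_E q c 1) * Lplus_op k l - Lplus_op k l * fps_const (act_E q c 1)) n = fps_nth ?R n"
  proof cases
    case 1
    then show ?thesis
      unfolding L using cq n by (auto simp: X1 fps_of_int_mult_nth Lplus_op_nth Lplus_coeff_def algebra_simps mult_2)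
  next
    case 2
    then show ?thesis
      unfolding L using cq n by (auto simp: X1 Lplus_op_nth Lplus_coeff_def K root_weight_def)
  next
    case 3
    then show ?thesis
      unfolding L using cq sgd[of l] I n by (auto simp: X1 Lplus_op_nth Lplus_coeff_def)
  next
    case 4
    then show ?thesis
      unfolding L using cq n by (auto simp: X1 Lplus_op_nth Lplus_coeff_def K root_weight_def)
  next
    case 5
    then show ?thesis
      unfolding L using cq sgd[of k] I n by (auto simp: X1 Lplus_op_nth Lplus_coeff_def)
  next
    case 6
    then show ?thesis
      unfolding L using cq by (simp add: root_weight_def)
  qed
qed

section \<open>Annihilation by the simple root vectors\<close>

text \<open>The hypothesis \<open>z\<close> balances rho against the central term. A finite root has
  rho_c - rho_q = 2 and z = 0; the affine root has rho_N - rho_1 = 2 - 2N and z = 2N, the value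
  supplied by the critical level.\<close>

lemma simple_rootI:
  assumes cq: "c \<in> {1..cex}" "q \<in> {1..cex}" "c \<noteq> q"
    and eps: "\<And>a. a \<in> {1..cex} \<Longrightarrow>
      sgd c a - sgd q a = 2 * eps - (if a = c then 1 else 0) - (if a = q then 1 else 0)"
    and U: "\<And>f. f * U = U * f" "fps_euler U = of_int eps * U"
    and z: "rho_int c - rho_int q - 2 = - z"
    and Lplus_op: "\<And>k l. k \<in> {1..cex} \<Longrightarrow> l \<in> {1..cex} \<Longrightarrow>
      fps_const f * Lplus_op k l - Lplus_op k l * fps_const f
      = (if k = c then U * Lplus_op q l else 0) - (if l = q then Lplus_op k c * U else 0)
      + (if k = l then of_int (root_weight c q k) * fps_const f else 0)
      - (if k = c \<and> l = q then U * fps_const (act_E c c 0 - act_E q q 0) else 0)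
      - (if k = c \<and> l = q then of_int z * U else 0)"
  shows "simple_root cex Lbar_op c q eps (series_op U) (series_op (fps_const f))
    (series_op (fps_const (act_E c c 0 - act_E q q 0))) (root_weight c q)"
proof (intro simple_root.intro Lbar_op_manin simple_root_axioms.intro)
  show "root_weight c q i = (if i = c then 1 else if i = q then - 1 else 0)" for i
    by (rule root_weight_def)
next
  fix k l assume kl: "k \<in> {1..cex}" "l \<in> {1..cex}"
  have 2: "series_op (2 * (of_int eps * U)) = of_int (2 * eps) * series_op U"
    using series_op_of_int_mult[of "2 * eps" U] by (simp add: mult.assoc)
  have dU: "Lbar_diff i j * series_op U = series_op U * Lbar_diff i j + (if i = j then of_int (2 * eps) * series_op U else 0)" for i j
    using Lbar_diff_series_op[of i j U] by (simp add: U(2) diff_eq_eq 2 del: of_int_mult split: if_splits)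
  show "Lbar_op k l * series_op U = series_op U * (Lbar_op k l + (if k = l then of_int (2 * eps) else 0))"
    unfolding Lbar_op_Lbar_diff distrib_left distrib_right dU series_op_mult[symmetric] U(1)
    using mult_of_int_commute[of "2 * eps" "series_op U"] by (auto simp: algebra_simps)
  have "series_op (fps_const (act_E c c 0 - act_E q q 0)) = series_op (fps_const (act_E c c 0)) - series_op (fps_const (act_E q q 0))"
    by (simp flip: series_op_diff)
  moreover have "root_weight c q k - root_weight c q l = (if k = c then 1 else 0) - (if l = c then 1 else 0)
     - ((if k = q then 1 else 0) - (if l = q then 1 else 0))"
    using cq(3) by (auto simp: root_weight_def)
  ultimately show "series_op (fps_const (act_E c c 0 - act_E q q 0)) * Lbar_op k l = Lbar_op k l * series_op (fps_const (act_E c c 0 - act_E q q 0))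
      + of_int (root_weight c q k - root_weight c q l) * Lbar_op k l"
    using cartan_Lbar_op[OF cq(1) kl] cartan_Lbar_op[OF cq(2) kl]
    by (simp only: left_diff_distrib right_diff_distrib of_int_diff add_diff_add)
  let ?F = "series_op (fps_const f)" and ?H = "series_op (fps_const (act_E c c 0 - act_E q q 0))" and ?u = "series_op U"
  \<comment> \<open>On the entry (c, q) the differential parts 2u d - rho at the two diagonal places
    do not cancel: they leave the difference of the rho values and the 2 eps from differentiating
    u.\<close>
  have d: "(if k = c then ?u * Lbar_diff q l else 0) - (if l = q then Lbar_diff k c * ?u else 0)
      = (if k = c \<and> l = q then of_int (rho_int c - rho_int q - 2 * eps) * ?u else 0)"
  proof -
    have "?u * Lbar_diff q q - Lbar_diff c c * ?u = of_int (rho_int c - rho_int q - 2 * eps) * ?u"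
      unfolding dU using mult_of_int_commute[of "rho_int c" ?u] mult_of_int_commute[of "rho_int q" ?u]
      by (simp add: Lbar_diff_def algebra_simps)
    then show ?thesis
      by (cases "k = c"; cases "l = q") (auto simp: Lbar_diff_def)
  qed
  have "?F * Lbar_op k l - Lbar_op k l * ?F = series_op (fps_const f * Lplus_op k l - Lplus_op k l * fps_const f)"
    by (rule series_op_const_Lbar_op)
  also have "\<dots> = (if k = c then ?u * series_op (Lplus_op q l) else 0) - (if l = q then series_op (Lplus_op k c) * ?u else 0)
      + (if k = l then of_int (root_weight c q k) * ?F else 0)
      - (if k = c \<and> l = q then ?u * ?H else 0)
      - (if k = c \<and> l = q then of_int z * ?u else 0)"
    unfolding Lplus_op[OF kl] series_op_diff series_op_add
    by (simp only: if_distrib[where f = series_op] series_op_0 series_op_mult series_op_of_int)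
  also have "(if k = c then ?u * series_op (Lplus_op q l) else 0) - (if l = q then series_op (Lplus_op k c) * ?u else 0)
     = ((if k = c then ?u * Lbar_op q l else 0) - (if l = q then Lbar_op k c * ?u else 0))
      - ((if k = c then ?u * Lbar_diff q l else 0) - (if l = q then Lbar_diff k c * ?u else 0))"
    by (simp add: Lbar_op_Lbar_diff distrib_left distrib_right)
  also have "\<dots> = ((if k = c then ?u * Lbar_op q l else 0) - (if l = q then Lbar_op k c * ?u else 0))
     - (if k = c \<and> l = q then of_int (rho_int c - rho_int q - 2 * eps) * ?u else 0)"
    unfolding d ..
  finally have 3: "?F * Lbar_op k l - Lbar_op k l * ?F =
     ((if k = c then ?u * Lbar_op q l else 0) - (if l = q then Lbar_op k c * ?u else 0))
     - (if k = c \<and> l = q then of_int (rho_int c - rho_int q - 2 * eps) * ?u else 0)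
     + (if k = l then of_int (root_weight c q k) * ?F else 0)
      - (if k = c \<and> l = q then ?u * ?H else 0)
      - (if k = c \<and> l = q then of_int z * ?u else 0)" .
  have "of_int (rho_int c - rho_int q - 2 * eps) * ?u + of_int z * ?u = of_int (2 - 2 * eps) * ?u"
  proof -
    have "rho_int c - rho_int q - 2 * eps + z = 2 - 2 * eps" using z by simp
    then show ?thesis by (simp only: distrib_right[symmetric] of_int_add[symmetric])
  qed
  then have 4: "(if k = c \<and> l = q then of_int (2 - 2 * eps) * ?u else 0)
      = (if k = c \<and> l = q then of_int (rho_int c - rho_int q - 2 * eps) * ?u else 0) + (if k = c \<and> l = q then of_int z * ?u else 0)"
    by (cases "k = c \<and> l = q") (simp_all only: if_True if_False add_0_left simp_thms)
  show "?F * Lbar_op k l = Lbar_op k l * ?F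
        + (if k = c then ?u * Lbar_op q l else 0) - (if l = q then Lbar_op k c * ?u else 0)
        - (if k = c \<and> l = q then of_int (2 - 2 * eps) * ?u else 0)
        + (if k = l then of_int (root_weight c q k) * ?F else 0) - (if k = c \<and> l = q then ?u * ?H else 0)"
    unfolding 4 using 3 by (simp only: diff_eq_eq) (simp only: algebra_simps)
qed (use assms in auto)

text \<open>The identity differential operator, with its coefficient 1 replaced by the vacuum
  vector. Applying an operator to it lists the vectors x 1 for all coefficients x of that
  operator.\<close>

definition vacuum :: "nat \<Rightarrow> nat \<Rightarrow> vac" where
  "vacuum b n = (if b = 0 \<and> n = 0 then abs_vac fone else 0)"

definition theta_op :: "nat \<Rightarrow> (nat \<Rightarrow> nat \<Rightarrow> vac) endo" where
  "theta_op m = (\<Sum>b=1..cex. mpow cex (Lbar_op + diag_of_int (sgd b)) m b b)"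

lemma series_op_const_vacuum: "app g (abs_vac fone) = 0 \<Longrightarrow> app (series_op (fps_const g)) vacuum = 0"
  by (auto simp: fun_eq_iff app_series_op_const vacuum_def)

lemma simple_root_kills:
  assumes "simple_root cex Lbar_op c q eps u (series_op (fps_const f)) (series_op (fps_const (act_E c c 0 - act_E q q 0))) h"
    and "c \<in> {1..cex}" "q \<in> {1..cex}" "app f (abs_vac fone) = 0"
  shows "app f (app (theta_op m) vacuum b n) = 0"
proof -
  interpret simple_root cex Lbar_op c q eps u "series_op (fps_const f)" "series_op (fps_const (act_E c c 0 - act_E q q 0))" h
    by (rule assms(1))
  obtain P Q where "series_op (fps_const f) * theta_op m = P * series_op (fps_const f) + Q * series_op (fps_const (act_E c c 0 - act_E q q 0))"
    using F_trace_in_left_ideal[of m] unfolding left_ideal_def theta_op_def by blast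
  then have "app (series_op (fps_const f) * theta_op m) vacuum
    = app (P * series_op (fps_const f) + Q * series_op (fps_const (act_E c c 0 - act_E q q 0))) vacuum" by simp
  moreover have "app (series_op (fps_const f)) vacuum = 0"
    using assms(4) by (rule series_op_const_vacuum)
  moreover have "app (series_op (fps_const (act_E c c 0 - act_E q q 0))) vacuum = 0"
    using act_E_vacuum[of c c 0] act_E_vacuum[of q q 0] assms(2,3) by (intro series_op_const_vacuum) simp
  ultimately have "app (series_op (fps_const f)) (app (theta_op m) vacuum) = 0"
    by simp
  then show ?thesis
    by (metis app_series_op_const zero_fun_apply)
qed

lemma finite_root_kills:
  assumes "1 \<le> c" "Suc c \<le> cex"
  shows "app (act_E (Suc c) c 0) (app (theta_op m) vacuum b n) = 0"
proof (rule simple_root_kills)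
  show "simple_root cex Lbar_op c (Suc c) 0 (series_op 1) (series_op (fps_const (act_E (Suc c) c 0)))
    (series_op (fps_const (act_E c c 0 - act_E (Suc c) (Suc c) 0))) (root_weight c (Suc c))"
  proof (rule simple_rootI)
    show "sgd c a - sgd (Suc c) a = 2 * 0 - (if a = c then 1 else 0) - (if a = Suc c then 1 else 0)" for a
      by (auto simp: sgd_def sgn_if)
    show "fps_euler (1 :: vac endo fps) = of_int 0 * 1"
      using fps_euler_const[of "1 :: vac endo"] by simp
    show "rho_int c - rho_int (Suc c) - 2 = - 0"
      by (simp add: rho_int_def)
  qed (use assms simple_root_Lplus_op[of c "Suc c"] in auto)
qed (use assms act_E_vacuum[of "Suc c" c 0] in auto)

lemma affine_root_kills:
  assumes "2 \<le> cex"
  shows "app (act_E 1 cex 1) (app (theta_op m) vacuum b n) = 0"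
proof (rule simple_root_kills)
  show "simple_root cex Lbar_op cex 1 1 (series_op fps_X) (series_op (fps_const (act_E 1 cex 1)))
    (series_op (fps_const (act_E cex cex 0 - act_E 1 1 0))) (root_weight cex 1)"
  proof (rule simple_rootI)
    show "sgd cex a - sgd 1 a = 2 * 1 - (if a = cex then 1 else 0) - (if a = 1 then 1 else 0)" if "a \<in> {1..cex}" for a
      using that assms by (auto simp: sgd_def sgn_if)
    show "f * fps_X = fps_X * f" for f :: "vac endo fps"
      by (rule fps_mult_fps_X_commute[symmetric])
    show "fps_euler (fps_X :: vac endo fps) = of_int 1 * fps_X"
      by (rule fps_ext) (simp add: fps_euler_def)
    show "rho_int cex - rho_int 1 - 2 = - (2 * int cex)"
      by (simp add: rho_int_def)
  qed (use assms affine_root_Lplus_op in auto)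
qed (use assms act_E_vacuum[of 1 cex 1] in auto)

text \<open>Diagonal entries of matrix powers have weight h b - h b = 0, so the element commutes
  with each summand of \<open>theta_op\<close>.\<close>

lemma weight_zero_kills:
  assumes "\<And>k l. k \<in> {1..cex} \<Longrightarrow> l \<in> {1..cex} \<Longrightarrow>
      series_op (fps_const g) * Lbar_op k l = Lbar_op k l * series_op (fps_const g) + of_int (h k - h l) * Lbar_op k l"
    and "app g (abs_vac fone) = 0"
  shows "app g (app (theta_op m) vacuum b n) = 0"
proof -
  have "series_op (fps_const g) * theta_op m = theta_op m * series_op (fps_const g)"
    unfolding theta_op_def sum_distrib_left sum_distrib_right
  proof (intro sum.cong refl)
    fix b assume "b \<in> {1..cex}"
    then show "series_op (fps_const g) * mpow cex (Lbar_op + diag_of_int (sgd b)) m b b = mpow cex (Lbar_op + diag_of_int (sgd b)) m b b * series_op (fps_const g)"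
      using mpow_weight[of cex "series_op (fps_const g)" Lbar_op h b b "sgd b" m, OF assms(1)] by simp
  qed
  then have "app (series_op (fps_const g) * theta_op m) vacuum = app (theta_op m * series_op (fps_const g)) vacuum" by simp
  then have "app (series_op (fps_const g)) (app (theta_op m) vacuum) = 0"
    using series_op_const_vacuum[OF assms(2)] by simp
  then show ?thesis
    by (metis app_series_op_const zero_fun_apply)
qed

lemma cartan_kills: "i \<in> {1..cex} \<Longrightarrow> app (act_E i i 0) (app (theta_op m) vacuum b n) = 0"
  by (rule weight_zero_kills[where h = "\<lambda>k. if k = i then 1 else 0"]) (auto simp: cartan_Lbar_op act_E_vacuum)

lemma center_kills: "r \<ge> 1 \<Longrightarrow> app (\<Sum>i=1..cex. act_E i i r) (app (theta_op m) vacuum b n) = 0"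
  by (rule weight_zero_kills[where h = "\<lambda>k. 0", OF center_Lbar_op]) (auto simp: app_sum_endo act_E_vacuum)

section \<open>The trace formula\<close>

lemma app_of_int_fun: "app (of_int z) Q b n = app (of_int z) (Q b n)"
  for Q :: "nat \<Rightarrow> nat \<Rightarrow> 'v::nonzero_group"
  using app_series_op_const[of "of_int z" Q b n] by (simp only: fps_of_int series_op_of_int)

definition vac_coeffs :: "dop \<Rightarrow> nat \<Rightarrow> nat \<Rightarrow> vac" where
  "vac_coeffs Q b n = abs_vac (Q b n)"

lemma abs_vac_scale_int: "p \<in> valid_alg cex \<Longrightarrow> abs_vac (fscale (of_int z) p) = app (of_int z) (abs_vac p)"
  by (simp only: abs_vac_scale app_scalar_endo[symmetric] scalar_endo_of_int)

lemma abs_vac_act_E: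
  assumes "p \<in> valid_alg cex" "i \<in> {1..cex}" "j \<in> {1..cex}"
  shows "abs_vac (fmul (fgen (E i j r)) p) = app (act_E i j r) (abs_vac p)"
  using assms by (simp add: abs_vac_fgen app_act_E)

lemma abs_vac_Lbar:
  assumes q: "q \<in> valid_alg cex" and ij: "i \<in> {1..cex}" "j \<in> {1..cex}"
  shows "abs_vac (fmul (fst (Lbar cex i j) p) q)
    = (if p = 0 \<and> i = j then - app (of_int (rho_int i)) (abs_vac q) else 0) + app (fps_nth (Lplus_op i j) p) (abs_vac q)"
proof -
  have Lp: "Lplus i j p = fscale (of_int (- Lplus_coeff i j p)) (fgen (E i j (- int p)))"
    by (simp add: Lplus_def Lplus_coeff_def sgd_def)
  have g: "fgen (E i j (- int p)) \<in> valid_alg cex"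
    using ij by (intro valid_alg_fgen) simp
  have L: "abs_vac (fmul (Lplus i j p) q) = - app (fps_nth (Lplus_op i j) p) (abs_vac q)"
    unfolding Lp fmul_scale_left
    by (subst abs_vac_scale_int) (use q ij in \<open>simp_all add: valid_alg_fmul_fgen abs_vac_act_E Lplus_op_nth\<close>)
  have rho: "- rho cex i = of_int (- rho_int i)"
    by (simp add: rho_def rho_int_def)
  define d where "d = (if p = 0 \<and> i = j then fscale (- rho cex i) fone else 0)"
  have d: "abs_vac (fmul d q) = (if p = 0 \<and> i = j then - app (of_int (rho_int i)) (abs_vac q) else 0)"
  proof (cases "p = 0 \<and> i = j")
    case True
    then have "fmul d q = fscale (of_int (- rho_int i)) q"
      unfolding d_def rho if_P[OF True] by (simp only: fmul_scale_left fone_def fmul_fone_left)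
    then show ?thesis
      using True by (simp only: abs_vac_scale_int[OF q]) simp
  qed (auto simp: d_def abs_vac_zero)
  have gd: "fmul d q \<in> valid_alg cex"
    unfolding d_def by (intro valid_alg_fmul q) (auto intro: valid_alg.scale valid_alg_fone valid_alg.zero)
  have gL: "fmul (Lplus i j p) q \<in> valid_alg cex"
    unfolding Lp by (intro valid_alg_fmul valid_alg.scale g q)
  have "fmul (fst (Lbar cex i j) p) q = fmul d q - fmul (Lplus i j p) q"
    by (simp only: Lbar_def fst_conv d_def fmul_diff_left)
  then show ?thesis
    by (simp only: abs_vac_diff[OF gd gL] d L diff_minus_eq_add)
qed

lemma smul_Lbar_snd:
  "smul (snd (Lbar N i j)) f n = (if i = j \<and> n \<ge> 1 then fscale 2 (f (n - 1)) else 0)"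
proof -
  have "smul (snd (Lbar N i j)) f n = (\<Sum>p\<le>n. if p = 1 then (if i = j then fscale 2 (f (n - 1)) else 0) else 0)"
    unfolding smul_def Lbar_def
    by (intro sum.cong refl) (auto simp: fmul_scale_left fone_def)
  then show ?thesis by (auto simp: sum.delta)
qed

lemma vac_coeffs_dmul1:
  assumes ij: "i \<in> {1..cex}" "j \<in> {1..cex}" and Q: "\<And>b n. Q b n \<in> valid_alg cex"
  shows "vac_coeffs (dmul1 (Lbar cex i j) Q) = app (Lbar_op i j) (vac_coeffs Q)"
proof (intro ext)
  fix b n
  let ?D = "app (euler + euler) (vac_coeffs Q) b n"
  have g1: "smul (fst (Lbar cex i j)) (Q b) n \<in> valid_alg cex"
    unfolding smul_def by (intro valid_alg_sum valid_alg_fmul valid_alg_Lbar ij Q)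
  have g2: "smul (snd (Lbar cex i j)) (sderiv (Q b)) n \<in> valid_alg cex"
    unfolding smul_Lbar_snd sderiv_def by (auto intro: valid_alg.scale Q valid_alg.zero)
  have g3: "(if b = 0 then 0 else smul (snd (Lbar cex i j)) (Q (b - 1)) n) \<in> valid_alg cex"
    unfolding smul_Lbar_snd by (auto intro: valid_alg.scale Q valid_alg.zero)
  have two: "abs_vac (fscale 2 p) = abs_vac p + abs_vac p" if "p \<in> valid_alg cex" for p
    using fscale_add_left[of 1 1 p] abs_vac_add[OF that that] by (simp add: fscale_one)
  have 1: "abs_vac (smul (fst (Lbar cex i j)) (Q b) n)
      = (if i = j then - app (of_int (rho_int i)) (vac_coeffs Q b n) else 0) + app (series_op (Lplus_op i j)) (vac_coeffs Q) b n"
  proof -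
    have "abs_vac (smul (fst (Lbar cex i j)) (Q b) n)
       = (\<Sum>p\<le>n. (if p = 0 then (if i = j then - app (of_int (rho_int i)) (vac_coeffs Q b n) else 0) else 0)
          + app (fps_nth (Lplus_op i j) p) (vac_coeffs Q b (n - p)))"
      unfolding smul_def
      by (subst abs_vac_sum, intro valid_alg_fmul valid_alg_Lbar ij Q, intro sum.cong refl)
        (simp only: abs_vac_Lbar[OF Q ij], simp add: vac_coeffs_def)
    then show ?thesis
      by (simp add: sum.distrib app_series_op)
  qed
  have 2: "abs_vac (smul (snd (Lbar cex i j)) (sderiv (Q b)) n)
      = (if i = j then app (of_nat n) (vac_coeffs Q b n) + app (of_nat n) (vac_coeffs Q b n) else 0)"
  proof (cases n)
    case (Suc k)
    have "abs_vac (fscale (of_nat n) (Q b n)) = app (of_nat n) (vac_coeffs Q b n)"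
      using abs_vac_scale_int[OF Q, of "int n" b n] by (simp add: vac_coeffs_def)
    then show ?thesis
      unfolding smul_Lbar_snd sderiv_def Suc
      by (auto simp: two valid_alg.scale Q abs_vac_zero)
  qed (auto simp: smul_Lbar_snd abs_vac_zero)
  have 3: "abs_vac (if b = 0 then 0 else smul (snd (Lbar cex i j)) (Q (b - 1)) n)
      = (if i = j then (if b = 0 \<or> n = 0 then 0 else vac_coeffs Q (b - 1) (n - 1) + vac_coeffs Q (b - 1) (n - 1)) else 0)"
    unfolding smul_Lbar_snd by (auto simp: two Q abs_vac_zero vac_coeffs_def)
  have "vac_coeffs (dmul1 (Lbar cex i j) Q) b n = abs_vac (smul (fst (Lbar cex i j)) (Q b) n
      + smul (snd (Lbar cex i j)) (sderiv (Q b)) n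
      + (if b = 0 then 0 else smul (snd (Lbar cex i j)) (Q (b - 1)) n))"
    by (cases "b = 0") (simp_all only: vac_coeffs_def dmul1_def plus_fun_apply zero_fun_apply if_True if_False simp_thms)
  also have "\<dots> = abs_vac (smul (fst (Lbar cex i j)) (Q b) n)
      + abs_vac (smul (snd (Lbar cex i j)) (sderiv (Q b)) n)
      + abs_vac (if b = 0 then 0 else smul (snd (Lbar cex i j)) (Q (b - 1)) n)"
    using g1 g2 g3 by (simp only: abs_vac_add valid_alg.add)
  also have "\<dots> = app (Lbar_op i j) (vac_coeffs Q) b n"
    unfolding 1 2 3 Lbar_op_def by (auto simp: app_euler app_of_int_fun)
  finally show "vac_coeffs (dmul1 (Lbar cex i j) Q) b n = app (Lbar_op i j) (vac_coeffs Q) b n" .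
qed


section \<open>Expansion of the trace into weighted paths\<close>

definition Lbar_word :: "(nat \<times> nat) list \<Rightarrow> (nat \<Rightarrow> nat \<Rightarrow> vac) endo" where
  "Lbar_word ps = prod_list (map (\<lambda>(i, j). Lbar_op i j) ps)"

lemma vac_coeffs_Lbar_prod:
  assumes "\<And>i j. (i, j) \<in> set ps \<Longrightarrow> i \<in> {1..cex} \<and> j \<in> {1..cex}"
  shows "vac_coeffs (Lbar_prod cex ps) = app (Lbar_word ps) vacuum"
  using assms
proof (induction ps)
  case Nil
  then show ?case
    by (intro ext) (simp add: Lbar_word_def vac_coeffs_def dunit_def vacuum_def abs_vac_zero)
next
  case (Cons p ps)
  obtain i j where p: "p = (i, j)" by fastforce
  have "vac_coeffs (dmul1 (Lbar cex i j) (Lbar_prod cex ps)) = app (Lbar_op i j) (vac_coeffs (Lbar_prod cex ps))"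
    by (intro vac_coeffs_dmul1 valid_alg_Lbar_prod) (use Cons.prems p in auto)
  moreover have "vac_coeffs (Lbar_prod cex ps) = app (Lbar_word ps) vacuum"
    by (rule Cons.IH, rule Cons.prems) simp
  ultimately show ?case
    by (simp add: p Lbar_word_def)
qed

text \<open>The product over the letters a of 1 / (1 - sgd c a y), a series in y: what T(y) charges
  for moving c past a. As 0^0 = 1, the factor for a = c is 1.\<close>

definition path_weight :: "nat \<Rightarrow> nat list \<Rightarrow> int fps" where
  "path_weight c js = prod_list (map (\<lambda>a. Abs_fps (\<lambda>n. sgd c a ^ n)) js)"

lemma tcoef_sgd: "tcoef a c n = of_int (sgd c a ^ n)"
  by (auto simp: tcoef_def sgd_def sgn_if)

text \<open>T(y) is the flip of two tensor factors with scalar weights, so a column M of its matrix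
  can be nonzero only in the row obtained by exchanging the two slots.\<close>

lemma Tslot_eq:
  assumes I: "I \<in> Idx N s" and M: "M \<in> Idx N s" and r: "Suc r < s"
  shows "Tslot N s (Suc r) (Suc (Suc r)) I M p
    = (if I = M[r := M ! Suc r, Suc r := M ! r] then tcoef (M ! Suc r) (M ! r) p else 0)"
proof -
  have len: "length I = s" "length M = s" and rng: "M ! r \<in> {1..N}" "M ! Suc r \<in> {1..N}"
    using I M r unfolding Idx_def by (auto simp: subset_iff)
  have eq: "I = M[r := M ! Suc r, Suc r := M ! r] \<longleftrightarrow> I ! r = M ! Suc r \<and> I ! Suc r = M ! r
      \<and> (\<forall>c<s. c \<noteq> r \<and> c \<noteq> Suc r \<longrightarrow> I ! c = M ! c)"
    (is "I = ?M \<longleftrightarrow> ?R")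
  proof
    assume "I = ?M"
    then show ?R
      using len r by simp
  next
    assume R: ?R
    show "I = ?M"
    proof (rule nth_equalityI)
      fix k assume "k < length I"
      then show "I ! k = ?M ! k"
        using R len r by (cases "k = r"; cases "k = Suc r") simp_all
    qed (simp add: len)
  qed
  have "Tslot N s (Suc r) (Suc (Suc r)) I M p = (\<Sum>i\<in>{1..N}. \<Sum>j\<in>{1..N}.
      if j = M ! r then (if i = M ! Suc r then (if I = M[r := M ! Suc r, Suc r := M ! r]
        then tcoef i j p else 0) else 0) else 0)"
    unfolding Tslot_def eq by (intro sum.cong refl) auto
  also have "\<dots> = (if I = M[r := M ! Suc r, Suc r := M ! r] then tcoef (M ! Suc r) (M ! r) p else 0)"
    using rng by (simp add: sum.delta)
  finally show ?thesis .
qed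

lemma finite_Idx: "finite (Idx N s)"
proof -
  have "Idx N s = {K. set K \<subseteq> {1..N} \<and> length K = s}" by (auto simp: Idx_def)
  then show ?thesis by (simp add: finite_lists_length_eq)
qed

text \<open>T_12 acts first; the successive factors carry the first letter c to the right one slot
  at a time, gathering the weight of every letter it passes.\<close>

lemma Tchain_eq:
  assumes J: "c # js \<in> Idx N s" and r: "r \<le> length js" and I: "I \<in> Idx N s"
  shows "Tchain N s r I (c # js) n
    = (if I = take r js @ c # drop r js then of_int (fps_nth (path_weight c (take r js)) n) else 0)"
  using r I
proof (induction r arbitrary: I n)
  case 0
  then show ?case by (auto simp: yid_def path_weight_def)
next
  case (Suc r)
  define M where "M = take r js @ c # drop r js"
  define a where "a = js ! r"
  have js: "length js = s - 1" "s > 0" "set js \<subseteq> {1..N}" "c \<in> {1..N}"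
    using J by (auto simp: Idx_def)
  have r: "r < length js" "Suc r < s"
    using Suc.prems js by auto
  have "set (take r js) \<union> set (drop r js) \<subseteq> {1..N}"
    using js(3) set_take_subset[of r js] set_drop_subset[of r js] by blast
  then have M: "M \<in> Idx N s"
    using js r by (simp add: Idx_def M_def)
  have drop: "drop r js = a # drop (Suc r) js" and take: "take (Suc r) js = take r js @ [a]"
    using r by (simp_all add: a_def Cons_nth_drop_Suc take_Suc_conv_app_nth)
  have Mr: "M ! r = c" "M ! Suc r = a"
    using r by (simp_all add: M_def drop nth_append)
  have upd: "M[r := M ! Suc r, Suc r := M ! r] = take (Suc r) js @ c # drop (Suc r) js"
    unfolding Mr using r by (simp add: M_def drop take list_update_append)
  have "Tchain N s (Suc r) I (c # js) n = (\<Sum>K\<in>Idx N s. if K = M then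
      \<Sum>p\<le>n. Tslot N s (Suc r) (Suc (Suc r)) I M p * of_int (fps_nth (path_weight c (take r js)) (n - p)) else 0)"
    unfolding Tchain.simps ymul_def using Suc.IH r
    by (intro sum.cong refl) (auto simp: M_def)
  also have "\<dots> = (\<Sum>p\<le>n. Tslot N s (Suc r) (Suc (Suc r)) I M p * of_int (fps_nth (path_weight c (take r js)) (n - p)))"
    using M by (simp add: finite_Idx)
  also have "\<dots> = (if I = take (Suc r) js @ c # drop (Suc r) js then
      of_int (\<Sum>p\<le>n. sgd c a ^ p * fps_nth (path_weight c (take r js)) (n - p)) else 0)"
    unfolding Tslot_eq[OF Suc.prems(2) M r(2)] upd by (simp add: Mr tcoef_sgd)
  also have "(\<Sum>p\<le>n. sgd c a ^ p * fps_nth (path_weight c (take r js)) (n - p)) = fps_nth (path_weight c (take (Suc r) js)) n"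
    unfolding take by (simp add: path_weight_def mult.commute[of _ "Abs_fps _"] fps_mult_nth atLeast0AtMost)
  finally show ?case .
qed

lemma Idx_Suc: "Idx N (Suc t) = (\<lambda>(c, js). c # js) ` ({1..N} \<times> Idx N t)"
  by (auto simp: Idx_def length_Suc_conv image_iff)

lemma sum_Idx_Suc: "(\<Sum>J\<in>Idx N (Suc t). f J) = (\<Sum>c=1..N. \<Sum>js\<in>Idx N t. f (c # js))"
proof -
  have "inj_on (\<lambda>(c, js). c # js) ({1..N} \<times> Idx N t)"
    by (auto simp: inj_on_def)
  then show ?thesis
    unfolding Idx_Suc sum.cartesian_product by (subst sum.reindex) (auto intro!: sum.cong)
qed

text \<open>Paths from i to c with t inner vertices, hence t + 1 factors L, weighted by the
  coefficient of y^n. The trace uses i = c only; a free start i permits a recursion on the first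
  step.\<close>

definition path_sum :: "nat \<Rightarrow> nat \<Rightarrow> nat \<Rightarrow> nat \<Rightarrow> (nat \<Rightarrow> nat \<Rightarrow> vac) endo" where
  "path_sum c t n i = (\<Sum>js\<in>Idx cex t. of_int (fps_nth (path_weight c js) n) * Lbar_word (zip (i # js) (js @ [c])))"

lemma vac_coeffs_trace_coef:
  "abs_vac (trace_coef cex (Suc t) n b r) = app (\<Sum>c=1..cex. path_sum c t n c) vacuum b r"
proof -
  let ?S = "Idx cex (Suc t)"
  define Z where "Z J = of_int (fps_nth (path_weight (hd J) (tl J)) n) * Lbar_word (zip J (tl J @ [hd J]))" for J
  have valid_alg: "Lbar_prod cex (zip J I) b r \<in> valid_alg cex"
    and vac_coeffs: "abs_vac (Lbar_prod cex (zip J I) b r) = app (Lbar_word (zip J I)) vacuum b r"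
    if "I \<in> ?S" "J \<in> ?S" for I J
  proof -
    have v: "\<And>i j. (i, j) \<in> set (zip J I) \<Longrightarrow> i \<in> {1..cex} \<and> j \<in> {1..cex}"
      using that by (auto simp: Idx_def dest: set_zip_leftD set_zip_rightD)
    show "Lbar_prod cex (zip J I) b r \<in> valid_alg cex"
      using v by (rule valid_alg_Lbar_prod)
    show "abs_vac (Lbar_prod cex (zip J I) b r) = app (Lbar_word (zip J I)) vacuum b r"
      using vac_coeffs_Lbar_prod[OF v] by (metis vac_coeffs_def)
  qed
  have "abs_vac (trace_coef cex (Suc t) n b r)
    = (\<Sum>I\<in>?S. \<Sum>J\<in>?S. abs_vac (fscale (Tchain cex (Suc t) t I J n) (Lbar_prod cex (zip J I) b r)))"
    unfolding trace_coef_def sum_fun_apply dscale_def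
    by (simp add: abs_vac_sum valid_alg_sum valid_alg.scale valid_alg)
  \<comment> \<open>After the full chain of T factors the row index is the cyclic rotation of J,
    which leaves a single sum over closed paths.\<close>
  also have "\<dots> = (\<Sum>J\<in>?S. \<Sum>I\<in>?S. if I = tl J @ [hd J] then app (Z J) vacuum b r else 0)"
  proof (subst sum.swap, intro sum.cong refl)
    fix I J assume IJ: "I \<in> ?S" "J \<in> ?S"
    then obtain c js where J: "J = c # js" "length js = t"
      by (auto simp: Idx_def length_Suc_conv)
    show "abs_vac (fscale (Tchain cex (Suc t) t I J n) (Lbar_prod cex (zip J I) b r))
      = (if I = tl J @ [hd J] then app (Z J) vacuum b r else 0)"
    proof (cases "I = js @ [c]")
      case True
      then have "Tchain cex (Suc t) t I J n = of_int (fps_nth (path_weight c js) n)"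
        using Tchain_eq[of c js cex "Suc t" t I n] IJ J by simp
      then have "abs_vac (fscale (Tchain cex (Suc t) t I J n) (Lbar_prod cex (zip J I) b r))
          = app (of_int (fps_nth (path_weight c js) n)) (app (Lbar_word (zip J I)) vacuum b r)"
        by (simp only: abs_vac_scale_int[OF valid_alg[OF IJ]] vac_coeffs[OF IJ])
      then show ?thesis
        using True J by (simp add: Z_def app_of_int_fun)
    next
      case False
      then have "Tchain cex (Suc t) t I J n = 0"
        using Tchain_eq[of c js cex "Suc t" t I n] IJ J by simp
      moreover have "fscale 0 p = 0" for p
        by (simp add: fscale_def fun_eq_iff)
      ultimately show ?thesis
        using False J by (simp add: abs_vac_zero)
    qed
  qed
  also have "\<dots> = (\<Sum>J\<in>?S. app (Z J) vacuum b r)"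
  proof (intro sum.cong refl)
    fix J assume "J \<in> ?S"
    then have "tl J @ [hd J] \<in> ?S"
      by (cases J) (auto simp: Idx_def)
    then show "(\<Sum>I\<in>?S. if I = tl J @ [hd J] then app (Z J) vacuum b r else 0) = app (Z J) vacuum b r"
      by (simp add: finite_Idx)
  qed
  also have "\<dots> = app (\<Sum>J\<in>?S. Z J) vacuum b r"
    by (simp add: app_sum_endo sum_fun_apply)
  also have "(\<Sum>J\<in>?S. Z J) = (\<Sum>c=1..cex. path_sum c t n c)"
    unfolding sum_Idx_Suc path_sum_def Z_def by simp
  finally show ?thesis .
qed

lemma path_sum_0: "path_sum c 0 n i = (if n = 0 then Lbar_op i c else 0)"
proof -
  have "Idx cex 0 = {[]}" by (auto simp: Idx_def)
  then show ?thesis by (simp add: path_sum_def path_weight_def Lbar_word_def)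
qed

lemma path_sum_Suc:
  "path_sum c (Suc t) n i = (\<Sum>p\<le>n. \<Sum>k=1..cex. Lbar_op i k * (of_int (sgd c k ^ p) * path_sum c t (n - p) k))"
proof -
  have "path_sum c (Suc t) n i = (\<Sum>k=1..cex. \<Sum>js\<in>Idx cex t. \<Sum>p\<le>n.
      Lbar_op i k * (of_int (sgd c k ^ p) * (of_int (fps_nth (path_weight c js) (n - p)) * Lbar_word (zip (k # js) (js @ [c])))))"
    unfolding path_sum_def sum_Idx_Suc
  proof (intro sum.cong refl)
    fix k js
    have path_weight: "fps_nth (path_weight c (k # js)) n = (\<Sum>p\<le>n. sgd c k ^ p * fps_nth (path_weight c js) (n - p))"
      by (simp add: path_weight_def fps_mult_nth atLeast0AtMost)
    show "of_int (fps_nth (path_weight c (k # js)) n) * Lbar_word (zip (i # k # js) ((k # js) @ [c]))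
      = (\<Sum>p\<le>n. Lbar_op i k * (of_int (sgd c k ^ p) * (of_int (fps_nth (path_weight c js) (n - p)) * Lbar_word (zip (k # js) (js @ [c])))))"
      unfolding path_weight of_int_sum sum_distrib_right
      by (intro sum.cong refl) (simp only: of_int_mult mult.assoc Lbar_word_def append_Cons zip_Cons_Cons list.map
          prod_list.Cons case_prod_conv of_int_left_commute[of "Lbar_op i k"])
  qed
  also have "\<dots> = (\<Sum>k=1..cex. \<Sum>p\<le>n. \<Sum>js\<in>Idx cex t.
      Lbar_op i k * (of_int (sgd c k ^ p) * (of_int (fps_nth (path_weight c js) (n - p)) * Lbar_word (zip (k # js) (js @ [c])))))"
    by (intro sum.cong refl sum.swap)
  also have "\<dots> = (\<Sum>p\<le>n. \<Sum>k=1..cex. Lbar_op i k * (of_int (sgd c k ^ p) * path_sum c t (n - p) k))"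
    unfolding path_sum_def sum_distrib_left by (rule sum.swap)
  finally show ?thesis .
qed

lemma sum_triangle_swap:
  "(\<Sum>n\<le>M. \<Sum>t\<le>M - n. f n t) = (\<Sum>t\<le>M. \<Sum>n\<le>M - t. f n t)" for M :: nat
proof -
  have "(\<Sum>n\<le>M. \<Sum>t\<le>M - n. f n t) = (\<Sum>n\<le>M. \<Sum>t\<le>M. if n + t \<le> M then f n t else 0)"
    by (intro sum.cong refl sum.mono_neutral_cong_left) auto
  also have "\<dots> = (\<Sum>t\<le>M. \<Sum>n\<le>M. if n + t \<le> M then f n t else 0)"
    by (rule sum.swap)
  also have "\<dots> = (\<Sum>t\<le>M. \<Sum>n\<le>M - t. f n t)"
    by (intro sum.cong refl sum.mono_neutral_cong_right) auto
  finally show ?thesis .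
qed

text \<open>Expand the power into words in L and S_c. A run of n factors S_c at a vertex k gives sgd
  c k ^ n, the coefficient of y^n in the weight of k. Each term has m + 1 factors in all: t + 1
  factors L and m - t factors S_c.\<close>

lemma mpow_eq_path_sum:
  fixes m :: nat
  assumes c: "c \<in> {1..cex}"
  shows "(\<Sum>k=1..cex. Lbar_op i k * mpow cex (Lbar_op + diag_of_int (sgd c)) m k c) = (\<Sum>t\<le>m. path_sum c t (m - t) i)"
proof (induction m arbitrary: i rule: less_induct)
  case (less m)
  define T where "T m k = mpow cex (Lbar_op + diag_of_int (sgd c)) m k c" for m k
  define U where "U m i = (\<Sum>k=1..cex. Lbar_op i k * T m k)" for m i
  have TS: "T (Suc m) k = U m k + of_int (sgd c k) * T m k" if "k \<in> {1..cex}" for m k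
    unfolding T_def U_def by (rule mpow_Suc_diag_of_int[OF that])
  have T: "T m k = (if m = 0 \<and> k = c then 1 else 0) + (\<Sum>n<m. of_int (sgd c k ^ n) * U (m - Suc n) k)"
    if k: "k \<in> {1..cex}" for m k
  proof (induction m)
    case 0
    then show ?case by (simp add: T_def)
  next
    case (Suc m)
    \<comment> \<open>A path may end in no factor S_c, because sgd c c = 0. This agrees with the
      absence of a weight at the endpoint in \<open>path_sum\<close>.\<close>
    have "of_int (sgd c k) * (if m = 0 \<and> k = c then 1 else 0) = (0 :: (nat \<Rightarrow> nat \<Rightarrow> vac) endo)"
      by auto
    then have "T (Suc m) k = U m k + (\<Sum>n<m. of_int (sgd c k ^ Suc n) * U (m - Suc n) k)"
      unfolding TS[OF k] Suc by (simp add: distrib_left sum_distrib_left mult.assoc)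
    then show ?case
      by (simp add: sum.lessThan_Suc_shift del: sum.lessThan_Suc)
  qed
  have "(\<Sum>k=1..cex. Lbar_op i k * T m k) = (\<Sum>t\<le>m. path_sum c t (m - t) i)"
  proof (cases m)
    case 0
    have "(\<Sum>k=1..cex. Lbar_op i k * T 0 k) = (\<Sum>k=1..cex. Lbar_op i k * (if k = c then 1 else 0))"
      by (simp add: T_def)
    also have "\<dots> = Lbar_op i c * 1"
      by (rule sum_delta_mult_right[OF c])
    finally show ?thesis
      by (simp add: 0 path_sum_0)
  next
    case (Suc M)
    have "(\<Sum>k=1..cex. Lbar_op i k * T m k)
      = (\<Sum>k=1..cex. Lbar_op i k * (\<Sum>n\<le>M. of_int (sgd c k ^ n) * (\<Sum>t\<le>M - n. path_sum c t (M - n - t) k)))"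
    proof (intro sum.cong refl arg_cong[where f = "(*) _"])
      fix k assume "k \<in> {1..cex}"
      then have "T m k = (\<Sum>n<m. of_int (sgd c k ^ n) * U (m - Suc n) k)"
        using T[of k m] Suc by simp
      also have "\<dots> = (\<Sum>n\<le>M. of_int (sgd c k ^ n) * U (M - n) k)"
        by (simp add: Suc lessThan_Suc_atMost)
      also have "\<dots> = (\<Sum>n\<le>M. of_int (sgd c k ^ n) * (\<Sum>t\<le>M - n. path_sum c t (M - n - t) k))"
        unfolding U_def T_def using Suc by (intro sum.cong refl arg_cong[where f = "(*) _"] less.IH) simp
      finally show "T m k = \<dots>" .
    qed
    also have "\<dots> = (\<Sum>n\<le>M. \<Sum>t\<le>M - n. \<Sum>k=1..cex. Lbar_op i k * (of_int (sgd c k ^ n) * path_sum c t (M - n - t) k))"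
      unfolding sum_distrib_left by (subst sum.swap, rule sum.cong[OF refl], rule sum.swap)
    also have "\<dots> = (\<Sum>t\<le>M. \<Sum>n\<le>M - t. \<Sum>k=1..cex. Lbar_op i k * (of_int (sgd c k ^ n) * path_sum c t (M - t - n) k))"
      by (subst sum_triangle_swap) (simp add: add.commute)
    also have "\<dots> = (\<Sum>t\<le>M. path_sum c (Suc t) (M - t) i)"
      by (simp only: path_sum_Suc)
    also have "\<dots> = (\<Sum>t\<le>m. path_sum c t (m - t) i)"
      unfolding Suc sum.atMost_Suc_shift by (simp add: path_sum_0)
    finally show ?thesis .
  qed
  then show ?case
    by (simp only: T_def)
qed

lemma abs_vac_theta:
  assumes "m \<ge> 1"
  shows "abs_vac (theta cex m b r) = app (theta_op m) vacuum b r"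
proof -
  obtain M where m: "m = Suc M" using assms by (cases m) auto
  have g: "trace_coef cex s n b r \<in> valid_alg cex" for s n
  proof -
    have "Lbar_prod cex (zip J I) b r \<in> valid_alg cex" if "I \<in> Idx cex s" "J \<in> Idx cex s" for I J
      using that by (intro valid_alg_Lbar_prod) (auto simp: Idx_def dest: set_zip_leftD set_zip_rightD)
    then show ?thesis
      unfolding trace_coef_def sum_fun_apply dscale_def by (intro valid_alg_sum valid_alg.scale)
  qed
  have "abs_vac (theta cex m b r) = (\<Sum>s\<in>{1..m}. abs_vac (trace_coef cex s (m - s) b r))"
    unfolding theta_def sum_fun_apply by (intro abs_vac_sum g)
  also have "\<dots> = (\<Sum>t\<le>M. abs_vac (trace_coef cex (Suc t) (M - t) b r))"
    unfolding m by (rule sum.reindex_bij_witness[of _ Suc "\<lambda>s. s - 1"]) auto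
  also have "\<dots> = app (\<Sum>t\<le>M. \<Sum>c=1..cex. path_sum c t (M - t) c) vacuum b r"
    unfolding vac_coeffs_trace_coef by (simp add: app_sum_endo sum_fun_apply)
  also have "(\<Sum>t\<le>M. \<Sum>c=1..cex. path_sum c t (M - t) c) = (\<Sum>c=1..cex. \<Sum>t\<le>M. path_sum c t (M - t) c)"
    by (rule sum.swap)
  also have "\<dots> = theta_op m"
    unfolding theta_op_def m
  proof (intro sum.cong refl)
    fix c assume c: "c \<in> {1..cex}"
    \<comment> \<open>The first factor of (L + S_c)^m in row c is L alone, again because sgd c c =
      0.\<close>
    show "(\<Sum>t\<le>M. path_sum c t (M - t) c) = mpow cex (Lbar_op + diag_of_int (sgd c)) (Suc M) c c"
      unfolding mpow_Suc_diag_of_int[OF c] mpow_eq_path_sum[OF c] by simp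
  qed
  finally show ?thesis .
qed

section \<open>Generation of the annihilating subalgebra\<close>

lemma app_of_nat_cancel:
  fixes v :: vac
  assumes "app (of_nat n) v = 0" "n > 0"
  shows "v = 0"
proof -
  have "scalar_endo (1 / of_nat n) * of_nat n = 1"
    using assms(2) by (simp flip: scalar_endo_of_nat scalar_endo_mult)
  then have "v = app (scalar_endo (1 / of_nat n)) (app (of_nat n) v)"
    by (metis app_one app_times)
  then show ?thesis
    using assms(1) by simp
qed

lemma sum_const_app: "(\<Sum>k=1..n. v) = app (of_nat n) v" for v :: vac
  by (induction n) simp_all

context
  fixes x :: vac
  assumes low: "\<And>j. 1 \<le> j \<Longrightarrow> Suc j \<le> cex \<Longrightarrow> app (act_E (Suc j) j 0) x = 0"
    and aff: "2 \<le> cex \<Longrightarrow> app (act_E 1 cex 1) x = 0"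
    and cart: "\<And>i. i \<in> {1..cex} \<Longrightarrow> app (act_E i i 0) x = 0"
    and cent: "\<And>r. r \<ge> 1 \<Longrightarrow> app (\<Sum>i=1..cex. act_E i i r) x = 0"
begin

text \<open>The annihilator of a vector is closed under commutators. Between nonnegative modes the
  central term never appears: r + s = 0 forces r = 0.\<close>

lemma annihilator_bracket:
  assumes "i \<in> {1..cex}" "j \<in> {1..cex}" "k \<in> {1..cex}" "l \<in> {1..cex}"
    and "r \<ge> 0" "s \<ge> 0" "app (act_E i j r) x = 0" "app (act_E k l s) x = 0"
  shows "(if k = j then app (act_E i l (r + s)) x else 0) = (if i = l then app (act_E k j (r + s)) x else 0)"
proof -
  have z: "(if r + s = 0 then of_int r * c else 0) = 0" for c :: "vac endo"
  proof -
    have "r + s = 0 \<Longrightarrow> r = 0" using assms(5,6) by simp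
    then show ?thesis by auto
  qed
  have "app (act_E i j r * act_E k l s - act_E k l s * act_E i j r) x = 0"
    using assms(7,8) by simp
  then have "app ((if k = j then act_E i l (r + s) else 0) - (if i = l then act_E k j (r + s) else 0)) x = 0"
    unfolding act_E_commutator[OF assms(1-4)] z by simp
  then show ?thesis
    by (simp split: if_splits)
qed

text \<open>Brackets of root vectors yield only differences of diagonal elements. Once these vanish,
  the central element, being the sum of all diagonal elements, determines the common value, which is
  0 after division by N.\<close>

lemma annihilator_diagonal:
  assumes "r \<ge> 1" "i \<in> {1..cex}"
    and eq: "\<And>j. j \<in> {1..cex} \<Longrightarrow> app (act_E j j r) x = app (act_E i i r) x"
  shows "app (act_E i i r) x = 0"
proof -
  have "(\<Sum>j=1..cex. app (act_E i i r) x) = (\<Sum>j=1..cex. app (act_E j j r) x)"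
    using eq by (intro sum.cong) auto
  also have "\<dots> = 0"
    using cent[OF assms(1)] by (simp add: app_sum_endo)
  finally have "app (of_nat cex) (app (act_E i i r) x) = 0"
    by (simp only: sum_const_app)
  then show ?thesis
    by (rule app_of_nat_cancel) (use assms(2) in simp)
qed

lemma annihilator_lower:
  assumes "1 \<le> j" "j < i" "i \<le> cex"
  shows "app (act_E i j 0) x = 0"
proof -
  have "Suc j \<le> i" using assms by simp
  then show ?thesis
    using assms(3)
  proof (induction i rule: dec_induct)
    case base
    then show ?case using low[of j] assms(1) by simp
  next
    case (step i)
    then show ?case
      using annihilator_bracket[of "Suc i" i i j 0 0] low[of i] assms(1) by simp
  qed
qed

text \<open>Lower triangular zero modes spread E_1N[1] over the matrix: brackets with E_k1[0] reach
  the last column above the corner, brackets with E_Nl[0] the off-diagonal entries of rows k < N.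
  The last row comes from [E_Nj[0], E_jj[1]], so it has to wait for the diagonal.\<close>

lemma annihilator_one:
  assumes "i \<in> {1..cex}" "j \<in> {1..cex}"
  shows "app (act_E i j 1) x = 0"
proof -
  have last: "app (act_E k cex 1) x = 0" if "1 \<le> k" "k < cex" for k
  proof (cases "k = 1")
    case True
    then show ?thesis using aff that by simp
  next
    case False
    then show ?thesis
      using annihilator_bracket[of k 1 1 cex 0 1] annihilator_lower[of 1 k] aff that by simp
  qed
  have off: "app (act_E k l 1) x = 0" if "1 \<le> k" "k < cex" "l \<in> {1..cex}" "l \<noteq> k" for k l
  proof (cases "l = cex")
    case True
    then show ?thesis using last that by simp
  next
    case False
    then show ?thesis
      using annihilator_bracket[of k cex cex l 1 0] last[of k] annihilator_lower[of l cex] that by simp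
  qed
  have less: "app (act_E k k 1) x = app (act_E l l 1) x" if "1 \<le> l" "l < k" "k \<le> cex" for k l
    using annihilator_bracket[of k l l k 0 1] annihilator_lower[of l k] off[of l k] that by simp
  have diag: "app (act_E k k 1) x = 0" if "k \<in> {1..cex}" for k
  proof (rule annihilator_diagonal[OF _ that])
    fix l assume "l \<in> {1..cex}"
    then show "app (act_E l l 1) x = app (act_E k k 1) x"
      using less[of k l] less[of l k] that by (cases k l rule: linorder_cases) auto
  qed simp
  show ?thesis
  proof (cases "i = j")
    case True
    then show ?thesis using diag assms by simp
  next
    case ij: False
    show ?thesis
    proof (cases "i = cex")
      case True
      then show ?thesis
        using annihilator_bracket[of i j j j 0 1] annihilator_lower[of j i] diag[of j] ij assms by simp
    next
      case False
      then show ?thesis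
        using off[of i j] ij assms by simp
    qed
  qed
qed

text \<open>Bracketing with all elements of mode 1 raises the mode by one; the diagonal again needs
  the central elements.\<close>

lemma annihilator_positive:
  assumes "i \<in> {1..cex}" "j \<in> {1..cex}"
  shows "app (act_E i j (1 + int n)) x = 0"
  using assms
proof (induction n arbitrary: i j)
  case 0
  then show ?case using annihilator_one by simp
next
  case (Suc n)
  have r: "1 + (1 + int n) = 1 + int (Suc n)" by simp
  have off: "app (act_E k l (1 + int (Suc n))) x = 0" if "k \<in> {1..cex}" "l \<in> {1..cex}" "k \<noteq> l" for k l
    using annihilator_bracket[of k k k l 1 "1 + int n"] annihilator_one[of k k] Suc.IH[of k l] that
    unfolding r by simp
  have diag: "app (act_E l l (1 + int (Suc n))) x = app (act_E k k (1 + int (Suc n))) x"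
    if "k \<in> {1..cex}" "l \<in> {1..cex}" for k l
    using annihilator_bracket[of l k k l 1 "1 + int n"] annihilator_one[of l k] Suc.IH[of k l] that
    unfolding r by simp
  show ?case
  proof (cases "i = j")
    case True
    have "app (act_E j j (1 + int (Suc n))) x = 0"
      by (rule annihilator_diagonal[OF _ Suc.prems(2) diag[OF Suc.prems(2)]]) simp_all
    then show ?thesis using True by simp
  next
    case False
    then show ?thesis using off Suc.prems by simp
  qed
qed

lemma annihilator_all:
  assumes "i \<in> {1..cex}" "j \<in> {1..cex}" "r \<ge> 1 \<or> r = 0 \<and> j \<le> i"
  shows "app (act_E i j r) x = 0"
proof (cases "r \<ge> 1")
  case True
  then have "r = 1 + int (nat (r - 1))" by simp
  then show ?thesis
    using annihilator_positive[OF assms(1,2), of "nat (r - 1)"] by simp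
next
  case False
  then show ?thesis
    using assms annihilator_lower[of j i] cart[of i] by (cases "i = j") auto
qed

end

lemma in_ztr_cex:
  assumes "m \<ge> 1"
  shows "in_ztr cex (theta_k cex m k r)"
proof -
  let ?x = "theta_k cex m k r"
  have x: "abs_vac ?x = app (theta_op m) vacuum (m - k) r"
    unfolding theta_k_def by (rule abs_vac_theta[OF assms])
  have kill: "fmul (fgen (E i j s)) ?x \<in> vac_ideal cex"
    if "i \<in> {1..cex}" "j \<in> {1..cex}" "s \<ge> 1 \<or> s = 0 \<and> j \<le> i" for i j s
  proof -
    have "app (act_E i j s) (abs_vac ?x) = 0"
      unfolding x
      by (rule annihilator_all)
        (use that finite_root_kills affine_root_kills cartan_kills center_kills in auto)
    moreover have v: "valid_gen cex (E i j s)"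
      using that by simp
    ultimately have "abs_vac (fmul (fgen (E i j s)) ?x) = 0"
      using abs_vac_fgen[OF valid_alg_theta v] by (simp only: app_act_E)
    then show ?thesis
      by (subst (asm) abs_vac_eq_0_iff) (intro valid_alg_fmul_fgen valid_alg_theta v)
  qed
  then show ?thesis
    unfolding in_ztr_def by simp
qed

theorem theorem4p2:
  fixes N m k :: nat
  assumes "N \<ge> 1" and "1 \<le> m" and "k \<le> m"
  shows "\<forall>r. in_ztr N (theta_k N m k r)"
proof (rule ccontr)
  assume "\<not> (\<forall>r. in_ztr N (theta_k N m k r))"
  then have "counterexample N"
    using assms unfolding counterexample_def by blast
  \<comment> \<open>Failure for the given N means that some rank fails, and then so does the rank
    \<open>cex\<close>; its failing m, k, r replace the given ones.\<close>
  then obtain m k r where "1 \<le> m" "\<not> in_ztr cex (theta_k cex m k r)"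
    using counterexampleI unfolding counterexample_def by blast
  then show False
    using in_ztr_cex by blast
qed

end
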